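(* Let $K$ be an algebraically closed field of characteristic zero. For each $k \in \{2,3,4,5\}$, the map $\tilde{\tau}_{k,2} : P_k \to \mathbb{A}^{(k+1)+(k^2+1)}$, $[\phi] \mapsto (\boldsymbol\sigma_1,\boldsymbol\sigma_2)$, is generically one-to-one; that is, $\deg(\tilde{\tau}_{k,2}) = 1$, meaning that for a generic point $Q$ in the image $\tilde{\tau}_{k,2}(P_k)$ the fiber $\tilde{\tau}_{k,2}^{-1}(Q) \subset P_k$ consists of exactly one point.
   Context: Work over an algebraically closed field $K$ of characteristic zero. $\mathrm{Hom}_d$ is the space of degree $d$ endomorphisms of $\mathbb{P}^1$, on which $\mathrm{PGL}_2$ acts by conjugation, and $M_d = \mathrm{Hom}_d/\mathrm{PGL}_2$ is the moduli space; $[\phi]$ denotes the conjugacy class of $\phi$. A polynomial map is a morphism of $\mathbb{P}^1$ with a totally ramified fixed point, and $P_d \subset M_d$ is the locus of conjugacy classes of polynomial maps of degree $d$. For $\phi\in \mathrm{Hom}_d$ let $\mathrm{Per}_n(\phi) = \{P \in \mathbb{P}^1 : \phi^n(P)=P\}$, where $\phi^n$ is the $n$-th iterate. For $P \in \mathrm{Per}_n(\phi)$ the multiplier $\lambda_P(\phi)$ is the scalar by which $\phi^n$ acts on the cotangent space of $\mathbb{P}^1$ at $P$ (equal to $(\phi^n)'(P)$ in a local coordinate). The $n$-multiplier spectrum $\Lambda_n$ is the multiset of the $d^n+1$ multipliers $\lambda_P(\phi)$, $P\in\mathrm{Per}_n(\phi)$, each point counted with its multiplicity as a fixed point of $\phi^n$.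 For $1\le i\le d^n+1$, $\sigma_{n,i}$ is the $i$-th elementary symmetric function of $\Lambda_n$, and $\boldsymbol\sigma_n = (\sigma_{n,1},\ldots,\sigma_{n,d^n+1})$. These are conjugation invariant and are regular functions on $M_d$. "Generic" means for all points in a nonempty (dense) Zariski open subset of the image. *)

theory Defs
  imports
    "HOL-Computational_Algebra.Polynomial"
    "HOL-Library.Multiset"
    "HOL-Library.Poly_Mapping"
begin

section \<open>The projective line and its endomorphisms\<close>

datatype 'a P1 = Fin 'a | Infty

text \<open>
  The map given by the homogeneous forms of degree \<open>d = max (degree p) (degree q)\<close> whose
  dehomogenisations are \<open>p\<close> and \<open>q\<close>.  The forms have no common zero, so that they define a
  morphism of degree \<open>d\<close>, iff \<open>p\<close> and \<open>q\<close> are coprime.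
\<close>

fun ratmap :: "'a::field poly \<Rightarrow> 'a poly \<Rightarrow> 'a P1 \<Rightarrow> 'a P1" where
  "ratmap p q (Fin z) = (if poly q z = 0 then Infty else Fin (poly p z / poly q z))"
| "ratmap p q Infty =
     (let d = max (degree p) (degree q)
      in if coeff q d = 0 then Infty else Fin (coeff p d / coeff q d))"

text \<open>
  Over an infinite field a morphism of the projective line is determined by its values on points,
  so morphisms are identified with functions on points.
\<close>

definition Hom_deg :: "nat \<Rightarrow> ('a::field P1 \<Rightarrow> 'a P1) set" where
  "Hom_deg d = {ratmap p q | p q. coprime p q \<and> max (degree p) (degree q) = d}"

text \<open>
  A representation in lowest terms, unique up to a common nonzero scalar; all uses below are
  independent of this scalar.
\<close>

definition lowest_terms :: "('a::field P1 \<Rightarrow> 'a P1) \<Rightarrow> 'a poly \<times> 'a poly" where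
  "lowest_terms f = (SOME (p, q). coprime p q \<and> f = ratmap p q)"

text \<open>The coordinate change \<open>z \<mapsto> 1 / z\<close>; local notions at \<open>Infty\<close> are read off at \<open>0\<close> through it.\<close>

fun flip :: "'a::field P1 \<Rightarrow> 'a P1" where
  "flip (Fin z) = (if z = 0 then Infty else Fin (1 / z))"
| "flip Infty = Fin 0"

definition PGL2 :: "('a::field P1 \<Rightarrow> 'a P1) set" where
  "PGL2 = {ratmap [:b, a:] [:d, c:] | a b c d. a * d - b * c \<noteq> 0}"


section \<open>Moduli of endomorphisms and of polynomial maps\<close>

definition conj_rel :: "nat \<Rightarrow> (('a::field P1 \<Rightarrow> 'a P1) \<times> ('a P1 \<Rightarrow> 'a P1)) set" where
  "conj_rel d = {(f, g). f \<in> Hom_deg d \<and> g \<in> Hom_deg d \<and> (\<exists>s\<in>PGL2. g = inv s \<circ> f \<circ> s)}"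

definition moduli :: "nat \<Rightarrow> ('a::field P1 \<Rightarrow> 'a P1) set set" where
  "moduli d = Hom_deg d // conj_rel d"

definition ram_index_fin :: "('a::field P1 \<Rightarrow> 'a P1) \<Rightarrow> 'a \<Rightarrow> nat" where
  "ram_index_fin f z =
     (let (p, q) = lowest_terms f
      in case f (Fin z) of Fin w \<Rightarrow> order z (p - smult w q) | Infty \<Rightarrow> order z q)"

definition ram_index :: "('a::field P1 \<Rightarrow> 'a P1) \<Rightarrow> 'a P1 \<Rightarrow> nat" where
  "ram_index f P = (case P of Fin z \<Rightarrow> ram_index_fin f z | Infty \<Rightarrow> ram_index_fin (f \<circ> flip) 0)"

definition polynomial_map :: "nat \<Rightarrow> ('a::field P1 \<Rightarrow> 'a P1) \<Rightarrow> bool" where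
  "polynomial_map d f \<longleftrightarrow> f \<in> Hom_deg d \<and> (\<exists>P. f P = P \<and> ram_index f P = d)"

definition poly_moduli :: "nat \<Rightarrow> ('a::field P1 \<Rightarrow> 'a P1) set set" where
  "poly_moduli d = {c \<in> moduli d. \<exists>f\<in>c. polynomial_map d f}"


section \<open>Multiplier spectra\<close>

definition Per :: "nat \<Rightarrow> ('a P1 \<Rightarrow> 'a P1) \<Rightarrow> 'a P1 set" where
  "Per n f = {P. (f ^^ n) P = P}"

text \<open>The derivative at \<open>z\<close> of \<open>p / q\<close>; only meaningful if \<open>f (Fin z) \<noteq> Infty\<close>.\<close>

definition deriv_fin :: "('a::field P1 \<Rightarrow> 'a P1) \<Rightarrow> 'a \<Rightarrow> 'a" where
  "deriv_fin f z =
     (let (p, q) = lowest_terms f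
      in (poly (pderiv p) z * poly q z - poly p z * poly (pderiv q) z) / (poly q z)\<^sup>2)"

text \<open>The multiplier of \<open>g\<close> at a fixed point of \<open>g\<close>.\<close>

definition fix_multiplier :: "('a::field P1 \<Rightarrow> 'a P1) \<Rightarrow> 'a P1 \<Rightarrow> 'a" where
  "fix_multiplier g P = (case P of Fin z \<Rightarrow> deriv_fin g z | Infty \<Rightarrow> deriv_fin (flip \<circ> g \<circ> flip) 0)"

text \<open>
  The order of vanishing at \<open>z\<close> of \<open>p / q - z\<close>, whose denominator does not vanish at a finite
  fixed point.
\<close>

definition fix_mult_fin :: "('a::field P1 \<Rightarrow> 'a P1) \<Rightarrow> 'a \<Rightarrow> nat" where
  "fix_mult_fin g z = (let (p, q) = lowest_terms g in order z (p - [:0, 1:] * q))"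

definition fix_mult :: "('a::field P1 \<Rightarrow> 'a P1) \<Rightarrow> 'a P1 \<Rightarrow> nat" where
  "fix_mult g P = (case P of Fin z \<Rightarrow> fix_mult_fin g z | Infty \<Rightarrow> fix_mult_fin (flip \<circ> g \<circ> flip) 0)"

definition multiplier :: "nat \<Rightarrow> ('a::field P1 \<Rightarrow> 'a P1) \<Rightarrow> 'a P1 \<Rightarrow> 'a" where
  "multiplier n f P = fix_multiplier (f ^^ n) P"

text \<open>For \<open>n \<ge> 1\<close> and \<open>f\<close> of degree at least 2 the set \<open>Per n f\<close> is finite.\<close>

definition multiplier_spectrum :: "nat \<Rightarrow> ('a::field P1 \<Rightarrow> 'a P1) \<Rightarrow> 'a multiset" where
  "multiplier_spectrum n f =
     (\<Sum>P\<in>Per n f. replicate_mset (fix_mult (f ^^ n) P) (multiplier n f P))"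

text \<open>
  The elementary symmetric function of degree \<open>i\<close>; the pairs \<open>(x, j)\<close> distinguish the
  \<open>count M x\<close> copies of \<open>x\<close> in \<open>M\<close>.
\<close>

definition elem_sym :: "nat \<Rightarrow> 'a::comm_ring_1 multiset \<Rightarrow> 'a" where
  "elem_sym i M =
     (\<Sum>A | A \<subseteq> (SIGMA x:set_mset M. {..<count M x}) \<and> card A = i. \<Prod>a\<in>A. fst a)"

definition sigma :: "nat \<Rightarrow> nat \<Rightarrow> ('a::field P1 \<Rightarrow> 'a P1) \<Rightarrow> 'a" where
  "sigma n i f = elem_sym i (multiplier_spectrum n f)"

definition sigma_vec :: "nat \<Rightarrow> nat \<Rightarrow> ('a::field P1 \<Rightarrow> 'a P1) \<Rightarrow> 'a list" where
  "sigma_vec d n f = map (\<lambda>i. sigma n i f) [1..<d ^ n + 2]"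

text \<open>
  The common value on a conjugacy class: multiplier spectra are conjugation invariant, so the
  image below is a singleton when \<open>d \<ge> 2\<close>.
\<close>

definition tau2 :: "nat \<Rightarrow> ('a::field P1 \<Rightarrow> 'a P1) set \<Rightarrow> 'a list" where
  "tau2 d c = the_elem ((\<lambda>f. sigma_vec d 1 f @ sigma_vec d 2 f) ` c)"


section \<open>Zariski topology on affine space\<close>

text \<open>
  Multivariate polynomials are finitely supported functions from monomials, themselves finitely
  supported exponent functions on variable indices, to coefficients.
\<close>

type_synonym 'a mvpoly = "(nat \<Rightarrow>\<^sub>0 nat) \<Rightarrow>\<^sub>0 'a"

definition mv_vars :: "'a::zero mvpoly \<Rightarrow> nat set" where
  "mv_vars p = (\<Union>m\<in>Poly_Mapping.keys p. Poly_Mapping.keys m)"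

definition mv_eval :: "'a::comm_ring_1 mvpoly \<Rightarrow> 'a list \<Rightarrow> 'a" where
  "mv_eval p x = (\<Sum>m\<in>Poly_Mapping.keys p. Poly_Mapping.lookup p m * (\<Prod>i\<in>Poly_Mapping.keys m. (x ! i) ^ Poly_Mapping.lookup m i))"

definition affine_space :: "nat \<Rightarrow> 'a list set" where
  "affine_space N = {x. length x = N}"

definition zariski_closed :: "nat \<Rightarrow> 'a::comm_ring_1 list set \<Rightarrow> bool" where
  "zariski_closed N Z \<longleftrightarrow>
     (\<exists>S. (\<forall>p\<in>S. mv_vars p \<subseteq> {..<N}) \<and> Z = {x \<in> affine_space N. \<forall>p\<in>S. mv_eval p x = 0})"

definition zariski_open :: "nat \<Rightarrow> 'a::comm_ring_1 list set \<Rightarrow> bool" where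
  "zariski_open N V \<longleftrightarrow> V \<subseteq> affine_space N \<and> zariski_closed N (affine_space N - V)"

text \<open>\<open>U\<close> is open and dense in \<open>X\<close> for the subspace topology induced from affine \<open>N\<close>-space.\<close>

definition open_dense_in :: "nat \<Rightarrow> 'a::comm_ring_1 list set \<Rightarrow> 'a list set \<Rightarrow> bool" where
  "open_dense_in N X U \<longleftrightarrow>
     (\<exists>V. zariski_open N V \<and> U = X \<inter> V) \<and> (\<forall>Z. zariski_closed N Z \<and> U \<subseteq> Z \<longrightarrow> X \<subseteq> Z)"

end

theory Submission
  imports Defs "HOL-Computational_Algebra.Computational_Algebra"
begin

text \<open>
  A polynomial map is conjugate to a monic centered polynomial \<open>F\<close>, unique up to scaling by
  \<open>(k - 1)\<close>-st roots of unity, and the spectra of any conjugate consist of \<open>0\<close> (at the totally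
  ramified fixed point) and the derivatives at the roots of \<open>F(z) - z\<close> and of \<open>F(F(z)) - z\<close>.
  By Newton's identities the coordinates of the image and the power sums of the multipliers
  determine each other, and the power sums are residues, so they are polynomials in the
  coefficients of \<open>F\<close>.  The image is thus connected by curves that are polynomially parametrized,
  and the nonvanishing locus of one polynomial in the coordinates is dense as soon as it is
  nonempty.

  With \<open>P = F(z) - z\<close>, the first spectrum yields the residues of the powers of \<open>P'\<close>.  For \<open>k = 2, 3\<close>
  these determine the class.  For \<open>k = 4\<close> the second power sum of the second spectrum gives one
  more equation, linear in the two remaining invariants.  For \<open>k = 5\<close> the fibres of the first
  spectrum have six points; adding the second power sum of the second spectrum and eliminating,
  one obtains two polynomials in one invariant with coefficients regular on the image.  They have
  a linear greatest common divisor at \<open>F = z\<^sup>5 + z\<^sup>3 + z\<close>, hence generically at most one common root.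
\<close>

section \<open>Algebras of functions\<close>

text \<open>Genericity has to be witnessed by one function \<open>D\<close> that is regular on the
  target space, not merely polynomial in the coefficients of \<open>F\<close>. This shapes the
  eliminations: they run over invariants that can be read off from the point \<open>Q\<close>, and
  they do not divide by functions. No dimension theory is used: monic centered polynomials form an
  affine space, so straight lines through a chosen \<open>F0\<close> suffice for density. For
  \<open>k = 5\<close> there is no closed formula for the inverse, and the greatest common divisor
  at a generic point is never computed. A Bezout identity with explicit integers at a single point
  is read as triviality of the kernel of a Sylvester-like matrix, an open condition that is
  certified by a product of pivots from the same algebra. A common root exists over every point of
  the image, since it is an invariant of the polynomial; only its uniqueness is generic. The same
  locale covers polynomial functions of the parameter of a line and regular functions of
  \<open>Q\<close>.\<close>

locale fun_alg =
  fixes A :: "('s \<Rightarrow> 'a::field) set"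
  assumes const: "(\<lambda>_. c) \<in> A"
    and add: "f \<in> A \<Longrightarrow> g \<in> A \<Longrightarrow> (\<lambda>s. f s + g s) \<in> A"
    and mult: "f \<in> A \<Longrightarrow> g \<in> A \<Longrightarrow> (\<lambda>s. f s * g s) \<in> A"
begin

lemma uminus: "f \<in> A \<Longrightarrow> (\<lambda>s. - f s) \<in> A"
  using mult[OF const[of "-1"], of f] by simp

lemma diff: "f \<in> A \<Longrightarrow> g \<in> A \<Longrightarrow> (\<lambda>s. f s - g s) \<in> A"
  using add[OF _ uminus, of f g] by simp

lemma power: "f \<in> A \<Longrightarrow> (\<lambda>s. f s ^ n) \<in> A"
  by (induction n) (simp_all add: const mult)

lemma divide: "f \<in> A \<Longrightarrow> (\<lambda>s. f s / c) \<in> A"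
  using mult[OF _ const[of "inverse c"], of f] by (simp add: field_simps)

lemma sum: "(\<And>i. i \<in> I \<Longrightarrow> f i \<in> A) \<Longrightarrow> (\<lambda>s. \<Sum>i\<in>I. f i s) \<in> A"
  by (induction I rule: infinite_finite_induct) (simp_all add: const add)

lemma prod: "(\<And>i. i \<in> I \<Longrightarrow> f i \<in> A) \<Longrightarrow> (\<lambda>s. \<Prod>i\<in>I. f i s) \<in> A"
  by (induction I rule: infinite_finite_induct) (simp_all add: const mult)

lemmas intros = const add mult uminus diff power divide sum prod

text \<open>Fraction-free Gaussian elimination: full column rank at \<open>s0\<close> supplies a
  pivot that is nonzero at \<open>s0\<close>, and \<open>D\<close> is the product of the pivots,
  hence again in \<open>A\<close>.\<close>

lemma generic_trivial_kernel:
  assumes "finite J" "\<And>i j. i \<in> I \<Longrightarrow> j \<in> J \<Longrightarrow> M i j \<in> A"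
    and "\<And>v. (\<And>i. i \<in> I \<Longrightarrow> (\<Sum>j\<in>J. M i j s0 * v j) = 0) \<Longrightarrow> \<forall>j\<in>J. v j = 0"
  shows "\<exists>D\<in>A. D s0 \<noteq> 0 \<and>
    (\<forall>s v. D s \<noteq> 0 \<longrightarrow> (\<forall>i\<in>I. (\<Sum>j\<in>J. M i j s * v j) = 0) \<longrightarrow> (\<forall>j\<in>J. v j = 0))"
  using assms
proof (induction J arbitrary: M rule: finite_induct)
  case empty
  show ?case by (rule bexI[OF _ const[of 1]]) auto
next
  case (insert j0 J)
  \<comment> \<open>Otherwise the unit vector at \<open>j0\<close> would lie in the kernel at
    \<open>s0\<close>.\<close>
  have "\<exists>i\<in>I. M i j0 s0 \<noteq> 0"
  proof (rule ccontr)
    assume neg: "\<not> ?thesis"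
    have "(\<Sum>j\<in>insert j0 J. M i j s0 * (if j = j0 then 1 else 0)) = 0" if "i \<in> I" for i
      using insert.hyps neg that by (auto intro!: sum.neutral)
    from insert.prems(2)[OF this] show False by auto
  qed
  then obtain i0 where i0: "i0 \<in> I" "M i0 j0 s0 \<noteq> 0" by blast
  \<comment> \<open>Cross multiplication with the pivot row clears column \<open>j0\<close> and
    keeps the entries in \<open>A\<close>.\<close>
  define M' where "M' = (\<lambda>i j s. M i0 j0 s * M i j s - M i j0 s * M i0 j s)"
  have M'A: "M' i j \<in> A" if "i \<in> I" "j \<in> J" for i j
    unfolding M'_def using insert.prems(1) that i0 by (intro intros) auto
  have expand: "(\<Sum>j\<in>J. M' i j s * v j) =
      M i0 j0 s * (\<Sum>j\<in>J. M i j s * v j) - M i j0 s * (\<Sum>j\<in>J. M i0 j s * v j)" for i s v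
    by (simp add: M'_def sum_distrib_left sum_subtractf [symmetric] algebra_simps)
  have ker: "\<forall>j\<in>J. v j = 0" if v: "\<And>i. i \<in> I \<Longrightarrow> (\<Sum>j\<in>J. M' i j s0 * v j) = 0" for v
  proof -
    \<comment> \<open>A kernel vector of the reduced matrix is extended by solving the pivot row for
      the coordinate \<open>j0\<close>; the division takes place at \<open>s0\<close> only.\<close>
    define w where "w = v(j0 := - (\<Sum>j\<in>J. M i0 j s0 * v j) / M i0 j0 s0)"
    have wJ: "(\<Sum>j\<in>J. M i j s0 * w j) = (\<Sum>j\<in>J. M i j s0 * v j)" for i
      using insert.hyps by (intro sum.cong) (auto simp: w_def)
    have "(\<Sum>j\<in>insert j0 J. M i j s0 * w j) = 0" if "i \<in> I" for i
      using v[OF that] insert.hyps i0(2) unfolding expand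
      by (simp add: wJ) (simp add: w_def field_simps)
    from insert.prems(2)[OF this] insert.hyps show ?thesis by (auto simp: w_def split: if_splits)
  qed
  obtain D where D: "D \<in> A" "D s0 \<noteq> 0"
    "\<And>s v. D s \<noteq> 0 \<Longrightarrow> (\<forall>i\<in>I. (\<Sum>j\<in>J. M' i j s * v j) = 0) \<Longrightarrow> \<forall>j\<in>J. v j = 0"
    using insert.IH[of M', OF M'A ker] by blast
  show ?case
  proof (intro bexI[of _ "\<lambda>s. M i0 j0 s * D s"] conjI allI impI)
    show "(\<lambda>s. M i0 j0 s * D s) \<in> A" using insert.prems(1) i0 D by (intro mult) auto
    show "M i0 j0 s0 * D s0 \<noteq> 0" using i0 D by simp
    fix s v assume nz: "M i0 j0 s * D s \<noteq> 0"
      and v: "\<forall>i\<in>I. (\<Sum>j\<in>insert j0 J. M i j s * v j) = 0"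
    have eq: "(\<Sum>j\<in>J. M i j s * v j) = - M i j0 s * v j0" if "i \<in> I" for i
    proof -
      have "M i j0 s * v j0 + (\<Sum>j\<in>J. M i j s * v j) = 0"
        using v that insert.hyps by force
      thus ?thesis by (simp add: add_eq_0_iff)
    qed
    have "(\<Sum>j\<in>J. M' i j s * v j) = 0" if "i \<in> I" for i
      using that i0 by (simp add: expand eq)
    with nz have vJ: "\<forall>j\<in>J. v j = 0" using D(3)[of s v] by simp
    have "M i0 j0 s * v j0 = 0" using eq[OF i0(1)] vJ by simp
    with nz vJ show "\<forall>j\<in>insert j0 J. v j = 0" by simp
  qed
qed

section \<open>Families of polynomials with coefficients in the algebra\<close>

definition poly_fam :: "('s \<Rightarrow> 'a poly) \<Rightarrow> bool" where
  "poly_fam F \<longleftrightarrow> (\<forall>i. (\<lambda>s. coeff (F s) i) \<in> A)"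

lemma poly_famD: "poly_fam F \<Longrightarrow> (\<lambda>s. coeff (F s) i) \<in> A"
  by (simp add: poly_fam_def)

lemma poly_fam_const: "poly_fam (\<lambda>_. p)"
  by (simp add: poly_fam_def const)

lemma poly_fam_add: "poly_fam F \<Longrightarrow> poly_fam G \<Longrightarrow> poly_fam (\<lambda>s. F s + G s)"
  by (simp add: poly_fam_def add)

lemma poly_fam_diff: "poly_fam F \<Longrightarrow> poly_fam G \<Longrightarrow> poly_fam (\<lambda>s. F s - G s)"
  by (simp add: poly_fam_def diff)

lemma poly_fam_uminus: "poly_fam F \<Longrightarrow> poly_fam (\<lambda>s. - F s)"
  by (simp add: poly_fam_def uminus)

lemma poly_fam_smult: "f \<in> A \<Longrightarrow> poly_fam F \<Longrightarrow> poly_fam (\<lambda>s. smult (f s) (F s))"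
  by (simp add: poly_fam_def mult)

lemma poly_fam_mult: "poly_fam F \<Longrightarrow> poly_fam G \<Longrightarrow> poly_fam (\<lambda>s. F s * G s)"
  by (auto simp: poly_fam_def coeff_mult intro!: sum mult)

lemma poly_fam_power: "poly_fam F \<Longrightarrow> poly_fam (\<lambda>s. F s ^ n)"
  by (induction n) (simp_all add: poly_fam_const poly_fam_mult)

lemma poly_fam_pCons: "f \<in> A \<Longrightarrow> poly_fam F \<Longrightarrow> poly_fam (\<lambda>s. pCons (f s) (F s))"
  unfolding poly_fam_def
proof
  fix i assume "f \<in> A" "\<forall>i. (\<lambda>s. coeff (F s) i) \<in> A"
  thus "(\<lambda>s. coeff (pCons (f s) (F s)) i) \<in> A" by (cases i) auto
qed

lemma poly_fam_sum: "(\<And>i. i \<in> I \<Longrightarrow> poly_fam (F i)) \<Longrightarrow> poly_fam (\<lambda>s. \<Sum>i\<in>I. F i s)"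
  by (auto simp: poly_fam_def coeff_sum intro!: sum)

lemma poly_fam_pderiv: "poly_fam F \<Longrightarrow> poly_fam (\<lambda>s. pderiv (F s))"
  by (auto simp: poly_fam_def coeff_pderiv intro!: intros)

text \<open>The uniform bound \<open>n\<close> makes the expansion in powers of \<open>G s\<close> a
  sum over an index set that does not depend on \<open>s\<close>.\<close>

lemma poly_fam_pcompose:
  assumes "poly_fam F" "poly_fam G" "\<And>s. degree (F s) \<le> n"
  shows "poly_fam (\<lambda>s. F s \<circ>\<^sub>p G s)"
proof -
  have "F s \<circ>\<^sub>p G s = (\<Sum>i\<le>n. smult (coeff (F s) i) (G s ^ i))" for s
  proof -
    have "F s \<circ>\<^sub>p G s = (\<Sum>i\<le>degree (F s). smult (coeff (F s) i) (G s ^ i))"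
      by (simp add: pcompose_altdef poly_altdef degree_map_poly coeff_map_poly)
    also have "\<dots> = (\<Sum>i\<le>n. smult (coeff (F s) i) (G s ^ i))"
      using assms(3)[of s] by (intro sum.mono_neutral_left) (auto simp: coeff_eq_0)
    finally show ?thesis .
  qed
  thus ?thesis using assms
    by (auto intro!: poly_fam_sum poly_fam_smult poly_fam_power poly_famD)
qed

lemmas fam_intros = poly_fam_const poly_fam_add poly_fam_diff poly_fam_uminus poly_fam_smult
  poly_fam_mult poly_fam_power poly_fam_pCons

text \<open>
  The functional \<open>T\<^sup>i \<mapsto> v i\<close> on polynomials of degree at most \<open>m + n\<close> kills the multiples
  of \<open>F s\<close> and \<open>G s\<close>.  At \<open>s0\<close> these multiples span all powers \<open>T\<^sup>i\<close>, up to constants if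
  \<open>l = 1\<close>, and this persists generically.
\<close>

lemma generic_elim:
  fixes F G :: "'s \<Rightarrow> 'a poly"
  assumes fam: "poly_fam F" "poly_fam G"
    and deg: "\<And>s. degree (F s) \<le> m" "\<And>s. degree (G s) \<le> n" and lead: "coeff (G s0) n \<noteq> 0"
    and l: "l \<le> 1"
    and gen: "\<And>i. i \<in> {l..m + n} \<Longrightarrow> \<exists>c a b. monom 1 i - [:c:] = a * F s0 + b * G s0 \<and> (l = 0 \<longrightarrow> c = 0)"
  shows "\<exists>D\<in>A. D s0 \<noteq> 0 \<and> (\<forall>s v. D s \<noteq> 0 \<longrightarrow>
    (\<forall>j\<le>n. (\<Sum>i=l..m + n. coeff (monom 1 j * F s) i * v i) = 0) \<longrightarrow>
    (\<forall>j\<le>m. (\<Sum>i=l..m + n. coeff (monom 1 j * G s) i * v i) = 0) \<longrightarrow>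
    (\<forall>i\<in>{l..m + n}. v i = 0))"
proof -
  \<comment> \<open>Sylvester rows with one additional shift of each polynomial: the cofactors below
    have degrees at most \<open>n\<close> and \<open>m\<close>, inclusively. For
    \<open>l = 1\<close> the column of the constant terms is absent.\<close>
  define M where "M = (\<lambda>(b, j) i s. coeff (monom 1 j * (if b then F s else G s)) i)"
  define I where "I = {True} \<times> {..n} \<union> {False} \<times> {..m}"
  have MA: "M i j \<in> A" for i j
    using fam by (cases i; cases "fst i") (auto simp: M_def intro!: poly_famD fam_intros)
  have ker: "\<forall>i\<in>{l..m + n}. v i = 0"
    if v: "\<And>i. i \<in> I \<Longrightarrow> (\<Sum>j=l..m + n. M i j s0 * v j) = 0" for v
  proof
    fix i assume i: "i \<in> {l..m + n}"
    define L where "L = (\<lambda>h. \<Sum>i=l..m + n. coeff h i * v i)"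
    have L_add: "L (h + h') = L h + L h'" and L_smult: "L (smult c h) = c * L h"
      and L_sum: "L (\<Sum>x\<in>B. f x) = (\<Sum>x\<in>B. L (f x))" for h h' c and f :: "nat \<Rightarrow> 'a poly" and B
      by (simp_all add: L_def sum.distrib ring_distribs sum_distrib_left mult.assoc coeff_sum
          sum_distrib_right sum.swap[of _ B])
    have Lz: "L (u * K) = 0" if "\<And>j. j \<le> r \<Longrightarrow> L (monom 1 j * K) = 0" "degree u \<le> r" for u K r
    proof -
      have "u * K = (\<Sum>j\<le>degree u. smult (coeff u j) (monom 1 j * K))"
        by (subst poly_as_sum_of_monoms[of u, symmetric])
          (simp add: sum_distrib_right smult_monom flip: mult_smult_left)
      also have "L \<dots> = 0" using that by (simp add: L_sum L_smult)
      finally show ?thesis .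
    qed
    obtain c a b where abc: "monom 1 i - [:c:] = a * F s0 + b * G s0" "l = 0 \<longrightarrow> c = 0"
      using gen[OF i] by blast
    \<comment> \<open>Reducing the cofactor of \<open>F s0\<close> modulo \<open>G s0\<close> bounds
      its degree. The bound for the other cofactor then follows from the identity, because
      \<open>lead\<close> makes the degree of \<open>G s0\<close> exactly \<open>n\<close>.\<close>
    define u where "u = a mod G s0"
    define w where "w = (a div G s0) * F s0 + b"
    have G0: "G s0 \<noteq> 0" and dG: "degree (G s0) = n"
      using lead deg(2)[of s0] le_degree[OF lead] by auto
    have du: "degree u \<le> n" using degree_mod_less[OF G0, of a] dG by (auto simp: u_def)
    have eq: "monom 1 i - [:c:] = u * F s0 + w * G s0"
    proof -
      have "a * F s0 = (a div G s0 * G s0 + a mod G s0) * F s0" by (simp only: div_mult_mod_eq)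
      thus ?thesis unfolding abc u_def w_def by (simp only: ring_distribs ac_simps)
    qed
    have "degree (w * G s0) \<le> m + n"
    proof -
      have "w * G s0 = monom 1 i - [:c:] - u * F s0" using eq by simp
      moreover have "degree (monom 1 i - [:c:]) \<le> m + n"
        using i by (intro degree_diff_le) (auto simp: degree_monom_eq)
      moreover have "degree (u * F s0) \<le> m + n"
        using degree_mult_le[of u "F s0"] du deg(1)[of s0] by linarith
      ultimately show ?thesis by (metis degree_diff_le)
    qed
    hence dw: "degree w \<le> m" using G0 dG by (cases "w = 0") (auto simp: degree_mult_eq)
    have "L (monom 1 i - [:c:]) = 0" unfolding eq L_add
    proof -
      have "L (monom 1 j * F s0) = 0" if "j \<le> n" for j
        using v[of "(True, j)"] that by (simp add: I_def M_def L_def)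
      moreover have "L (monom 1 j * G s0) = 0" if "j \<le> m" for j
        using v[of "(False, j)"] that by (simp add: I_def M_def L_def)
      ultimately show "L (u * F s0) + L (w * G s0) = 0"
        using Lz[of n "F s0" u] Lz[of m "G s0" w] du dw by simp
    qed
    moreover have "L (monom 1 i - [:c:]) = v i"
    proof -
      \<comment> \<open>The constant \<open>c\<close> is invisible to \<open>L\<close> for
        \<open>l = 1\<close> and zero for \<open>l = 0\<close>.\<close>
      have "L (monom 1 i - [:c:]) = (\<Sum>j=l..m + n. if j = i then v j else 0)"
        unfolding L_def using l abc(2) by (intro sum.cong) (auto simp: coeff_pCons split: nat.split)
      thus ?thesis using i by simp
    qed
    ultimately show "v i = 0" by simp
  qed
  obtain D where D: "D \<in> A" "D s0 \<noteq> 0"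
    "\<And>s v. D s \<noteq> 0 \<Longrightarrow> (\<forall>i\<in>I. (\<Sum>j=l..m + n. M i j s * v j) = 0) \<Longrightarrow> \<forall>j\<in>{l..m + n}. v j = 0"
    using generic_trivial_kernel[of "{l..m + n}" I M s0, OF finite_atLeastAtMost MA ker] by blast
  show ?thesis
  proof (intro bexI[OF _ D(1)] conjI D(2) allI impI)
    fix s v
    assume nz: "D s \<noteq> 0"
    assume v: "\<forall>j\<le>n. (\<Sum>i=l..m + n. coeff (monom 1 j * F s) i * v i) = 0"
        "\<forall>j\<le>m. (\<Sum>i=l..m + n. coeff (monom 1 j * G s) i * v i) = 0"
    have "\<forall>i\<in>I. (\<Sum>j=l..m + n. M i j s * v j) = 0"
      unfolding I_def M_def using v by auto
    with D(3) nz show "\<forall>i\<in>{l..m + n}. v i = 0" by blast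
  qed
qed

lemma poly_eq_sum_upto: "degree p \<le> N \<Longrightarrow> poly p x = (\<Sum>i\<le>N. coeff p i * x ^ i)"
  for p :: "'a poly"
  unfolding poly_altdef by (intro sum.mono_neutral_left) (auto simp: coeff_eq_0)

text \<open>A common root \<open>t\<close> makes \<open>v i = t ^ i\<close> a kernel vector, and its
  entry at \<open>0\<close> is \<open>1\<close>.\<close>

lemma generic_coprime:
  assumes fam: "poly_fam F" "poly_fam G"
    and deg: "\<And>s. degree (F s) \<le> m" "\<And>s. degree (G s) \<le> n" and lead: "coeff (G s0) n \<noteq> 0"
    and bezout: "U * F s0 + V * G s0 = 1"
  shows "\<exists>D\<in>A. D s0 \<noteq> 0 \<and> (\<forall>s t. D s \<noteq> 0 \<longrightarrow> poly (F s) t = 0 \<longrightarrow> poly (G s) t \<noteq> 0)"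
proof -
  have gen: "\<exists>c a b. monom 1 i - [:c:] = a * F s0 + b * G s0 \<and> ((0::nat) = 0 \<longrightarrow> c = 0)" for i
    using arg_cong[OF bezout, of "\<lambda>p. monom 1 i * p"]
    by (intro exI[of _ 0] exI[of _ "monom 1 i * U"] exI[of _ "monom 1 i * V"])
      (simp add: algebra_simps)
  obtain D where D: "D \<in> A" "D s0 \<noteq> 0" "\<And>s v. D s \<noteq> 0 \<Longrightarrow>
    (\<forall>j\<le>n. (\<Sum>i=0..m + n. coeff (monom 1 j * F s) i * v i) = 0) \<Longrightarrow>
    (\<forall>j\<le>m. (\<Sum>i=0..m + n. coeff (monom 1 j * G s) i * v i) = 0) \<Longrightarrow>
    (\<forall>i\<in>{0..m + n}. v i = 0)"
    using generic_elim[OF fam deg lead zero_le_one gen] by blast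
  have "poly (G s) t \<noteq> 0" if "D s \<noteq> 0" "poly (F s) t = 0" for s t
  proof
    assume G: "poly (G s) t = 0"
    have *: "(\<Sum>i=0..m + n. coeff (monom 1 j * K) i * t ^ i) = 0"
      if "poly K t = 0" "degree K + j \<le> m + n" for j and K :: "'a poly"
    proof -
      have "degree (monom 1 j * K) \<le> m + n"
        using that degree_mult_le[of "monom 1 j" K] by (simp add: degree_monom_eq)
      from poly_eq_sum_upto[OF this, of t] that show ?thesis by (simp add: atLeast0AtMost)
    qed
    have "\<forall>i\<in>{0..m + n}. t ^ i = 0"
      by (rule D(3)[OF that(1)]; intro allI impI *)
        (use that(2) G deg(1)[of s] deg(2)[of s] in auto)
    thus False by force
  qed
  with D show ?thesis by blast
qed

text \<open>Two common roots give the kernel vector \<open>t ^ i - t' ^ i\<close>. Its entry at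
  \<open>0\<close> always vanishes, which is why the constant column is dropped; its entry at
  \<open>1\<close> compares the roots.\<close>

lemma generic_unique_root:
  assumes fam: "poly_fam F" "poly_fam G"
    and deg: "\<And>s. degree (F s) \<le> m" "\<And>s. degree (G s) \<le> n" and lead: "coeff (G s0) n \<noteq> 0"
    and bezout: "U * F s0 + V * G s0 = [:- t0, 1:]" and pos: "m + n > 0"
  shows "\<exists>D\<in>A. D s0 \<noteq> 0 \<and> (\<forall>s t t'. D s \<noteq> 0 \<longrightarrow> poly (F s) t = 0 \<longrightarrow> poly (G s) t = 0 \<longrightarrow>
    poly (F s) t' = 0 \<longrightarrow> poly (G s) t' = 0 \<longrightarrow> t = t')"
proof -
  have gen: "\<exists>c a b. monom 1 i - [:c:] = a * F s0 + b * G s0 \<and> (1 = (0::nat) \<longrightarrow> c = 0)" for i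
  proof -
    \<comment> \<open>Modulo the linear common divisor every power of the variable is congruent to a
      constant.\<close>
    have "poly (monom 1 i - [:t0 ^ i:]) t0 = 0" by (simp add: poly_monom)
    then obtain q where q: "monom 1 i - [:t0 ^ i:] = [:- t0, 1:] * q"
      using poly_eq_0_iff_dvd by blast
    show ?thesis unfolding q bezout[symmetric]
      by (intro exI[of _ "t0 ^ i"] exI[of _ "q * U"] exI[of _ "q * V"])
        (simp only: q bezout[symmetric], simp add: algebra_simps)
  qed
  obtain D where D: "D \<in> A" "D s0 \<noteq> 0" "\<And>s v. D s \<noteq> 0 \<Longrightarrow>
    (\<forall>j\<le>n. (\<Sum>i=1..m + n. coeff (monom 1 j * F s) i * v i) = 0) \<Longrightarrow>
    (\<forall>j\<le>m. (\<Sum>i=1..m + n. coeff (monom 1 j * G s) i * v i) = 0) \<Longrightarrow>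
    (\<forall>i\<in>{1..m + n}. v i = 0)"
    using generic_elim[OF fam deg lead le_refl gen] by blast
  have "t = t'" if "D s \<noteq> 0" "poly (F s) t = 0" "poly (G s) t = 0"
      "poly (F s) t' = 0" "poly (G s) t' = 0" for s t t'
  proof -
    have *: "(\<Sum>i=1..m + n. coeff (monom 1 j * K) i * (t ^ i - t' ^ i)) = 0"
      if "poly K t = 0" "poly K t' = 0" "degree K + j \<le> m + n" for j and K :: "'a poly"
    proof -
      have d: "degree (monom 1 j * K) \<le> m + n"
        using that degree_mult_le[of "monom 1 j" K] by (simp add: degree_monom_eq)
      have "(\<Sum>i=1..m + n. coeff (monom 1 j * K) i * (t ^ i - t' ^ i)) =
          (\<Sum>i\<le>m + n. coeff (monom 1 j * K) i * (t ^ i - t' ^ i))"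
        by (intro sum.mono_neutral_left) (auto simp: Suc_le_eq)
      also have "\<dots> = poly (monom 1 j * K) t - poly (monom 1 j * K) t'"
        by (simp add: poly_eq_sum_upto[OF d] ring_distribs sum_subtractf del: poly_mult)
      finally show ?thesis using that by simp
    qed
    have "\<forall>i\<in>{1..m + n}. t ^ i - t' ^ i = 0"
      by (rule D(3)[OF that(1)]; intro allI impI *)
        (use that(2-) deg(1)[of s] deg(2)[of s] in auto)
    hence "t ^ 1 - t' ^ 1 = 0" using pos by (metis atLeastAtMost_iff le_refl Suc_le_eq One_nat_def)
    thus ?thesis by simp
  qed
  with D show ?thesis by blast
qed

end

section \<open>Regular functions and density in a polynomially parametrized image\<close>

definition poly_funs :: "('a::field \<Rightarrow> 'a) set" where
  "poly_funs = {f. \<exists>p. \<forall>t. f t = poly p t}"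

interpretation poly_funs: fun_alg "poly_funs :: ('a::field \<Rightarrow> 'a) set"
proof
  fix c :: 'a and f g :: "'a \<Rightarrow> 'a"
  show "(\<lambda>_. c) \<in> poly_funs"
    unfolding poly_funs_def by (auto intro!: exI[of _ "[:c:]"])
  assume "f \<in> poly_funs" "g \<in> poly_funs"
  then obtain p q where "\<forall>t. f t = poly p t" "\<forall>t. g t = poly q t"
    by (auto simp: poly_funs_def)
  hence "\<forall>t. f t + g t = poly (p + q) t" "\<forall>t. f t * g t = poly (p * q) t" by simp_all
  thus "(\<lambda>t. f t + g t) \<in> poly_funs" "(\<lambda>t. f t * g t) \<in> poly_funs"
    unfolding poly_funs_def by blast+
qed

definition mon_eval :: "(nat \<Rightarrow>\<^sub>0 nat) \<Rightarrow> 'a::comm_ring_1 list \<Rightarrow> 'a" where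
  "mon_eval m x = (\<Prod>i\<in>Poly_Mapping.keys m. (x ! i) ^ Poly_Mapping.lookup m i)"

lemma mon_eval_superset:
  assumes "finite S" "Poly_Mapping.keys m \<subseteq> S"
  shows "mon_eval m x = (\<Prod>i\<in>S. (x ! i) ^ Poly_Mapping.lookup m i)"
  unfolding mon_eval_def using assms
  by (intro prod.mono_neutral_left) (auto simp: in_keys_iff)

lemma mon_eval_add: "mon_eval (m + m') x = mon_eval m x * mon_eval m' x"
proof -
  let ?S = "Poly_Mapping.keys m \<union> Poly_Mapping.keys m'"
  have "Poly_Mapping.keys (m + m') \<subseteq> ?S" by (rule keys_add)
  thus ?thesis
    by (simp add: mon_eval_superset[of ?S] lookup_add power_add prod.distrib)
qed

lemma mv_eval_superset:
  assumes "finite S" "Poly_Mapping.keys p \<subseteq> S"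
  shows "mv_eval p x = (\<Sum>m\<in>S. Poly_Mapping.lookup p m * mon_eval m x)"
  unfolding mv_eval_def mon_eval_def[symmetric] using assms
  by (intro sum.mono_neutral_left) (auto simp: in_keys_iff)

lemma mv_eval_add: "mv_eval (p + q) x = mv_eval p x + mv_eval q x"
proof -
  let ?S = "Poly_Mapping.keys p \<union> Poly_Mapping.keys q"
  have "Poly_Mapping.keys (p + q) \<subseteq> ?S" by (rule keys_add)
  thus ?thesis
    by (simp add: mv_eval_superset[of ?S] lookup_add ring_distribs sum.distrib)
qed

lemma mv_eval_zero: "mv_eval 0 x = 0"
  by (simp add: mv_eval_def)

lemma mv_eval_sum: "mv_eval (\<Sum>i\<in>I. f i) x = (\<Sum>i\<in>I. mv_eval (f i) x)"
  by (induction I rule: infinite_finite_induct) (simp_all add: mv_eval_zero mv_eval_add)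

lemma mv_eval_single: "mv_eval (Poly_Mapping.single m c) x = c * mon_eval m x"
  by (cases "c = 0") (simp_all add: mv_eval_zero mv_eval_def mon_eval_def)

lemma poly_mapping_sum_single:
  "p = (\<Sum>m\<in>Poly_Mapping.keys p. Poly_Mapping.single m (Poly_Mapping.lookup p m))"
proof (rule poly_mapping_eqI)
  fix k
  show "Poly_Mapping.lookup p k =
      Poly_Mapping.lookup (\<Sum>m\<in>Poly_Mapping.keys p. Poly_Mapping.single m (Poly_Mapping.lookup p m)) k"
    by (simp add: lookup_sum lookup_single when_def in_keys_iff)
qed

lemma mv_eval_mult: "mv_eval (p * q) x = mv_eval p x * mv_eval q x"
proof -
  have "p * q = (\<Sum>m\<in>Poly_Mapping.keys p. Poly_Mapping.single m (Poly_Mapping.lookup p m)) *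
      (\<Sum>m\<in>Poly_Mapping.keys q. Poly_Mapping.single m (Poly_Mapping.lookup q m))"
    using poly_mapping_sum_single[of p] poly_mapping_sum_single[of q] by simp
  also have "mv_eval \<dots> x = mv_eval p x * mv_eval q x"
    by (simp only: sum_product mult_single mv_eval_sum mv_eval_single mon_eval_add
        mv_eval_superset[OF finite_keys order_refl, of p] mv_eval_superset[OF finite_keys order_refl, of q]
        ac_simps)
  finally show ?thesis .
qed

lemma mv_vars_add: "mv_vars (p + q) \<subseteq> mv_vars p \<union> mv_vars q"
  unfolding mv_vars_def using keys_add[of p q] by blast

lemma mv_vars_mult: "mv_vars (p * q) \<subseteq> mv_vars p \<union> mv_vars q"
proof
  fix i assume "i \<in> mv_vars (p * q)"
  then obtain m where m: "m \<in> Poly_Mapping.keys (p * q)" "i \<in> Poly_Mapping.keys m"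
    by (auto simp: mv_vars_def)
  obtain a b where ab: "m = a + b" "a \<in> Poly_Mapping.keys p" "b \<in> Poly_Mapping.keys q"
    using keys_mult[of p q] m(1) by blast
  show "i \<in> mv_vars p \<union> mv_vars q"
    using keys_add[of a b] m(2) ab unfolding mv_vars_def by blast
qed

definition regular_funs :: "nat \<Rightarrow> ('a::field list \<Rightarrow> 'a) set" where
  "regular_funs N =
     {f. \<exists>p. mv_vars p \<subseteq> {..<N} \<and> (\<forall>x\<in>affine_space N. f x = mv_eval p x)}"

interpretation regular: fun_alg "regular_funs N :: ('a::field list \<Rightarrow> 'a) set" for N
proof
  fix c :: 'a and f g :: "'a list \<Rightarrow> 'a"
  show "(\<lambda>_. c) \<in> regular_funs N"
    unfolding regular_funs_def
    by (auto intro!: exI[of _ "Poly_Mapping.single 0 c"]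
        simp: mv_eval_single mon_eval_def mv_vars_def split: if_splits)
  assume "f \<in> regular_funs N" "g \<in> regular_funs N"
  then obtain p q where pq: "mv_vars p \<subseteq> {..<N}" "\<forall>x\<in>affine_space N. f x = mv_eval p x"
    "mv_vars q \<subseteq> {..<N}" "\<forall>x\<in>affine_space N. g x = mv_eval q x"
    by (auto simp: regular_funs_def)
  have "mv_vars (p + q) \<subseteq> {..<N}" "mv_vars (p * q) \<subseteq> {..<N}"
    using pq mv_vars_add[of p q] mv_vars_mult[of p q] by blast+
  moreover have "\<forall>x\<in>affine_space N. f x + g x = mv_eval (p + q) x"
    "\<forall>x\<in>affine_space N. f x * g x = mv_eval (p * q) x"
    using pq by (simp_all add: mv_eval_add mv_eval_mult)
  ultimately show "(\<lambda>x. f x + g x) \<in> regular_funs N" "(\<lambda>x. f x * g x) \<in> regular_funs N"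
    unfolding regular_funs_def by blast+
qed

lemma regular_coord: "i < N \<Longrightarrow> (\<lambda>x. x ! i) \<in> regular_funs N"
  unfolding regular_funs_def
  by (auto intro!: exI[of _ "Poly_Mapping.single (Poly_Mapping.single i 1) 1"]
      simp: mv_eval_single mon_eval_def mv_vars_def)

lemma poly_funs_mv_eval:
  assumes "mv_vars p \<subseteq> {..<N}" "\<And>i. i < N \<Longrightarrow> (\<lambda>t. \<gamma> t ! i) \<in> poly_funs"
  shows "(\<lambda>t. mv_eval p (\<gamma> t)) \<in> poly_funs"
  unfolding mv_eval_def using assms
  by (intro poly_funs.intros) (auto simp: mv_vars_def)

text \<open>Along the curve from \<open>b\<close> to \<open>b0\<close>, an equation of
  \<open>Z\<close> times the equation \<open>D\<close> is a polynomial in \<open>t\<close> that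
  vanishes everywhere. The second factor is nonzero at \<open>t = 1\<close>, so the first one is the
  zero polynomial, in particular at \<open>t = 0\<close>.\<close>

lemma open_dense_in_image:
  fixes \<tau> :: "'b \<Rightarrow> 'a::field_char_0 list"
  assumes img: "\<tau> ` S \<subseteq> affine_space N" and D: "D \<in> regular_funs N"
    and b0: "D (\<tau> b0) \<noteq> 0"
    and line: "\<And>b. b \<in> S \<Longrightarrow> \<exists>\<gamma>. range \<gamma> \<subseteq> S \<and> \<gamma> 0 = b \<and> \<gamma> 1 = b0 \<and>
      (\<forall>i<N. (\<lambda>t. \<tau> (\<gamma> t) ! i) \<in> poly_funs)"
  shows "open_dense_in N (\<tau> ` S) {x \<in> \<tau> ` S. D x \<noteq> 0}"
proof -
  obtain d where d: "mv_vars d \<subseteq> {..<N}" "\<And>x. x \<in> affine_space N \<Longrightarrow> D x = mv_eval d x"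
    using D by (auto simp: regular_funs_def)
  have "zariski_open N {x \<in> affine_space N. D x \<noteq> 0}"
    unfolding zariski_open_def zariski_closed_def
    using d by (auto intro!: exI[of _ "{d}"])
  moreover have "{x \<in> \<tau> ` S. D x \<noteq> 0} = \<tau> ` S \<inter> {x \<in> affine_space N. D x \<noteq> 0}"
    using img by auto
  moreover have "\<tau> ` S \<subseteq> Z"
    if Z: "zariski_closed N Z" and sub: "{x \<in> \<tau> ` S. D x \<noteq> 0} \<subseteq> Z" for Z
  proof
    fix x assume "x \<in> \<tau> ` S"
    then obtain b where b: "b \<in> S" "x = \<tau> b" by blast
    then obtain \<gamma> where \<gamma>: "range \<gamma> \<subseteq> S" "\<gamma> 0 = b" "\<gamma> 1 = b0"
      "\<And>i. i < N \<Longrightarrow> (\<lambda>t. \<tau> (\<gamma> t) ! i) \<in> poly_funs" using line by metis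
    have aff: "\<tau> (\<gamma> t) \<in> affine_space N" for t using img \<gamma>(1) by blast
    obtain P where P: "\<And>p. p \<in> P \<Longrightarrow> mv_vars p \<subseteq> {..<N}"
      "Z = {x \<in> affine_space N. \<forall>p\<in>P. mv_eval p x = 0}"
      using Z unfolding zariski_closed_def by blast
    have "mv_eval p x = 0" if pP: "p \<in> P" for p
    proof -
      obtain u where u: "\<And>t. mv_eval p (\<tau> (\<gamma> t)) = poly u t"
        using poly_funs_mv_eval[OF P(1)[OF pP], of "\<lambda>t. \<tau> (\<gamma> t)"] \<gamma>(4) by (auto simp: poly_funs_def)
      obtain w where w: "\<And>t. mv_eval d (\<tau> (\<gamma> t)) = poly w t"
        using poly_funs_mv_eval[OF d(1), of "\<lambda>t. \<tau> (\<gamma> t)"] \<gamma>(4) by (auto simp: poly_funs_def)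
      have "poly (u * w) t = 0" for t
      proof (cases "D (\<tau> (\<gamma> t)) = 0")
        case True
        thus ?thesis using d(2)[OF aff] w by simp
      next
        case False
        hence "\<tau> (\<gamma> t) \<in> Z" using sub \<gamma>(1) by blast
        hence "mv_eval p (\<tau> (\<gamma> t)) = 0" using P(2) pP by blast
        thus ?thesis using u[of t] by simp
      qed
      hence "u * w = 0" using poly_all_0_iff_0 by blast
      moreover have "poly w 1 \<noteq> 0" using b0 d(2)[OF aff] w[of 1] \<gamma>(3) by metis
      ultimately have "u = 0" by auto
      thus ?thesis using u[of 0] \<gamma>(2) b(2) by simp
    qed
    thus "x \<in> Z" using P(2) b img by auto
  qed
  ultimately show ?thesis unfolding open_dense_in_def by auto
qed

section \<open>Power sums and elementary symmetric functions\<close>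

definition psum :: "nat \<Rightarrow> 'a::comm_ring_1 multiset \<Rightarrow> 'a" where
  "psum m M = (\<Sum>x\<in>#M. x ^ m)"

definition elem_poly :: "'a::comm_ring_1 multiset \<Rightarrow> 'a poly" where
  "elem_poly M = (\<Prod>x\<in>#M. [:1, x:])"

text \<open>Expanding the product over the tagged copies \<open>(x, j)\<close> gives one monomial
  for each subset, of degree its cardinality.\<close>

lemma coeff_elem_poly: "coeff (elem_poly M) i = elem_sym i M"
proof -
  define S where "S = (SIGMA x:set_mset M. {..<count M x})"
  have fin: "finite S" by (simp add: S_def)
  have "elem_poly M = (\<Prod>x\<in>set_mset M. [:1, x:] ^ count M x)"
    unfolding elem_poly_def by (simp add: image_prod_mset_multiplicity)
  also have "\<dots> = (\<Prod>x\<in>set_mset M. \<Prod>j<count M x. [:1, x:])" by simp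
  also have "\<dots> = (\<Prod>a\<in>S. [:1, fst a:])"
    unfolding S_def by (subst prod.Sigma) (auto simp: case_prod_beta)
  also have "\<dots> = (\<Prod>a\<in>S. monom (fst a) 1 + 1)"
    by (intro prod.cong) (auto simp: monom_altdef one_pCons)
  also have "\<dots> = (\<Sum>B\<in>Pow S. (\<Prod>a\<in>B. monom (fst a) 1))"
    by (subst prod_add[OF fin]) simp
  also have "\<dots> = (\<Sum>B\<in>Pow S. monom (\<Prod>a\<in>B. fst a) (card B))"
  proof (intro sum.cong refl)
    fix B assume "B \<in> Pow S"
    with fin have "finite B" using finite_subset by blast
    thus "(\<Prod>a\<in>B. monom (fst a) 1) = monom (\<Prod>a\<in>B. fst a) (card B)"
      by (induction B rule: finite_induct) (simp_all add: mult_monom one_pCons monom_0)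
  qed
  also have "coeff \<dots> i = (\<Sum>B\<in>Pow S. if card B = i then \<Prod>a\<in>B. fst a else 0)"
    by (simp add: coeff_sum)
  also have "\<dots> = (\<Sum>B\<in>{B \<in> Pow S. card B = i}. \<Prod>a\<in>B. fst a)"
    using fin by (subst sum.inter_filter) auto
  finally show ?thesis unfolding elem_sym_def S_def by (simp add: Pow_def conj_commute)
qed

lemma elem_sym_0: "elem_sym 0 M = 1"
  unfolding coeff_elem_poly[symmetric] elem_poly_def
  by (induction M) (simp_all add: coeff_mult)

text \<open>The logarithmic derivative of the product of the factors \<open>1 + x T\<close> is the
  generating series of the signed power sums; it is additive in the multiset, whence the
  induction.\<close>

lemma newton_identity:
  fixes M :: "'a::field multiset"
  shows "of_nat (Suc m) * elem_sym (Suc m) M =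
    (\<Sum>j\<le>m. (-1) ^ j * psum (Suc j) M * elem_sym (m - j) M)"
proof -
  define S where "S = (\<lambda>M :: 'a multiset. Abs_fps (\<lambda>j. (-1) ^ j * psum (Suc j) M))"
  have "fps_deriv (fps_of_poly (elem_poly M)) = fps_of_poly (elem_poly M) * S M"
  proof (induction M)
    case empty
    show ?case by (simp add: S_def psum_def elem_poly_def fps_eq_iff)
  next
    case (add x M)
    define L where "L = fps_of_poly [:1, x:]"
    define R where "R = Abs_fps (\<lambda>j. (-1) ^ j * x ^ Suc j)"
    have E: "fps_of_poly (elem_poly (add_mset x M)) = L * fps_of_poly (elem_poly M)"
      by (simp add: elem_poly_def L_def fps_of_poly_mult)
    have S: "S (add_mset x M) = R + S M"
      by (simp add: S_def R_def psum_def fps_eq_iff ring_distribs)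
    have L: "L = 1 + fps_const x * fps_X"
      by (simp add: L_def fps_of_poly_pCons)
    \<comment> \<open>\<open>R\<close> is the geometric series of
      \<open>x / (1 + x T)\<close>.\<close>
    have LR: "R * L = fps_const x"
    proof (rule fps_ext)
      fix n
      show "(R * L) $ n = fps_const x $ n"
        by (cases n) (simp_all add: L R_def ring_distribs mult.assoc[symmetric] del: mult.assoc)
    qed
    have "fps_deriv L = fps_const x" by (simp add: L)
    thus ?case unfolding E S fps_deriv_mult add.IH
      by (simp add: ring_distribs LR[symmetric] ac_simps)
  qed
  from arg_cong[OF this, of "\<lambda>f. f $ m"]
  have "of_nat (Suc m) * elem_sym (Suc m) M =
      (\<Sum>i=0..m. elem_sym i M * ((-1) ^ (m - i) * psum (Suc (m - i)) M))"
    by (simp add: fps_mult_nth S_def coeff_elem_poly)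
  also have "\<dots> = (\<Sum>j\<le>m. (-1) ^ j * psum (Suc j) M * elem_sym (m - j) M)"
    by (rule sum.reindex_bij_witness[of _ "\<lambda>j. m - j" "\<lambda>j. m - j"]) auto
  finally show ?thesis .
qed

text \<open>Newton's identity solved for the power sum of exponent \<open>m + 1\<close>. It needs no
  division and reads only \<open>e 1\<close>, ..., \<open>e (m + 1)\<close>.\<close>

fun newton :: "(nat \<Rightarrow> 'a::field) \<Rightarrow> nat \<Rightarrow> 'a" where
  "newton e m = (-1) ^ m * (of_nat (Suc m) * e (Suc m) -
     (\<Sum>j<m. (-1) ^ j * newton e j * e (m - j)))"

declare newton.simps [simp del]

lemma psum_Suc_eq_newton:
  fixes M :: "'a::field multiset"
  shows "psum (Suc m) M = newton (\<lambda>i. elem_sym i M) m"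
proof (induction m rule: less_induct)
  case (less m)
  have "{..m} = insert m {..<m}" by auto
  hence "of_nat (Suc m) * elem_sym (Suc m) M = (-1) ^ m * psum (Suc m) M +
      (\<Sum>j<m. (-1) ^ j * psum (Suc j) M * elem_sym (m - j) M)"
    unfolding newton_identity by (simp add: elem_sym_0)
  also have "(\<Sum>j<m. (-1) ^ j * psum (Suc j) M * elem_sym (m - j) M) =
      (\<Sum>j<m. (-1) ^ j * newton (\<lambda>i. elem_sym i M) j * elem_sym (m - j) M)"
    by (intro sum.cong) (auto simp: less)
  finally show ?case
    by (subst newton.simps) (simp add: mult.assoc[symmetric] flip: power_mult_distrib)
qed

context fun_alg begin

lemma newton_closed:
  assumes "\<And>i. 0 < i \<Longrightarrow> i \<le> Suc m \<Longrightarrow> (\<lambda>s. e s i) \<in> A"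
  shows "(\<lambda>s. newton (e s) m) \<in> A"
  using assms
proof (induction m rule: less_induct)
  case (less m)
  show ?case unfolding newton.simps[of _ m]
    by (intro mult const diff sum less) auto
qed

lemma psum_closed:
  assumes "\<And>i. (\<lambda>s. elem_sym i (M s)) \<in> A"
  shows "(\<lambda>s. psum (Suc m) (M s)) \<in> A"
  unfolding psum_Suc_eq_newton by (intro newton_closed assms)

end

text \<open>The converse passage, from power sums to elementary symmetric functions, divides by
  positive integers.\<close>

lemma (in fun_alg) elem_sym_closed:
  fixes M :: "'s \<Rightarrow> 'a multiset"
  assumes "\<And>m. (\<lambda>s. psum (Suc m) (M s)) \<in> A" and char0: "\<And>n. of_nat (Suc n) \<noteq> (0::'a)"
  shows "(\<lambda>s. elem_sym i (M s)) \<in> A"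
proof (induction i rule: less_induct)
  case (less i)
  show ?case
  proof (cases i)
    case 0
    thus ?thesis by (simp add: elem_sym_0 const)
  next
    case (Suc m)
    have "elem_sym (Suc m) (M s) =
        (\<Sum>j\<le>m. (-1) ^ j * psum (Suc j) (M s) * elem_sym (m - j) (M s)) / of_nat (Suc m)" for s
      using newton_identity[of m "M s"] char0[of m]
      by (simp only: eq_divide_eq mult.commute) simp
    thus ?thesis unfolding Suc
      by (simp only:) (intro divide sum mult const less assms(1); simp add: Suc)
  qed
qed

section \<open>Sums over the roots of a polynomial\<close>

lemma monic_eq_prod_roots:
  fixes G :: "'a::alg_closed_field poly"
  assumes "lead_coeff G = 1"
  shows "G = (\<Prod>z\<in>#proots G. [:- z, 1:])" "size (proots G) = degree G"
proof -
  have "G \<noteq> 0" using assms by auto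
  then obtain M where M: "size M = degree G" "G = (\<Prod>z\<in>#M. [:- z, 1:])"
    using alg_closed_imp_factorization[of G] assms by auto
  have "proots G = M"
  proof -
    have "proots (\<Prod>z\<in>#M. [:- z, 1:]) = M"
    proof (induction M)
      case (add z M)
      have "(\<Prod>z\<in>#M. [:- z, 1:]) \<noteq> 0" by (auto simp: prod_mset_zero_iff)
      thus ?case using add by (simp add: proots_mult del: mult_pCons_left)
    qed simp
    thus ?thesis using M(2) by simp
  qed
  with M show "G = (\<Prod>z\<in>#proots G. [:- z, 1:])" "size (proots G) = degree G" by simp_all
qed

lemma psum_uminus: "psum m (image_mset uminus M) = (-1) ^ m * psum m M"
proof (induction M)
  case (add x M)
  have "(- x) ^ m = (-1) ^ m * x ^ m" by (rule power_minus)
  with add show ?case by (simp add: psum_def ring_distribs)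
qed (simp add: psum_def)

text \<open>With negated roots, Vieta's formulas hold without signs: the elementary symmetric
  functions are the coefficients read from the top.\<close>

lemma elem_poly_proots:
  fixes G :: "'a::alg_closed_field poly"
  assumes "lead_coeff G = 1"
  shows "elem_poly (image_mset uminus (proots G)) = reflect_poly G"
proof -
  have "reflect_poly (\<Prod>z\<in>#M. [:- z, 1:]) = elem_poly (image_mset uminus M)" for M :: "'a multiset"
  proof (induction M)
    case (add z M)
    have "reflect_poly [:- z, 1:] = [:1, - z:]" by (simp add: reflect_poly_def)
    with add show ?case
      by (simp add: elem_poly_def reflect_poly_mult del: mult_pCons_left)
  qed (simp add: elem_poly_def)
  thus ?thesis using monic_eq_prod_roots(1)[OF assms] by metis
qed


text \<open>Vieta and Newton make the power sums of the roots polynomial in the coefficients of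
  \<open>G\<close>; the sum over the roots is then linear in the coefficients of
  \<open>H\<close>.\<close>

lemma sum_roots_closed:
  fixes G H :: "'s \<Rightarrow> 'a::alg_closed_field poly"
  assumes "fun_alg A" and G: "fun_alg.poly_fam A G" "\<And>s. degree (G s) = N" "\<And>s. lead_coeff (G s) = 1"
    and H: "fun_alg.poly_fam A H" "\<And>s. degree (H s) \<le> n"
  shows "(\<lambda>s. \<Sum>z\<in>#proots (G s). poly (H s) z) \<in> A"
proof -
  interpret fun_alg A by fact
  have "(\<lambda>s. elem_sym i (image_mset uminus (proots (G s)))) \<in> A" for i
    unfolding coeff_elem_poly[symmetric] elem_poly_proots[OF G(3)] coeff_reflect_poly G(2)
    by (cases "i \<le> N") (auto simp: const intro!: poly_famD G(1))
  hence "(\<lambda>s. psum (Suc m) (image_mset uminus (proots (G s)))) \<in> A" for m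
    by (rule psum_closed)
  hence "(\<lambda>s. (-1) ^ Suc m * psum (Suc m) (image_mset uminus (proots (G s)))) \<in> A" for m
    by (intro mult const)
  hence "(\<lambda>s. psum (Suc m) (proots (G s))) \<in> A" for m
    unfolding psum_uminus by (simp flip: mult.assoc power_mult_distrib)
  moreover have "(\<lambda>s. psum 0 (proots (G s))) \<in> A"
    using monic_eq_prod_roots(2)[OF G(3)] G(2) by (simp add: psum_def const)
  ultimately have *: "(\<lambda>s. psum m (proots (G s))) \<in> A" for m by (cases m) auto
  have "(\<Sum>z\<in>#proots (G s). poly (H s) z) = (\<Sum>i\<le>n. coeff (H s) i * psum i (proots (G s)))" for s
  proof -
    have "(\<Sum>z\<in>#proots (G s). poly (H s) z) = (\<Sum>z\<in>#proots (G s). \<Sum>i\<le>n. coeff (H s) i * z ^ i)"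
      by (intro arg_cong[of _ _ sum_mset] image_mset_cong poly_eq_sum_upto H(2))
    also have "\<dots> = (\<Sum>i\<le>n. coeff (H s) i * psum i (proots (G s)))"
    proof -
      have "(\<Sum>z\<in>#M. \<Sum>i\<le>n. c i * z ^ i) = (\<Sum>i\<le>n. c i * psum i M)" for c and M :: "'a multiset"
        unfolding psum_def by (induction M) (simp_all add: sum.distrib ring_distribs)
      thus ?thesis .
    qed
    finally show ?thesis .
  qed
  thus ?thesis using * by (simp only:) (intro sum mult poly_famD H(1))
qed

lemma mod_linear: "h mod [:- z, 1:] = [:poly h z:]" for z :: "'a::field"
proof -
  have "[:- z, 1:] dvd h - [:poly h z:]" by (simp add: poly_eq_0_iff_dvd[symmetric])
  hence "h mod [:- z, 1:] = [:poly h z:] mod [:- z, 1:]" by (simp add: mod_eq_dvd_iff)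
  thus ?thesis by (simp add: mod_poly_less)
qed

text \<open>Both sides are the residue at infinity of \<open>h G' / G\<close>, up to sign.\<close>

lemma sum_roots_eq_coeff:
  fixes G :: "'a::alg_closed_field poly"
  assumes "lead_coeff G = 1"
  shows "(\<Sum>z\<in>#proots G. poly h z) = coeff ((h * pderiv G) mod G) (degree G - 1)"
proof -
  have "(\<Sum>z\<in>#M. poly h z) = coeff ((h * pderiv G) mod G) (size M - 1)"
    if "G = (\<Prod>z\<in>#M. [:- z, 1:])" for M and G :: "'a poly"
    using that
  proof (induction M arbitrary: G)
    case empty
    thus ?case by simp
  next
    case (add z M)
    define K where "K = (\<Prod>z\<in>#M. [:- z, 1:])"
    have G: "G = [:- z, 1:] * K" using add.prems by (simp add: K_def)
    have "degree K = size M \<and> lead_coeff K = 1"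
      unfolding K_def
    proof (induction M)
      case (add z M)
      hence "(\<Prod>z\<in>#M. [:- z, 1:]) \<noteq> 0" by auto
      moreover have "lead_coeff ([:- z, 1:] * (\<Prod>z\<in>#M. [:- z, 1:])) = 1"
        unfolding lead_coeff_mult conjunct2[OF add.IH] by simp
      moreover have "degree ([:- z, 1:] * (\<Prod>z\<in>#M. [:- z, 1:])) = Suc (size M)"
        using add \<open>(\<Prod>z\<in>#M. [:- z, 1:]) \<noteq> 0\<close> by (subst degree_mult_eq) auto
      ultimately show ?case by (simp del: mult_pCons_left)
    qed simp
    hence degK: "degree K = size M" "lead_coeff K = 1" by auto
    have "pderiv [:- z, 1:] = 1" by (simp add: pderiv_pCons)
    \<comment> \<open>By the product rule each summand shares a factor with \<open>G\<close>, which
      can be cancelled from the reduction: what remains is \<open>h\<close> modulo the linear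
      factor, which is its value at \<open>z\<close>, and the induction hypothesis.\<close>
    hence "h * pderiv G = K * h + [:- z, 1:] * (h * pderiv K)"
      unfolding G pderiv_mult by (simp only: ring_distribs ac_simps mult_1_right mult_1_left)
    hence "(h * pderiv G) mod G = (K * h) mod (K * [:- z, 1:]) +
        ([:- z, 1:] * (h * pderiv K)) mod ([:- z, 1:] * K)"
      unfolding G by (simp only: poly_mod_add_left mult.commute[of K "[:- z, 1:]"])
    also have "\<dots> = smult (poly h z) K + [:- z, 1:] * ((h * pderiv K) mod K)"
      by (simp add: mod_mult_mult1 mod_linear del: mult_pCons_left mult_pCons_right)
        (simp only: mult_pCons_right mult_zero_right, simp)
    finally have eq: "(h * pderiv G) mod G =
        smult (poly h z) K + [:- z, 1:] * ((h * pderiv K) mod K)" .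
    define r where "r = (h * pderiv K) mod K"
    have IH: "(\<Sum>z\<in>#M. poly h z) = coeff r (size M - 1)"
      using add.IH[OF K_def] by (simp add: r_def)
    have "coeff ([:- z, 1:] * r) (size M) = coeff r (size M - 1)"
    proof (cases "size M")
      \<comment> \<open>Here \<open>K\<close> is a nonzero constant, so the remainder vanishes and
        the truncated index \<open>size M - 1\<close> does no harm.\<close>
      case 0
      hence "r = 0" using degK degree_0_id[of K] by (simp add: r_def K_def)
      thus ?thesis by simp
    next
      case (Suc n)
      have "K \<noteq> 0" using degK by auto
      hence "r = 0 \<or> degree r < degree K" unfolding r_def by (rule degree_mod_less)
      hence "coeff r (size M) = 0" using degK by (auto simp: coeff_eq_0)
      thus ?thesis by (simp add: Suc)
    qed
    thus ?case using degK IH unfolding eq r_def[symmetric] by simp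
  qed
  from this[OF monic_eq_prod_roots(1)[OF assms]] monic_eq_prod_roots(2)[OF assms]
  show ?thesis by simp
qed

section \<open>The projective line\<close>

text \<open>Homogeneous coordinates. The pair \<open>(0, 0)\<close> is sent to \<open>Infty\<close>
  as well, so statements on coordinates carry the hypothesis \<open>nz\<close>.\<close>

definition pt :: "'a::field \<Rightarrow> 'a \<Rightarrow> 'a P1" where
  "pt u v = (if v = 0 then Infty else Fin (u / v))"

definition nz :: "'a::field \<Rightarrow> 'a \<Rightarrow> bool" where
  "nz u v \<longleftrightarrow> u \<noteq> 0 \<or> v \<noteq> 0"

lemma pt_scale: "c \<noteq> 0 \<Longrightarrow> pt (c * u) (c * v) = pt u v"
  by (simp add: pt_def)

lemma pt_eq_iff: "nz u v \<Longrightarrow> nz u' v' \<Longrightarrow> pt u v = pt u' v' \<longleftrightarrow> u * v' = u' * v"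
  by (auto simp: pt_def nz_def field_simps)

lemma Fin_eq_pt: "Fin z = pt z 1" and Infty_eq_pt: "Infty = pt 1 0"
  by (simp_all add: pt_def)

lemma P1_cases_pt: obtains u v where "nz u v" "P = pt u v"
proof (cases P)
  case (Fin z)
  thus ?thesis using that[of z 1] by (simp add: nz_def Fin_eq_pt)
next
  case Infty
  thus ?thesis using that[of 1 0] by (simp add: nz_def Infty_eq_pt)
qed

lemma P1_fun_eqI: "(\<And>u v. nz u v \<Longrightarrow> f (pt u v) = g (pt u v)) \<Longrightarrow> f = g"
  by (rule ext) (metis P1_cases_pt)

text \<open>The value at \<open>(u, v)\<close> of the form of degree \<open>d\<close> with dehomogenisation \<open>p\<close>.\<close>

definition hev :: "nat \<Rightarrow> 'a::field poly \<Rightarrow> 'a \<Rightarrow> 'a \<Rightarrow> 'a" where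
  "hev d p u v = (\<Sum>i\<le>d. coeff p i * u ^ i * v ^ (d - i))"

lemma hev_finite: 
  assumes "degree p \<le> d" "v \<noteq> 0"
  shows "hev d p u v = v ^ d * poly p (u / v)"
proof -
  have "poly p (u / v) = (\<Sum>i\<le>d. coeff p i * (u / v) ^ i)"
    unfolding poly_altdef using assms by (intro sum.mono_neutral_left) (auto simp: coeff_eq_0)
  hence eq: "v ^ d * poly p (u / v) = (\<Sum>i\<le>d. v ^ d * (coeff p i * (u / v) ^ i))"
    by (simp only: sum_distrib_left)
  have *: "coeff p i * u ^ i * v ^ (d - i) = v ^ d * (coeff p i * (u / v) ^ i)" if "i \<le> d" for i
    using that assms by (simp add: power_divide field_simps flip: power_add)
  show ?thesis unfolding hev_def eq by (intro sum.cong refl *) simp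
qed

lemma hev_infty: "hev d p u 0 = coeff p d * u ^ d"
proof -
  have "hev d p u 0 = (\<Sum>i\<le>d. if i = d then coeff p i * u ^ i else 0)"
    unfolding hev_def by (intro sum.cong) (auto simp: power_0_left)
  thus ?thesis by simp
qed

lemma hev_lin: "hev d (smult a p + smult b q) u v = a * hev d p u v + b * hev d q u v"
  by (simp add: hev_def sum.distrib sum_distrib_left ring_distribs ac_simps)

lemma ratmap_Fin: "ratmap p q (Fin z) = pt (poly p z) (poly q z)"
  by (simp add: pt_def)

lemma ratmap_pt:
  assumes "max (degree p) (degree q) = d" "nz u v"
  shows "ratmap p q (pt u v) = pt (hev d p u v) (hev d q u v)"
proof (cases "v = 0")
  case True
  hence "pt u v = Infty" "u \<noteq> 0" using assms(2) by (auto simp: pt_def nz_def)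
  thus ?thesis using True assms(1) by (auto simp: hev_infty pt_def Let_def)
next
  case False
  hence "pt u v = Fin (u / v)" by (simp add: pt_def)
  thus ?thesis using False assms(1) pt_scale[of "v ^ d"]
    by (subst (1 2) hev_finite) (auto simp: ratmap_Fin simp del: ratmap.simps)
qed

lemma coprime_bezout:
  fixes p q :: "'a::field poly"
  assumes "coprime p q"
  shows "\<exists>a b. a * p + b * q = 1"
  using assms
proof (induction "if q = 0 then 0 else Suc (degree q)" arbitrary: p q rule: less_induct)
  case less
  show ?case
  proof (cases "q = 0")
    case True
    hence "p dvd 1" using less.prems by simp
    then obtain a where "1 = p * a" by (elim dvdE)
    thus ?thesis by (intro exI[of _ a] exI[of _ 0]) (simp add: mult.commute)
  next
    case False
    have "coprime q (p mod q)"
    proof (rule coprimeI)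
      fix c assume "c dvd q" "c dvd p mod q"
      moreover from this have "c dvd p" using dvd_mod_iff by blast
      ultimately show "is_unit c" using less.prems coprime_common_divisor by blast
    qed
    moreover have "(if p mod q = 0 then 0 else Suc (degree (p mod q))) < Suc (degree q)"
      using degree_mod_less[OF False, of p] by auto
    ultimately obtain a b where "a * q + b * (p mod q) = 1"
      using less.hyps[of "p mod q" q] False by auto
    moreover have "p mod q = p - (p div q) * q" by (simp add: minus_div_mult_eq_mod)
    ultimately have "b * p + (a - b * (p div q)) * q = 1" by (simp add: algebra_simps)
    thus ?thesis by blast
  qed
qed

lemma coprime_iff_no_common_root:
  fixes p q :: "'a::alg_closed_field poly"
  shows "coprime p q \<longleftrightarrow> (\<forall>x. poly p x \<noteq> 0 \<or> poly q x \<noteq> 0)"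
proof
  assume "coprime p q"
  then obtain a b where "a * p + b * q = 1" using coprime_bezout by blast
  hence "poly a x * poly p x + poly b x * poly q x = 1" for x
    by (metis poly_add poly_mult poly_1)
  thus "\<forall>x. poly p x \<noteq> 0 \<or> poly q x \<noteq> 0" by (metis mult_zero_right add_0 zero_neq_one)
next
  assume nr: "\<forall>x. poly p x \<noteq> 0 \<or> poly q x \<noteq> 0"
  show "coprime p q"
  proof (rule coprimeI)
    fix c assume c: "c dvd p" "c dvd q"
    have "c \<noteq> 0" using c nr by auto
    moreover have "degree c = 0"
    proof (rule ccontr)
      assume "degree c \<noteq> 0"
      then obtain x where "poly c x = 0" using alg_closed_imp_poly_has_root[of c] by auto
      hence "poly p x = 0" "poly q x = 0" using c by (auto elim!: dvdE)
      thus False using nr by blast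
    qed
    ultimately show "is_unit c" by (simp add: is_unit_iff_degree)
  qed
qed

text \<open>A common zero with \<open>v = 0\<close> means that both degrees drop. Coprimality and
  exact degree thus merge into one condition without points at infinity, which is visibly stable
  under invertible substitutions on either side.\<close>

lemma coprime_degree_iff_hev:
  fixes p q :: "'a::alg_closed_field poly"
  assumes "degree p \<le> d" "degree q \<le> d"
  shows "coprime p q \<and> max (degree p) (degree q) = d \<longleftrightarrow>
    (\<forall>u v. nz u v \<longrightarrow> nz (hev d p u v) (hev d q u v))"
proof (intro iffI conjI allI impI)
  fix u v :: 'a assume pq: "coprime p q \<and> max (degree p) (degree q) = d" and uv: "nz u v"
  show "nz (hev d p u v) (hev d q u v)"
  proof (cases "v = 0")
    case True
    have "coeff p d \<noteq> 0 \<or> coeff q d \<noteq> 0"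
    proof (rule ccontr)
      assume neg: "\<not> ?thesis"
      hence "degree p \<noteq> d \<or> p = 0" "degree q \<noteq> d \<or> q = 0" by (metis leading_coeff_neq_0)+
      hence "p = 0 \<and> q = 0" using pq neg by (auto simp: max_def split: if_splits) 
      thus False using pq by auto
    qed
    thus ?thesis using True uv by (auto simp: hev_infty nz_def)
  next
    case False
    thus ?thesis using pq assms uv
      by (auto simp: hev_finite nz_def coprime_iff_no_common_root)
  qed
next
  assume h: "\<forall>u v. nz u v \<longrightarrow> nz (hev d p u v) (hev d q u v)"
  show "coprime p q" unfolding coprime_iff_no_common_root
  proof
    fix x show "poly p x \<noteq> 0 \<or> poly q x \<noteq> 0"
      using h[rule_format, of x 1] assms by (auto simp: hev_finite nz_def)
  qed
  have "coeff p d \<noteq> 0 \<or> coeff q d \<noteq> 0"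
    using h[rule_format, of 1 0] by (auto simp: hev_infty nz_def)
  thus "max (degree p) (degree q) = d" using assms le_degree by (metis le_antisym max.cobounded1 max.cobounded2 max.bounded_iff)
qed

section \<open>Moebius transformations\<close>

definition mob :: "'a::field \<Rightarrow> 'a \<Rightarrow> 'a \<Rightarrow> 'a \<Rightarrow> 'a P1 \<Rightarrow> 'a P1" where
  "mob a b c d = ratmap [:b, a:] [:d, c:]"

lemma PGL2_eq: "PGL2 = {mob a b c d | a b c d. a * d - b * c \<noteq> 0}"
  by (simp add: PGL2_def mob_def)

lemma nz_mob: "a * d - b * c \<noteq> 0 \<Longrightarrow> nz u v \<Longrightarrow> nz (a * u + b * v) (c * u + d * v)"
  unfolding nz_def
proof (rule ccontr)
  assume det: "a * d - b * c \<noteq> 0" and uv: "u \<noteq> 0 \<or> v \<noteq> 0"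
    and neg: "\<not> (a * u + b * v \<noteq> 0 \<or> c * u + d * v \<noteq> 0)"
  have "(a * d - b * c) * u = d * (a * u + b * v) - b * (c * u + d * v)"
    "(a * d - b * c) * v = a * (c * u + d * v) - c * (a * u + b * v)"
    by (simp_all add: algebra_simps)
  with neg det uv show False by simp
qed

lemma mob_pt:
  assumes "a * d - b * c \<noteq> 0" "nz u v"
  shows "mob a b c d (pt u v) = pt (a * u + b * v) (c * u + d * v)"
proof -
  have "max (degree [:b, a:]) (degree [:d, c:]) = 1" using assms by auto
  from ratmap_pt[OF this assms(2)] show ?thesis
    by (simp add: mob_def hev_def add.commute)
qed

lemma mob_comp:
  assumes "a * d - b * c \<noteq> 0" "a' * d' - b' * c' \<noteq> 0"
  shows "mob a b c d \<circ> mob a' b' c' d' =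
    mob (a * a' + b * c') (a * b' + b * d') (c * a' + d * c') (c * b' + d * d')"
    and "(a * a' + b * c') * (c * b' + d * d') - (a * b' + b * d') * (c * a' + d * c') \<noteq> 0"
proof -
  have "(a * a' + b * c') * (c * b' + d * d') - (a * b' + b * d') * (c * a' + d * c') =
      (a * d - b * c) * (a' * d' - b' * c')" by (simp add: algebra_simps)
  with assms show det: "(a * a' + b * c') * (c * b' + d * d') - (a * b' + b * d') * (c * a' + d * c') \<noteq> 0"
    by simp
  show "mob a b c d \<circ> mob a' b' c' d' =
    mob (a * a' + b * c') (a * b' + b * d') (c * a' + d * c') (c * b' + d * d')"
  proof (rule P1_fun_eqI)
    fix u v :: 'a assume uv: "nz u v"
    have "a * (a' * u + b' * v) + b * (c' * u + d' * v) = (a * a' + b * c') * u + (a * b' + b * d') * v"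
      "c * (a' * u + b' * v) + d * (c' * u + d' * v) = (c * a' + d * c') * u + (c * b' + d * d') * v"
      by (simp_all add: algebra_simps)
    thus "(mob a b c d \<circ> mob a' b' c' d') (pt u v) =
        mob (a * a' + b * c') (a * b' + b * d') (c * a' + d * c') (c * b' + d * d') (pt u v)"
      by (simp only: o_apply mob_pt[OF assms(2) uv] mob_pt[OF assms(1) nz_mob[OF assms(2) uv]]
          mob_pt[OF det uv])
  qed
qed

lemma mob_scalar: "c \<noteq> 0 \<Longrightarrow> mob c 0 0 c = id"
  by (intro P1_fun_eqI) (simp add: mob_pt pt_scale)

lemma mob_inverse:
  assumes "a * d - b * c \<noteq> 0"
  shows "mob d (- b) (- c) a \<circ> mob a b c d = id" "mob a b c d \<circ> mob d (- b) (- c) a = id"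
proof -
  have det: "d * a - (- b) * (- c) \<noteq> 0" using assms by (simp add: algebra_simps)
  show "mob d (- b) (- c) a \<circ> mob a b c d = id" "mob a b c d \<circ> mob d (- b) (- c) a = id"
    using assms det mob_scalar[of "a * d - b * c"]
    by (simp_all add: mob_comp) (simp_all add: algebra_simps)
qed

lemma inv_mob: "a * d - b * c \<noteq> 0 \<Longrightarrow> inv (mob a b c d) = mob d (- b) (- c) a"
  using mob_inverse[of a d b c] by (intro inv_unique_comp)

lemma bij_PGL2: "s \<in> PGL2 \<Longrightarrow> bij s"
  unfolding PGL2_eq using mob_inverse o_bij by blast

lemma PGL2_id: "(id :: 'a::field P1 \<Rightarrow> 'a P1) \<in> PGL2"
proof -
  have "id = mob 1 0 0 (1 :: 'a) \<and> 1 * 1 - 0 * 0 \<noteq> (0 :: 'a)" using mob_scalar[of "1 :: 'a"] by simp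
  thus ?thesis unfolding PGL2_eq by blast
qed

lemma PGL2_comp: "(s :: 'a::field P1 \<Rightarrow> 'a P1) \<in> PGL2 \<Longrightarrow> t \<in> PGL2 \<Longrightarrow> s \<circ> t \<in> PGL2"
  unfolding PGL2_eq
proof clarify
  fix a b c d a' b' c' d' :: 'a assume det: "a * d - b * c \<noteq> 0" "a' * d' - b' * c' \<noteq> 0"
  show "\<exists>x y z w. mob a b c d \<circ> mob a' b' c' d' = mob x y z w \<and> x * w - y * z \<noteq> 0"
    using mob_comp[OF det] by blast
qed

lemma PGL2_inv: "(s :: 'a::field P1 \<Rightarrow> 'a P1) \<in> PGL2 \<Longrightarrow> inv s \<in> PGL2"
  unfolding PGL2_eq
proof clarify
  fix a b c d :: 'a assume "a * d - b * c \<noteq> 0"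
  thus "\<exists>a' b' c' d'. inv (mob a b c d) = mob a' b' c' d' \<and> a' * d' - b' * c' \<noteq> 0"
    by (intro exI[of _ d] exI[of _ "- b"] exI[of _ "- c"] exI[of _ a])
      (simp add: inv_mob algebra_simps)
qed

lemma flip_eq_mob: "flip = mob 0 1 1 0"
proof
  fix P :: "'a P1"
  show "flip P = mob 0 1 1 0 P"
    by (cases P) (auto simp: mob_pt Fin_eq_pt Infty_eq_pt nz_def, auto simp: pt_def)
qed

lemma flip_PGL2: "(flip :: 'a::field P1 \<Rightarrow> 'a P1) \<in> PGL2"
proof -
  have "flip = mob 0 1 1 (0 :: 'a) \<and> 0 * 0 - 1 * 1 \<noteq> (0 :: 'a)" using flip_eq_mob by simp
  thus ?thesis unfolding PGL2_eq by blast
qed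

lemma inv_flip: "inv flip = flip"
proof -
  have "mob 0 (- 1) (- 1) 0 = mob 0 1 1 (0 :: 'a)"
  proof (rule P1_fun_eqI)
    fix u v :: 'a assume "nz u v"
    thus "mob 0 (- 1) (- 1) 0 (pt u v) = mob 0 1 1 0 (pt u v)"
      using pt_scale[of "- 1" v u] by (simp add: mob_pt)
  qed
  thus ?thesis unfolding flip_eq_mob by (simp add: inv_mob)
qed

text \<open>The form of degree \<open>d\<close> belonging to \<open>p\<close>, with polynomials
  substituted for both of its variables; for linear \<open>u\<close>, \<open>v\<close> this is the
  pullback under a Moebius transformation.\<close>

definition hpoly :: "nat \<Rightarrow> 'a::field poly \<Rightarrow> 'a poly \<Rightarrow> 'a poly \<Rightarrow> 'a poly" where
  "hpoly d p u v = (\<Sum>i\<le>d. smult (coeff p i) (u ^ i * v ^ (d - i)))"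

lemma poly_hpoly: "poly (hpoly d p u v) x = hev d p (poly u x) (poly v x)"
  by (simp add: hpoly_def hev_def poly_sum mult.assoc)

lemma coeff_mult_bound:
  assumes "degree p \<le> m" "degree q \<le> n"
  shows "coeff (p * q) (m + n) = coeff p m * coeff q n"
proof -
  have "coeff p i * coeff q (m + n - i) = (if i = m then coeff p m * coeff q n else 0)" for i
    using assms by (cases i m rule: linorder_cases) (auto simp: coeff_eq_0)
  thus ?thesis by (simp add: coeff_mult)
qed

lemma coeff_power_bound:
  assumes "degree p \<le> m"
  shows "degree (p ^ n) \<le> n * m" "coeff (p ^ n) (n * m) = coeff p m ^ n"
proof -
  show d: "degree (p ^ n) \<le> n * m" for n
    using degree_power_le[of p n] assms by (metis le_trans mult.commute mult_le_mono2)
  show "coeff (p ^ n) (n * m) = coeff p m ^ n"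
    by (induction n) (simp_all add: coeff_mult_bound[OF assms d])
qed

lemma hpoly_linear:
  assumes "degree u \<le> 1" "degree v \<le> 1"
  shows "degree (hpoly d p u v) \<le> d" "coeff (hpoly d p u v) d = hev d p (coeff u 1) (coeff v 1)"
proof -
  have *: "degree (u ^ i) \<le> i" "coeff (u ^ i) i = coeff u 1 ^ i"
    "degree (v ^ i) \<le> i" "coeff (v ^ i) i = coeff v 1 ^ i" for i
    using coeff_power_bound[OF assms(1), of i] coeff_power_bound[OF assms(2), of i] by auto
  have "degree (u ^ i * v ^ (d - i)) \<le> d \<and>
    coeff (u ^ i * v ^ (d - i)) d = coeff u 1 ^ i * coeff v 1 ^ (d - i)" if "i \<le> d" for i
    using coeff_mult_bound[OF *(1)[of i] *(3)[of "d - i"]] that *[of i] *[of "d - i"]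
      degree_mult_le[of "u ^ i" "v ^ (d - i)"] by simp
  thus "degree (hpoly d p u v) \<le> d" "coeff (hpoly d p u v) d = hev d p (coeff u 1) (coeff v 1)"
    unfolding hpoly_def hev_def
    by (auto simp: coeff_sum mult.assoc intro!: degree_sum_le order.trans[OF degree_smult_le])
qed

lemma hev_hpoly:
  "hev d (hpoly d p [:b, a:] [:c', c:]) x y = hev d p (a * x + b * y) (c * x + c' * y)"
proof -
  have hom: "hev d p (w * s) (w * t) = w ^ d * hev d p s t" for w s t
    by (simp add: hev_def sum_distrib_left power_mult_distrib, intro sum.cong refl)
      (simp add: power_add[symmetric] ac_simps)
  have deg: "degree [:b, a:] \<le> 1" "degree [:c', c:] \<le> 1" by auto
  note h = hpoly_linear[OF deg, of d p]
  show ?thesis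
  proof (cases "y = 0")
    case True
    thus ?thesis using h(2) hom[of x a c] by (simp add: hev_infty mult.commute)
  next
    case False
    thus ?thesis using hom[of y "b + a * (x / y)" "c' + c * (x / y)"]
      by (simp add: hev_finite[OF h(1)] poly_hpoly algebra_simps)
  qed
qed

lemma ratmap_comp_mob:
  fixes p q :: "'a::alg_closed_field poly"
  assumes "coprime p q" "max (degree p) (degree q) = D" "a * d - b * c \<noteq> 0"
  defines "p' \<equiv> hpoly D p [:b, a:] [:d, c:]" and "q' \<equiv> hpoly D q [:b, a:] [:d, c:]"
  shows "ratmap p q \<circ> mob a b c d = ratmap p' q'" "coprime p' q'" "max (degree p') (degree q') = D"
proof -
  have deg: "degree p' \<le> D" "degree q' \<le> D" unfolding p'_def q'_def by (intro hpoly_linear; simp)+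
  have "nz (hev D p u v) (hev D q u v)" if "nz u v" for u v
    using coprime_degree_iff_hev[of p D q] assms that by auto
  hence "nz (hev D p' u v) (hev D q' u v)" if "nz u v" for u v
    unfolding p'_def q'_def hev_hpoly using nz_mob[OF assms(3) that] by blast
  thus *: "coprime p' q'" "max (degree p') (degree q') = D"
    using coprime_degree_iff_hev[OF deg] by blast+
  show "ratmap p q \<circ> mob a b c d = ratmap p' q'"
    using assms(2,3) * nz_mob[OF assms(3)]
    by (intro P1_fun_eqI) (simp add: mob_pt ratmap_pt, simp add: p'_def q'_def hev_hpoly)
qed

lemma mob_comp_ratmap:
  fixes p q :: "'a::alg_closed_field poly"
  assumes "coprime p q" "max (degree p) (degree q) = D" "a * d - b * c \<noteq> 0"
  defines "p' \<equiv> smult a p + smult b q" and "q' \<equiv> smult c p + smult d q"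
  shows "mob a b c d \<circ> ratmap p q = ratmap p' q'" "coprime p' q'" "max (degree p') (degree q') = D"
proof -
  have deg: "degree p' \<le> D" "degree q' \<le> D"
    unfolding p'_def q'_def using assms(2)
    by (auto intro!: degree_add_le order.trans[OF degree_smult_le])
  have nzpq: "nz (hev D p u v) (hev D q u v)" if "nz u v" for u v
    using coprime_degree_iff_hev[of p D q] assms that by auto
  hence "nz (hev D p' u v) (hev D q' u v)" if "nz u v" for u v
    unfolding p'_def q'_def hev_lin using nz_mob[OF assms(3)] that by blast
  thus *: "coprime p' q'" "max (degree p') (degree q') = D"
    using coprime_degree_iff_hev[OF deg] by blast+
  show "mob a b c d \<circ> ratmap p q = ratmap p' q'"
    using assms(2,3) * nzpq
    by (intro P1_fun_eqI) (simp add: mob_pt ratmap_pt, simp add: p'_def q'_def hev_lin)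
qed

section \<open>Conjugacy and independence of the representation in lowest terms\<close>

lemma equiv_conj_rel: "equiv (Hom_deg n) (conj_rel n :: (('a::alg_closed_field P1 \<Rightarrow> 'a P1) \<times> _) set)"
proof (rule equivI)
  show "conj_rel n \<subseteq> Hom_deg n \<times> (Hom_deg n :: ('a P1 \<Rightarrow> 'a P1) set)" by (auto simp: conj_rel_def)
  show "refl_on (Hom_deg n) (conj_rel n :: (('a P1 \<Rightarrow> 'a P1) \<times> _) set)"
    using PGL2_id by (force simp: refl_on_def conj_rel_def intro!: bexI[of _ id])
  show "sym (conj_rel n :: (('a P1 \<Rightarrow> 'a P1) \<times> _) set)"
  proof (rule symI)
    fix f g :: "'a P1 \<Rightarrow> 'a P1" assume "(f, g) \<in> conj_rel n"
    then obtain s where s: "s \<in> PGL2" "g = inv s \<circ> f \<circ> s" "f \<in> Hom_deg n" "g \<in> Hom_deg n"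
      by (auto simp: conj_rel_def)
    have b: "bij s" using bij_PGL2 s by blast
    have "f = inv (inv s) \<circ> g \<circ> inv s"
      using b by (simp add: s(2) inv_inv_eq fun_eq_iff bij_is_surj surj_f_inv_f)
    thus "(g, f) \<in> conj_rel n" using s PGL2_inv by (auto simp: conj_rel_def)
  qed
  show "trans (conj_rel n :: (('a P1 \<Rightarrow> 'a P1) \<times> _) set)"
  proof (rule transI)
    fix f g h :: "'a P1 \<Rightarrow> 'a P1" assume "(f, g) \<in> conj_rel n" "(g, h) \<in> conj_rel n"
    then obtain s t where *: "s \<in> PGL2" "g = inv s \<circ> f \<circ> s" "t \<in> PGL2" "h = inv t \<circ> g \<circ> t"
      "f \<in> Hom_deg n" "h \<in> Hom_deg n" by (auto simp: conj_rel_def)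
    have "inv (s \<circ> t) = inv t \<circ> inv s" using o_inv_distrib bij_PGL2 * by blast
    hence "h = inv (s \<circ> t) \<circ> f \<circ> (s \<circ> t)" using * by (simp add: o_assoc)
    thus "(f, h) \<in> conj_rel n" using * PGL2_comp by (auto simp: conj_rel_def)
  qed
qed

text \<open>Equal values at all finite points give \<open>p * q' = p' * q\<close>. Bezout then
  exhibits \<open>(p', q')\<close> as a multiple of \<open>(p, q)\<close>, and coprimality of
  \<open>p'\<close>, \<open>q'\<close> makes the factor a constant.\<close>

lemma lowest_terms_ratmap:
  fixes p q :: "'a::{alg_closed_field, field_char_0} poly"
  assumes "coprime p q"
  obtains c where "c \<noteq> 0" "lowest_terms (ratmap p q) = (smult c p, smult c q)"
proof -
  obtain p' q' where lt: "lowest_terms (ratmap p q) = (p', q')" by fastforce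
  have "case (p', q') of (p', q') \<Rightarrow> coprime p' q' \<and> ratmap p q = ratmap p' q'"
    unfolding lt[symmetric] lowest_terms_def by (rule someI[of _ "(p, q)"]) (use assms in simp)
  hence pq': "coprime p' q'" "ratmap p q = ratmap p' q'" by auto
  have "poly (p * q') x = poly (p' * q) x" for x
  proof -
    have "pt (poly p x) (poly q x) = pt (poly p' x) (poly q' x)"
      using pq'(2) by (metis ratmap_Fin)
    thus ?thesis using assms pq'(1)
      by (subst (asm) pt_eq_iff) (auto simp: nz_def coprime_iff_no_common_root)
  qed
  hence cross: "p * q' = p' * q" by (simp only: poly_eq_poly_eq_iff[symmetric] fun_eq_iff) simp
  obtain a b where ab: "a * p + b * q = 1" using coprime_bezout[OF assms] by blast
  define r where "r = a * p' + b * q'"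
  have "p * r = a * p * p' + b * (p * q')" by (simp add: r_def algebra_simps)
  also have "\<dots> = (a * p + b * q) * p'" unfolding cross by (simp add: algebra_simps)
  finally have p': "p' = p * r" using ab by simp
  have "q * r = a * (p' * q) + b * q * q'" by (simp add: r_def algebra_simps)
  also have "\<dots> = (a * p + b * q) * q'" unfolding cross[symmetric] by (simp add: algebra_simps)
  finally have q': "q' = q * r" using ab by simp
  have "is_unit r" using pq'(1) p' q' coprime_common_divisor[of p' q' r] by simp
  then obtain c where "r = [:c:]" "c dvd 1" by (elim is_unit_polyE)
  moreover from this have "c \<noteq> 0" by auto
  ultimately show ?thesis using that[of c] lt p' q' by simp
qed

lemma
  fixes p q :: "'a::{alg_closed_field, field_char_0} poly"
  assumes "coprime p q"
  shows deriv_fin_ratmap: "deriv_fin (ratmap p q) z =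
      (poly (pderiv p) z * poly q z - poly p z * poly (pderiv q) z) / (poly q z)\<^sup>2"
    and fix_mult_fin_ratmap: "fix_mult_fin (ratmap p q) z = order z (p - [:0, 1:] * q)"
    and ram_index_fin_ratmap: "ram_index_fin (ratmap p q) z =
      (case ratmap p q (Fin z) of Fin w \<Rightarrow> order z (p - smult w q) | Infty \<Rightarrow> order z q)"
proof -
  obtain c where c: "c \<noteq> 0" "lowest_terms (ratmap p q) = (smult c p, smult c q)"
    using lowest_terms_ratmap[OF assms] .
  show "deriv_fin (ratmap p q) z =
      (poly (pderiv p) z * poly q z - poly p z * poly (pderiv q) z) / (poly q z)\<^sup>2"
  proof -
    have "deriv_fin (ratmap p q) z =
        (c\<^sup>2 * (poly (pderiv p) z * poly q z - poly p z * poly (pderiv q) z)) / (c\<^sup>2 * (poly q z)\<^sup>2)"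
      by (simp add: deriv_fin_def c(2) pderiv_smult power2_eq_square algebra_simps)
    thus ?thesis using c(1) by simp
  qed
  have "smult c p - [:0, 1:] * smult c q = smult c (p - [:0, 1:] * q)"
    "smult c p - smult w (smult c q) = smult c (p - smult w q)" for w
    by (simp_all add: smult_diff_right mult.commute)
  thus "fix_mult_fin (ratmap p q) z = order z (p - [:0, 1:] * q)"
    "ram_index_fin (ratmap p q) z =
      (case ratmap p q (Fin z) of Fin w \<Rightarrow> order z (p - smult w q) | Infty \<Rightarrow> order z q)"
    using c(1) by (simp_all add: fix_mult_fin_def ram_index_fin_def c(2) order_smult split: P1.split
        del: ratmap.simps)
qed

section \<open>Multiplier spectra of conjugates of polynomials\<close>

lemma hev_mult:
  assumes "degree p \<le> m" "degree q \<le> n"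
  shows "hev (m + n) (p * q) u v = hev m p u v * hev n q u v"
proof (cases "v = 0")
  case True
  thus ?thesis using coeff_mult_bound[OF assms] by (simp add: hev_infty power_add)
next
  case False
  have "degree (p * q) \<le> m + n" using degree_mult_le[of p q] assms by linarith
  thus ?thesis using False assms by (simp add: hev_finite power_add)
qed

lemma hpoly_mult:
  fixes p q :: "'a::field_char_0 poly"
  assumes "degree p \<le> m" "degree q \<le> n"
  shows "hpoly (m + n) (p * q) u v = hpoly m p u v * hpoly n q u v"
  by (simp only: poly_eq_poly_eq_iff[symmetric] fun_eq_iff poly_hpoly poly_mult hev_mult[OF assms])
    simp

lemma hpoly_linear_power:
  fixes u v :: "'a::field_char_0 poly"
  shows "hpoly m ([:- y, 1:] ^ m) u v = (u - smult y v) ^ m"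
proof (induction m)
  case 0
  show ?case by (simp add: hpoly_def one_pCons)
next
  case (Suc m)
  have "hpoly 1 [:- y, 1:] u v = u - smult y v" by (simp add: hpoly_def)
  thus ?case
    using hpoly_mult[of "[:- y, 1:]" 1 "[:- y, 1:] ^ m" m u v] Suc
    by (simp add: degree_linear_power)
qed

lemma hpoly_one: "hpoly d 1 u v = v ^ d"
proof -
  have "hpoly d 1 u v = (\<Sum>i\<le>d. if i = 0 then v ^ d else 0)"
    unfolding hpoly_def by (intro sum.cong) (auto simp: one_pCons coeff_pCons split: nat.split)
  thus ?thesis by simp
qed

lemma hpoly_diff: "hpoly d (p - q) u v = hpoly d p u v - hpoly d q u v"
  by (simp add: hpoly_def sum_subtractf smult_diff_left)

lemma order_linear: "a \<noteq> 0 \<Longrightarrow> a * x + b = 0 \<Longrightarrow> order x [:b, a:] = 1"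
  for a b x :: "'a::field"
proof -
  assume *: "a \<noteq> 0" "a * x + b = 0"
  hence "[:b, a:] = smult a [:- x, 1:]" by (simp add: add_eq_0_iff)
  thus ?thesis using * order_power_n_n[of x 1] by (simp add: order_smult del: smult_pCons)
qed

text \<open>For \<open>g = P / Q\<close> the fixed point form is \<open>P - z Q = v J\<close>, where
  \<open>J\<close> is the pullback of \<open>F(z) - z\<close>. A zero of \<open>v\<close> is the
  preimage of infinity and is simple; a zero of \<open>J\<close> is the preimage of a root
  \<open>y\<close> of \<open>F(z) - z\<close> and has the same order.\<close>

lemma conj_polynomial:
  fixes F :: "'a::{alg_closed_field, field_char_0} poly"
  assumes N: "degree F = N" "N \<ge> 2" and det: "a * d - b * c \<noteq> 0"
  defines "g \<equiv> inv (mob a b c d) \<circ> ratmap F 1 \<circ> mob a b c d"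
  shows fix_mult_fin_conj: "fix_mult_fin g x =
      (case mob a b c d (Fin x) of Fin y \<Rightarrow> order y (F - [:0, 1:]) | Infty \<Rightarrow> 1)"
    and deriv_fin_conj: "ratmap F 1 (mob a b c d (Fin x)) = mob a b c d (Fin x) \<Longrightarrow> deriv_fin g x =
      (case mob a b c d (Fin x) of Fin y \<Rightarrow> poly (pderiv F) y | Infty \<Rightarrow> 0)"
proof -
  define u v where uv: "u = [:b, a:]" "v = [:d, c:]"
  define H where "H = hpoly N F u v"
  define P Q where PQ: "P = smult d H + smult (- b) (v ^ N)" "Q = smult (- c) H + smult a (v ^ N)"
  define K where "K = F - [:0, 1:]"
  have det': "d * a - (- b) * (- c) \<noteq> 0" using det by (simp add: algebra_simps)
  have maxd: "max (degree F) (degree (1 :: 'a poly)) = N" using N by simp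
  note comp1 = ratmap_comp_mob[OF coprime_1_right maxd det]
  note comp2 = mob_comp_ratmap[OF comp1(2,3) det']
  have cop: "coprime P Q"
    using comp2(2) unfolding PQ H_def uv hpoly_one by simp
  have g: "g = ratmap P Q"
    unfolding g_def inv_mob[OF det] o_assoc[symmetric] comp1(1) comp2(1)
    unfolding PQ H_def uv hpoly_one by simp
  have K0: "degree K = N" "K \<noteq> 0"
  proof -
    have "degree (F + - [:0, 1:]) = degree F" using N by (intro degree_add_eq_left) simp
    thus "degree K = N" by (simp only: K_def diff_conv_add_uminus N)
    thus "K \<noteq> 0" using N by auto
  qed
  define J where "J = hpoly N K u v"
  have "hpoly (1 + (N - 1)) ([:0, 1:] * 1) u v = hpoly 1 [:0, 1:] u v * hpoly (N - 1) 1 u v"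
    by (rule hpoly_mult) auto
  hence "hpoly N [:0, 1:] u v = u * v ^ (N - 1)"
    using N by (simp add: hpoly_one) (simp add: hpoly_def)
  hence J: "J = H - u * v ^ (N - 1)" by (simp add: J_def K_def H_def hpoly_diff)
  have vN: "v ^ N = v * v ^ (N - 1)" using N by (metis power_minus_mult mult.commute not_numeral_le_zero not_gr_zero)
  have R: "P - [:0, 1:] * Q = v * J"
  proof -
    have "v * w = smult d w + [:0, 1:] * smult c w" "u * w = smult b w + [:0, 1:] * smult a w" for w
      by (simp_all add: uv)
    hence "P - [:0, 1:] * Q = v * H - u * v ^ N"
      unfolding PQ by (simp add: ring_distribs)
    thus ?thesis unfolding J vN by (simp only: right_diff_distrib ac_simps)
  qed
  have mobx: "mob a b c d (Fin x) = pt (poly u x) (poly v x)"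
    using mob_pt[OF det, of x 1] by (simp add: Fin_eq_pt nz_def uv algebra_simps)
  have nzuv: "nz (poly u x) (poly v x)"
    using nz_mob[OF det, of x 1] by (simp add: nz_def uv algebra_simps)
  \<comment> \<open>Differentiate \<open>P = z Q + v J\<close> at a zero of \<open>v J\<close> and
    divide by \<open>Q\<close>.\<close>
  have derivR: "deriv_fin g x = 1 + poly (pderiv (v * J)) x / poly Q x"
    if "poly (v * J) x = 0" "poly Q x \<noteq> 0"
  proof -
    have P: "P = [:0, 1:] * Q + v * J" using R by (simp add: algebra_simps)
    have "pderiv [:0, 1 :: 'a:] = 1" by (simp add: pderiv_pCons)
    hence "pderiv P = [:0, 1:] * pderiv Q + Q + pderiv (v * J)"
      unfolding P pderiv_add by (subst pderiv_mult) simp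
    hence "poly (pderiv P) x = x * poly (pderiv Q) x + poly Q x + poly (pderiv (v * J)) x" by simp
    moreover have "poly P x = x * poly Q x" using P that(1) by simp
    ultimately show ?thesis using that(2)
      unfolding g deriv_fin_ratmap[OF cop] by (simp add: field_simps power2_eq_square)
  qed
  have "fix_mult_fin g x =
        (case mob a b c d (Fin x) of Fin y \<Rightarrow> order y (F - [:0, 1:]) | Infty \<Rightarrow> 1) \<and>
      (ratmap F 1 (mob a b c d (Fin x)) = mob a b c d (Fin x) \<longrightarrow> deriv_fin g x =
        (case mob a b c d (Fin x) of Fin y \<Rightarrow> poly (pderiv F) y | Infty \<Rightarrow> 0))"
  proof (cases "poly v x = 0")
    case True
    have c0: "c \<noteq> 0" using True det nzuv by (auto simp: uv nz_def)
    have u0: "poly u x \<noteq> 0" using True nzuv by (auto simp: nz_def)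
    have Hx: "poly H x \<noteq> 0"
      using u0 True N by (auto simp: H_def poly_hpoly hev_infty)
    have Jx: "poly J x = poly H x" using True N by (simp add: J power_0_left)
    hence ord: "order x (v * J) = 1"
    proof -
      have "v \<noteq> 0" "J \<noteq> 0" using c0 Hx Jx by (auto simp: uv)
      moreover have "order x v = 1" unfolding uv using c0 True by (intro order_linear) (auto simp: uv algebra_simps)
      moreover have "order x J = 0" using Hx Jx by (intro order_0I) simp
      ultimately show ?thesis by (subst order_mult) auto
    qed
    have "poly (pderiv (v * J)) x = c * poly H x"
      using True Jx by (simp add: pderiv_mult) (simp add: uv pderiv_pCons)
    moreover have "poly Q x = - c * poly H x" using True N by (simp add: PQ power_0_left)
    ultimately have "deriv_fin g x = 0"
      using derivR True Hx c0 by simp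
    moreover have "mob a b c d (Fin x) = Infty" using mobx True by (simp add: pt_def)
    ultimately show ?thesis using ord unfolding g fix_mult_fin_ratmap[OF cop] R by simp
  next
    case False
    define y where "y = poly u x / poly v x"
    have moby: "mob a b c d (Fin x) = Fin y" using mobx False by (simp add: pt_def y_def)
    define e where "e = a - y * c"
    have e0: "e \<noteq> 0"
    proof
      assume "e = 0"
      hence "poly v x * e = 0" by simp
      moreover have "poly v x * e = a * d - b * c"
        using False by (simp add: e_def y_def uv field_simps)
      ultimately show False using det by simp
    qed
    \<comment> \<open>\<open>l\<close> is the pullback of \<open>z - y\<close>. It has a simple zero
      at \<open>x\<close>, since its slope \<open>e\<close> satisfies
      \<open>v(x) e = a d - b c\<close>.\<close>
    define l where "l = u - smult y v"
    have l: "l = [:b - y * d, e:]" by (simp add: l_def uv e_def)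
    have lx: "poly l x = 0" using False by (simp add: l_def y_def)
    define m where "m = order y K"
    obtain K' where K': "K = [:- y, 1:] ^ m * K'" "\<not> [:- y, 1:] dvd K'"
      using order_decomp[OF K0(2)] unfolding m_def by blast
    have K'0: "K' \<noteq> 0" using K0(2) K'(1) by auto
    have degK': "m + degree K' = N"
      using K0(1) K'0 unfolding K'(1) by (simp add: degree_mult_eq degree_linear_power)
    define n' where "n' = N - m"
    have n': "degree K' \<le> n'" "N = m + n'" using degK' by (auto simp: n'_def)
    have JK: "J = l ^ m * hpoly n' K' u v"
      unfolding J_def K'(1) n'(2) l_def hpoly_linear_power[symmetric]
      by (rule hpoly_mult) (auto simp: degree_linear_power n')
    have "poly (hpoly n' K' u v) x \<noteq> 0"
      using K'(2) False n' by (simp add: poly_hpoly hev_finite y_def poly_eq_0_iff_dvd)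
    moreover from this have "hpoly n' K' u v \<noteq> 0" by auto
    moreover have "order x l = 1" unfolding l using e0 lx
      by (intro order_linear) (auto simp: l algebra_simps)
    moreover have "order x (l ^ m) = m * order x l"
    proof -
      have "l \<noteq> 0" using l e0 by auto
      thus ?thesis by (induction m) (simp_all add: order_mult)
    qed
    moreover have "order x v = 0" using False by (rule order_0I)
    moreover have "v \<noteq> 0" "l \<noteq> 0" using False l e0 by auto
    ultimately have ord: "order x (v * J) = m"
    proof -
      assume *: "poly (hpoly n' K' u v) x \<noteq> 0" "hpoly n' K' u v \<noteq> 0" "order x l = 1"
        "order x (l ^ m) = m * order x l" "order x v = 0" "v \<noteq> 0" "l \<noteq> 0"
      hence "order x (l ^ m * hpoly n' K' u v) = m"
        by (subst order_mult) (auto simp: order_0I)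
      thus ?thesis unfolding JK using * by (subst order_mult) auto
    qed
    have deriv: "deriv_fin g x = poly (pderiv F) y" if fp: "poly F y = y"
    proof -
      have "poly K y = 0" using fp by (simp add: K_def)
      then obtain L where L: "K = [:- y, 1:] * L" using poly_eq_0_iff_dvd by blast
      have "L \<noteq> 0" using L K0(2) by auto
      hence dL: "degree L \<le> N - 1" "1 + (N - 1) = N"
        using K0(1) N unfolding L by (auto simp: degree_mult_eq simp del: mult_pCons_left)
      have JL: "J = l * hpoly (N - 1) L u v"
        unfolding J_def using hpoly_mult[of "[:- y, 1:]" 1 L "N - 1" u v] dL
          hpoly_linear_power[of 1 y u v] by (simp add: L l_def)
      have "poly (pderiv K) y = poly L y"
        unfolding L by (simp add: pderiv_mult pderiv_pCons del: mult_pCons_left)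
      hence Ly: "poly L y = poly (pderiv F) y - 1"
        by (simp add: K_def pderiv_diff pderiv_pCons)
      have "pderiv l = [:e:]" by (simp add: l pderiv_pCons)
      hence "poly (pderiv J) x = e * poly (hpoly (N - 1) L u v) x"
        unfolding JL pderiv_mult using lx by simp
      hence pJ: "poly (pderiv J) x = e * (poly v x ^ (N - 1) * (poly (pderiv F) y - 1))"
        using dL False Ly by (simp add: poly_hpoly hev_finite y_def)
      have Jx: "poly J x = 0" using lx by (simp add: JL)
      have "poly H x = poly v x ^ N * y"
        using fp False N by (simp add: H_def poly_hpoly hev_finite y_def)
      hence Qx: "poly Q x = poly v x ^ N * e" by (simp add: PQ e_def algebra_simps)
      have "poly v x ^ N = poly v x * poly v x ^ (N - 1)" using vN by (metis poly_mult poly_power)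
      hence "poly (pderiv (v * J)) x / poly Q x = poly (pderiv F) y - 1"
        using False e0 Jx unfolding Qx by (simp add: pderiv_mult pJ)
      thus ?thesis using derivR Jx Qx e0 False by simp
    qed
    show ?thesis using ord deriv unfolding moby
      unfolding g fix_mult_fin_ratmap[OF cop] R by (simp add: m_def K_def)
  qed
  thus "fix_mult_fin g x =
      (case mob a b c d (Fin x) of Fin y \<Rightarrow> order y (F - [:0, 1:]) | Infty \<Rightarrow> 1)"
    "ratmap F 1 (mob a b c d (Fin x)) = mob a b c d (Fin x) \<Longrightarrow> deriv_fin g x =
      (case mob a b c d (Fin x) of Fin y \<Rightarrow> poly (pderiv F) y | Infty \<Rightarrow> 0)" by blast+
qed

text \<open>Local data at \<open>Infty\<close> are read off at \<open>0\<close> after conjugation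
  with \<open>flip\<close>, which is itself a Moebius transformation. The case of
  \<open>Infty\<close> is thus the finite case for \<open>s \<circ> flip\<close>.\<close>

lemma
  fixes F :: "'a::{alg_closed_field, field_char_0} poly"
  assumes N: "degree F \<ge> 2" and s: "s \<in> PGL2"
  shows fix_mult_conj: "fix_mult (inv s \<circ> ratmap F 1 \<circ> s) P =
      (case s P of Fin y \<Rightarrow> order y (F - [:0, 1:]) | Infty \<Rightarrow> 1)" (is ?A)
    and fix_multiplier_conj: "ratmap F 1 (s P) = s P \<Longrightarrow>
      fix_multiplier (inv s \<circ> ratmap F 1 \<circ> s) P =
      (case s P of Fin y \<Rightarrow> poly (pderiv F) y | Infty \<Rightarrow> 0)" (is "_ \<Longrightarrow> ?B")
proof -
  have fin: "fix_mult_fin (inv t \<circ> ratmap F 1 \<circ> t) x =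
      (case t (Fin x) of Fin y \<Rightarrow> order y (F - [:0, 1:]) | Infty \<Rightarrow> 1)"
    "ratmap F 1 (t (Fin x)) = t (Fin x) \<Longrightarrow> deriv_fin (inv t \<circ> ratmap F 1 \<circ> t) x =
      (case t (Fin x) of Fin y \<Rightarrow> poly (pderiv F) y | Infty \<Rightarrow> 0)" if "t \<in> PGL2" for t x
    using that fix_mult_fin_conj[OF refl N] deriv_fin_conj[OF refl N] unfolding PGL2_eq by auto
  have flip: "flip \<circ> (inv s \<circ> ratmap F 1 \<circ> s) \<circ> flip = inv (s \<circ> flip) \<circ> ratmap F 1 \<circ> (s \<circ> flip)"
    using o_inv_distrib[OF bij_PGL2[OF s] bij_PGL2[OF flip_PGL2]] by (simp add: inv_flip o_assoc)
  have sf: "s \<circ> flip \<in> PGL2" "(s \<circ> flip) (Fin 0) = s Infty"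
    using PGL2_comp[OF s flip_PGL2] by simp_all
  show ?A
    using fin(1)[OF s] fin(1)[OF sf(1), of 0] sf(2)
    by (cases P) (simp_all only: fix_mult_def P1.case flip)
  assume "ratmap F 1 (s P) = s P"
  thus ?B
    using fin(2)[OF s] fin(2)[OF sf(1), of 0] sf(2)
    by (cases P) (simp_all only: fix_multiplier_def P1.case flip)
qed

definition spec :: "'a::alg_closed_field poly \<Rightarrow> 'a multiset" where
  "spec F = add_mset 0 (image_mset (poly (pderiv F)) (proots (F - [:0, 1:])))"

lemma image_mset_eq_sum:
  fixes f :: "'b \<Rightarrow> 'c"
  shows "image_mset f M = (\<Sum>x\<in>set_mset M. replicate_mset (count M x) (f x))"
proof -
  have M: "M = (\<Sum>x\<in>set_mset M. replicate_mset (count M x) x)"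
  proof (rule multiset_eqI)
    fix a
    have "count (\<Sum>x\<in>set_mset M. replicate_mset (count M x) x) a =
        (\<Sum>x\<in>set_mset M. if x = a then count M a else 0)"
      by (simp add: count_sum if_distrib cong: if_cong)
    also have "\<dots> = count M a" by (simp add: not_in_iff)
    finally show "count M a = count (\<Sum>x\<in>set_mset M. replicate_mset (count M x) x) a" ..
  qed
  have "image_mset f (\<Sum>x\<in>A. h x) = (\<Sum>x\<in>A. image_mset f (h x))" for A and h :: "'b \<Rightarrow> 'b multiset"
    by (induction A rule: infinite_finite_induct) auto
  from this[of "\<lambda>x. replicate_mset (count M x) x" "set_mset M"] show ?thesis
    using M by simp
qed

lemma funpow_conj: "bij s \<Longrightarrow> (inv s \<circ> f \<circ> s) ^^ n = inv s \<circ> (f ^^ n) \<circ> s"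
proof (induction n)
  case 0
  thus ?case by (simp add: bij_is_inj)
next
  case (Suc n)
  have "s \<circ> inv s = id" using bij_is_surj[OF Suc.prems] by (simp only: surj_iff)
  have "(inv s \<circ> f \<circ> s) ^^ Suc n = inv s \<circ> f \<circ> (s \<circ> inv s) \<circ> (f ^^ n) \<circ> s"
    unfolding funpow.simps Suc.IH[OF Suc.prems] by (simp only: o_assoc)
  thus ?case by (simp only: \<open>s \<circ> inv s = id\<close> o_id funpow.simps o_assoc)
qed

lemma multiplier_spectrum_conj:
  fixes G :: "'a::{alg_closed_field, field_char_0} poly"
  assumes f: "f ^^ n = ratmap G 1" and deg: "degree G \<ge> 2" and s: "s \<in> PGL2"
  shows "multiplier_spectrum n (inv s \<circ> f \<circ> s) = spec G"
proof -
  define h where "h = inv s \<circ> ratmap G 1 \<circ> s"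
  have b: "bij s" using bij_PGL2 s by blast
  have h: "(inv s \<circ> f \<circ> s) ^^ n = h" using funpow_conj[OF b] f by (simp add: h_def)
  define \<phi> where "\<phi> = (\<lambda>R. case R of
    Fin y \<Rightarrow> replicate_mset (order y (G - [:0, 1:])) (poly (pderiv G) y) | Infty \<Rightarrow> {#0#})"
  have fixed: "h P = P \<longleftrightarrow> ratmap G 1 (s P) = s P" for P
    using b unfolding h_def o_apply by (metis bij_inv_eq_iff)
  define R where "R = {y. poly (G - [:0, 1:]) y = 0}"
  have G0: "G - [:0, 1:] \<noteq> 0"
  proof
    assume "G - [:0, 1:] = 0"
    hence "G = [:0, 1:]" by simp
    thus False using deg by simp
  qed
  have Fix: "{Q. ratmap G 1 Q = Q} = insert Infty (Fin ` R)"
  proof -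
    have "ratmap G 1 Q = Q \<longleftrightarrow> Q \<in> insert Infty (Fin ` R)" for Q
      using deg by (cases Q) (auto simp: R_def Let_def image_iff one_pCons coeff_pCons split: nat.split)
    thus ?thesis by blast
  qed
  have "multiplier_spectrum n (inv s \<circ> f \<circ> s) = (\<Sum>P\<in>{P. h P = P}. \<phi> (s P))"
    unfolding multiplier_spectrum_def Per_def multiplier_def h
  proof (intro sum.cong refl)
    fix P assume "P \<in> {P. h P = P}"
    hence "ratmap G 1 (s P) = s P" using fixed by simp
    thus "replicate_mset (fix_mult h P) (fix_multiplier h P) = \<phi> (s P)"
      unfolding h_def \<phi>_def
      by (simp add: fix_mult_conj[OF deg s] fix_multiplier_conj[OF deg s] split: P1.split)
  qed
  also have "\<dots> = (\<Sum>Q\<in>{Q. ratmap G 1 Q = Q}. \<phi> Q)"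
  proof (rule sum.reindex_bij_betw)
    have "s ` {P. h P = P} = {Q. ratmap G 1 Q = Q}"
      unfolding fixed using b by (auto simp: image_iff) (metis bij_pointE)
    thus "bij_betw s {P. h P = P} {Q. ratmap G 1 Q = Q}"
      unfolding bij_betw_def using inj_on_subset[OF bij_is_inj[OF b] subset_UNIV] by blast
  qed
  also have "\<dots> = {#0#} + (\<Sum>y\<in>R. replicate_mset (order y (G - [:0, 1:])) (poly (pderiv G) y))"
  proof -
    have "finite R" unfolding R_def using G0 by (rule poly_roots_finite)
    thus ?thesis unfolding Fix
      by (subst sum.insert) (auto simp: \<phi>_def sum.reindex inj_on_def)
  qed
  also have "\<dots> = spec G"
    unfolding spec_def image_mset_eq_sum using G0 by (simp add: R_def)
  finally show ?thesis .
qed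

section \<open>Normal forms\<close>

abbreviation pmap :: "'a::field poly \<Rightarrow> 'a P1 \<Rightarrow> 'a P1" where
  "pmap F \<equiv> ratmap F 1"

definition monic_centered :: "nat \<Rightarrow> 'a::field poly \<Rightarrow> bool" where
  "monic_centered k F \<longleftrightarrow> degree F = k \<and> lead_coeff F = 1 \<and> coeff F (k - 1) = 0"

definition pclass :: "nat \<Rightarrow> 'a::field poly \<Rightarrow> ('a P1 \<Rightarrow> 'a P1) set" where
  "pclass k F = conj_rel k `` {pmap F}"

lemma pmap_Hom_deg: "degree F = k \<Longrightarrow> pmap F \<in> Hom_deg k"
  unfolding Hom_deg_def by (intro CollectI exI[of _ F] exI[of _ 1]) auto

lemma pmap_Infty: "degree F > 0 \<Longrightarrow> pmap F Infty = Infty"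
  by (simp add: Let_def)

lemma pmap_comp: "degree F > 0 \<Longrightarrow> degree G > 0 \<Longrightarrow> pmap F \<circ> pmap G = pmap (F \<circ>\<^sub>p G)"
proof
  fix P :: "'a P1" assume *: "degree F > 0" "degree G > 0"
  hence "degree (F \<circ>\<^sub>p G) > 0" by (simp add: degree_pcompose)
  with * show "(pmap F \<circ> pmap G) P = pmap (F \<circ>\<^sub>p G) P"
    by (cases P) (simp_all add: pmap_Infty poly_pcompose del: ratmap.simps(2))
qed

lemma pclass_nonempty:
  fixes F :: "'a::alg_closed_field poly"
  shows "degree F = k \<Longrightarrow> pmap F \<in> pclass k F"
  unfolding pclass_def using equiv_class_self[OF equiv_conj_rel pmap_Hom_deg] by blast

lemma pclass_eqI:
  fixes F F' :: "'a::alg_closed_field poly"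
  assumes "degree F = k" "degree F' = k" "s \<in> PGL2" "pmap F' = inv s \<circ> pmap F \<circ> s"
  shows "pclass k F = pclass k F'"
  unfolding pclass_def
proof (rule equiv_class_eq[OF equiv_conj_rel])
  show "(pmap F, pmap F') \<in> conj_rel k"
    unfolding conj_rel_def using assms pmap_Hom_deg[OF assms(1)] pmap_Hom_deg[OF assms(2)] by blast
qed

definition sigma_poly :: "nat \<Rightarrow> 'a::alg_closed_field poly \<Rightarrow> 'a list" where
  "sigma_poly k F = map (\<lambda>i. elem_sym i (spec F)) [1..<k ^ 1 + 2] @
    map (\<lambda>i. elem_sym i (spec (F \<circ>\<^sub>p F))) [1..<k ^ 2 + 2]"

lemma tau2_pclass:
  fixes F :: "'a::{alg_closed_field, field_char_0} poly"
  assumes k: "degree F = k" "k \<ge> 2"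
  shows "tau2 k (pclass k F) = sigma_poly k F"
proof -
  have "sigma_vec k 1 f @ sigma_vec k 2 f = sigma_poly k F" if "f \<in> pclass k F" for f
  proof -
    obtain s where s: "s \<in> PGL2" "f = inv s \<circ> pmap F \<circ> s"
      using \<open>f \<in> pclass k F\<close> by (auto simp: pclass_def conj_rel_def)
    have 1: "pmap F ^^ 1 = pmap F" by simp
    have 2: "pmap F ^^ 2 = pmap (F \<circ>\<^sub>p F)" using k by (simp add: numeral_2_eq_2 pmap_comp)
    have "k * 1 \<le> k * k" using k by (intro mult_le_mono) auto
    hence "2 \<le> k * k" using k by linarith
    hence "degree (F \<circ>\<^sub>p F) \<ge> 2" using k by (simp add: degree_pcompose)
    from multiplier_spectrum_conj[OF 1 _ s(1)] multiplier_spectrum_conj[OF 2 this s(1)] k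
    show ?thesis unfolding s(2) sigma_vec_def sigma_def sigma_poly_def by simp
  qed
  moreover have "pclass k F \<noteq> {}" using pclass_nonempty[OF k(1)] by blast
  ultimately have "(\<lambda>f. sigma_vec k 1 f @ sigma_vec k 2 f) ` pclass k F = {sigma_poly k F}" by auto
  thus ?thesis unfolding tau2_def by simp
qed

lemma affine_conj:
  fixes F F' :: "'a::field poly"
  assumes "t \<noteq> 0" "degree F > 0" "degree F' > 0"
    and "\<And>z. t * poly F' z = poly F (t * z + e) - e"
  shows "pmap F' = inv (mob t e 0 1) \<circ> pmap F \<circ> mob t e 0 1" "mob t e 0 1 \<in> PGL2"
proof -
  show "mob t e 0 1 \<in> PGL2" unfolding PGL2_eq using assms(1) by force
  have det: "t * 1 - e * 0 \<noteq> 0" "1 * t - (- e) * 0 \<noteq> 0" using assms(1) by auto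
  have nz: "nz x 1" "nz 1 0" for x :: 'a by (auto simp: nz_def)
  show "pmap F' = inv (mob t e 0 1) \<circ> pmap F \<circ> mob t e 0 1"
  proof
    fix P
    have eq: "poly F' z = (poly F (t * z + e) - e) / t" for z
      using assms(4)[of z] assms(1) by (simp add: field_simps)
    have inv: "inv (mob t e 0 1) = mob 1 (- e) 0 t" using inv_mob[OF det(1)] by simp
    have F: "pmap F (pt x 1) = pt (poly F x) 1" for x by (simp add: pt_def)
    show "pmap F' P = (inv (mob t e 0 1) \<circ> pmap F \<circ> mob t e 0 1) P"
    proof (cases P)
      case (Fin z)
      thus ?thesis using mob_pt[OF det(1) nz(1)[of z]] mob_pt[OF det(2) nz(1)]
        by (simp add: inv F Fin_eq_pt del: ratmap.simps) (simp add: pt_def eq assms(1))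
    next
      case Infty
      have "mob t e 0 1 Infty = Infty" "mob 1 (- e) 0 t Infty = Infty"
        using mob_pt[OF det(1) nz(2)] mob_pt[OF det(2) nz(2)] by (simp_all add: pt_def)
      thus ?thesis using Infty assms by (simp add: inv pmap_Infty del: ratmap.simps(2))
    qed
  qed
qed

text \<open>Conjugation by \<open>z \<mapsto> w z\<close>. If both polynomials are monic, the
  condition for \<open>i = k\<close> says that \<open>w\<close> is a root of unity of order dividing
  \<open>k - 1\<close>.\<close>

lemma pclass_scale:
  fixes F F' :: "'a::alg_closed_field poly"
  assumes "degree F = k" "degree F' = k" "k > 0" "w \<noteq> 0"
    and "\<And>i. i \<le> k \<Longrightarrow> w * coeff F' i = w ^ i * coeff F i"
  shows "pclass k F = pclass k F'"
proof -
  have "w * poly F' z = poly F (w * z + 0) - 0" for z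
    using assms(5) by (simp add: poly_altdef assms(1,2) sum_distrib_left power_mult_distrib ac_simps)
      (intro sum.cong refl, metis atMost_iff mult.assoc mult.left_commute)
  from affine_conj[of w F F' 0, OF assms(4) _ _ this] show ?thesis
    using assms(1-3) by (intro pclass_eqI) auto
qed

lemma exists_monic_centered:
  fixes F :: "'a::{alg_closed_field, field_char_0} poly"
  assumes k: "degree F = k" "k \<ge> 2"
  shows "\<exists>F'. monic_centered k F' \<and> pclass k F = pclass k F'"
proof -
  define \<alpha> \<beta> where ab: "\<alpha> = coeff F k" "\<beta> = coeff F (k - 1)"
  have a0: "\<alpha> \<noteq> 0" unfolding ab k(1)[symmetric] using k by auto
  \<comment> \<open>Conjugation by \<open>z \<mapsto> t z + e\<close> turns the leading coefficient
    into \<open>\<alpha> * t ^ (k - 1)\<close>.\<close>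
  obtain t where t: "t ^ (k - 1) = 1 / \<alpha>" using nth_root_exists[of "k - 1" "1 / \<alpha>"] k by auto
  have t0: "t \<noteq> 0" using t a0 k by (auto simp: power_0_left split: if_splits)
  \<comment> \<open>The solution of \<open>of_nat k * \<alpha> * e + \<beta> = 0\<close>, which
    makes the next coefficient vanish.\<close>
  define e where "e = - \<beta> / (of_nat k * \<alpha>)"
  define C where "C = F \<circ>\<^sub>p [:e, t:]"
  define F' where "F' = smult (1 / t) (C - [:e:])"
  have k': "k = Suc (k - 1)" using k by simp
  have C: "C = (\<Sum>i\<le>k. smult (coeff F i) ([:e, t:] ^ i))"
    by (simp add: C_def pcompose_altdef poly_altdef degree_map_poly coeff_map_poly k)
  have deg0: "coeff ([:e, t:] ^ i) j = 0" if "i < j" for i j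
  proof -
    have "degree [:e, t:] \<le> 1" by simp
    from coeff_power_bound(1)[OF this, of i] that show ?thesis by (intro coeff_eq_0) linarith
  qed
  have Ck: "coeff C k = \<alpha> * t ^ k"
  proof -
    have "coeff C k = (\<Sum>i\<le>k. if i = k then \<alpha> * t ^ k else 0)"
      unfolding C coeff_sum
      by (intro sum.cong) (auto simp: deg0 ab coeff_linear_poly_power)
    thus ?thesis by simp
  qed
  have Ck1: "coeff C (k - 1) = \<alpha> * of_nat k * t ^ (k - 1) * e + \<beta> * t ^ (k - 1)"
  proof -
    have bin: "k choose (k - 1) = k" using k by (subst binomial_symmetric) auto
    have "coeff C (k - 1) = (\<Sum>i\<le>k. (if i = k then \<alpha> * of_nat k * t ^ (k - 1) * e else 0) +
        (if i = k - 1 then \<beta> * t ^ (k - 1) else 0))"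
      unfolding C coeff_sum
    proof (intro sum.cong refl)
      fix i assume "i \<in> {..k}"
      hence "i \<le> k" by simp
      hence "i = k \<or> i = k - 1 \<or> i < k - 1" by arith
      then consider "i = k" | "i = k - 1" | "i < k - 1" by blast
      thus "coeff (smult (coeff F i) ([:e, t:] ^ i)) (k - 1) =
          (if i = k then \<alpha> * of_nat k * t ^ (k - 1) * e else 0) + (if i = k - 1 then \<beta> * t ^ (k - 1) else 0)"
        using k(2) by cases (auto simp: coeff_linear_poly_power ab deg0 bin[unfolded One_nat_def])
    qed
    thus ?thesis by (simp add: sum.distrib)
  qed
  have tk: "t ^ k = t * (1 / \<alpha>)" using t k' by (metis power_Suc)
  have degC: "degree C = k" unfolding C_def using t0 k by (simp add: degree_pcompose)
  have ne: "coeff [:e:] k = 0" "coeff [:e:] (k - 1) = 0"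
    using k(2) by (auto intro!: coeff_eq_0)
  have lead: "coeff F' k = 1"
    using t0 a0 by (simp add: F'_def Ck ne tk)
  have "coeff F' (k - 1) = 0"
    using t0 a0 k(2) unfolding F'_def coeff_smult coeff_diff Ck1 ne by (simp add: e_def)
  moreover have degF': "degree F' = k"
  proof (rule antisym)
    show "degree F' \<le> k" unfolding F'_def using degC
      by (intro order.trans[OF degree_smult_le] degree_diff_le) auto
    show "k \<le> degree F'" using lead by (intro le_degree) simp
  qed
  ultimately have "monic_centered k F'" using lead by (simp add: monic_centered_def)
  moreover have "t * poly F' z = poly F (t * z + e) - e" for z
    using t0 by (simp add: F'_def C_def poly_pcompose add.commute mult.commute)
  from affine_conj[OF t0 _ _ this] have "pclass k F = pclass k F'"
    using k degF' by (intro pclass_eqI) auto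
  ultimately show ?thesis by blast
qed

section \<open>Polynomial maps have a polynomial in their conjugacy class\<close>

lemma ratmap_smult: "c \<noteq> 0 \<Longrightarrow> ratmap (smult c p) (smult c q) = ratmap p q"
proof
  fix P :: "'a P1" assume "c \<noteq> 0"
  thus "ratmap (smult c p) (smult c q) P = ratmap p q P"
    by (cases P) (auto simp: Let_def)
qed

lemma ratmap_const_denominator:
  assumes "c \<noteq> 0" "max (degree p) (degree [:c:]) = d"
  shows "ratmap p [:c:] = pmap (smult (1 / c) p)" "degree (smult (1 / c) p) = d"
proof -
  have "ratmap (smult (1 / c) p) (smult (1 / c) [:c:]) = ratmap p [:c:]"
    using assms(1) by (intro ratmap_smult) simp
  thus "ratmap p [:c:] = pmap (smult (1 / c) p)" using assms(1) by (simp add: one_pCons)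
  show "degree (smult (1 / c) p) = d" using assms by simp
qed

lemma degree_le_order_eq:
  fixes p :: "'a::field poly"
  assumes "p \<noteq> 0" "degree p \<le> d" "order z p = d"
  obtains c where "c \<noteq> 0" "p = smult c ([:- z, 1:] ^ d)"
proof -
  have "[:- z, 1:] ^ d dvd p" using assms(3) order_1 by metis
  then obtain r where r: "p = [:- z, 1:] ^ d * r" by (elim dvdE)
  have "r \<noteq> 0" using r assms(1) by auto
  hence "degree r = 0" using assms(2) unfolding r by (simp add: degree_mult_eq degree_linear_power)
  then obtain c where "r = [:c:]" by (elim degree_eq_zeroE)
  thus ?thesis using that[of c] \<open>r \<noteq> 0\<close> r by simp
qed

lemma hpoly_smult: "hpoly d (smult c p) u v = smult c (hpoly d p u v)"
  by (simp add: poly_eq_iff hpoly_def coeff_sum sum_distrib_left mult.assoc)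

lemma flip_mob_args: "(flip :: 'a::field P1 \<Rightarrow> 'a P1) = mob 0 1 1 0" "0 * 0 - 1 * 1 \<noteq> (0::'a)"
  by (simp_all add: flip_eq_mob)

text \<open>Total ramification forces the form that vanishes over the fixed point, \<open>q\<close>
  at infinity and \<open>p - z q\<close> at a finite \<open>z\<close>, to be a constant times the
  \<open>d\<close>-th power of a linear form. Once the fixed point is at infinity, this says that
  the denominator is constant.\<close>

lemma polynomial_map_conj_pmap:
  fixes f :: "'a::{alg_closed_field, field_char_0} P1 \<Rightarrow> 'a P1"
  assumes f: "polynomial_map d f" and d: "d > 0"
  shows "\<exists>F s. degree F = d \<and> s \<in> PGL2 \<and> inv s \<circ> f \<circ> s = pmap F"
proof -
  obtain p q where pq: "f = ratmap p q" "coprime p q" "max (degree p) (degree q) = d"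
    using f by (auto simp: polynomial_map_def Hom_deg_def)
  obtain P where P: "f P = P" "ram_index f P = d" using f by (auto simp: polynomial_map_def)
  show ?thesis
  proof (cases P)
    case Infty
    define p' q' where p'q': "p' = hpoly d p [:1, 0:] [:0, 1:]" "q' = hpoly d q [:1, 0:] [:0, 1:]"
    have comp: "f \<circ> flip = ratmap p' q'" "coprime p' q'" "max (degree p') (degree q') = d"
      using ratmap_comp_mob[OF pq(2,3) flip_mob_args(2)] unfolding p'q' pq(1) flip_mob_args(1) by auto
    have "ratmap p' q' (Fin 0) = Infty" using P(1) Infty by (simp flip: comp(1))
    hence "order 0 q' = d"
      using P(2) Infty ram_index_fin_ratmap[OF comp(2), of 0] by (simp add: ram_index_def comp(1) del: ratmap.simps)
    moreover have "q' \<noteq> 0"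
    proof
      assume "q' = 0"
      hence "is_unit p'" using comp(2) by simp
      hence "degree p' = 0" by (auto elim!: is_unit_polyE)
      thus False using comp(3) \<open>q' = 0\<close> d by simp
    qed
    moreover have "degree q' \<le> d" using comp(3) by simp
    ultimately obtain c where c: "c \<noteq> 0" "q' = smult c ([:- 0, 1:] ^ d)"
      using degree_le_order_eq by blast
    \<comment> \<open>The form of \<open>q'\<close> is \<open>c * u ^ d\<close>. Exchanging the
      variables gives the form \<open>c * v ^ d\<close> for \<open>q\<close>, which is the constant
      \<open>c\<close> on the affine line.\<close>
    have "poly q x = c" for x
    proof -
      have "poly q x = hev d q x 1" using pq(3) by (subst hev_finite) auto
      also have "\<dots> = hev d q' 1 x" unfolding p'q' hev_hpoly by simp
      also have "hev d q' u v = c * u ^ d" if "v \<noteq> 0" for u v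
        using that by (subst hev_finite) (auto simp: c(2) power_divide degree_power_eq)
      hence "hev d q' 1 x = c" if "x \<noteq> 0" using that by simp
      moreover have "hev d q' 1 0 = c" using coeff_linear_power[of "0 :: 'a" d] by (simp add: hev_infty c(2))
      ultimately show ?thesis by (cases "x = 0") auto
    qed
    hence q: "q = [:c:]" by (simp add: poly_eq_poly_eq_iff[symmetric] fun_eq_iff)
    show ?thesis
      using ratmap_const_denominator[OF c(1), of p d] pq(3) PGL2_id
      by (intro exI[of _ "smult (1 / c) p"] exI[of _ id]) (simp add: q pq(1))
  next
    case (Fin z)
    have fz: "ratmap p q (Fin z) = Fin z" using P(1) Fin pq(1) by simp
    define R where "R = p - smult z q"
    have "order z R = d"
      using P(2) Fin ram_index_fin_ratmap[OF pq(2), of z] fz by (simp add: ram_index_def pq(1) R_def)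
    moreover have "R \<noteq> 0"
    proof
      assume "R = 0"
      hence "p = smult z q" by (simp add: R_def)
      hence "is_unit q" using pq(2) coprime_common_divisor[of p q q] by (metis dvd_refl dvd_smult)
      hence "degree q = 0" by (auto elim!: is_unit_polyE)
      thus False using pq(3) \<open>p = smult z q\<close> d by (auto split: if_splits)
    qed
    moreover have "degree R \<le> d" unfolding R_def using pq(3)
      by (intro degree_diff_le order.trans[OF degree_smult_le]) auto
    ultimately obtain c where c: "c \<noteq> 0" "R = smult c ([:- z, 1:] ^ d)"
      using degree_le_order_eq by blast
    \<comment> \<open>The conjugating map is \<open>w \<mapsto> z + 1 / w\<close>, which takes
      infinity to \<open>z\<close>.\<close>
    have det: "z * 0 - 1 * 1 \<noteq> 0" "0 * z - (- 1) * (- 1) \<noteq> 0" by auto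
    note comp1 = ratmap_comp_mob[OF pq(2,3) det(1)]
    define p' q' where p'q': "p' = hpoly d p [:1, z:] [:0, 1:]" "q' = hpoly d q [:1, z:] [:0, 1:]"
    note comp2 = mob_comp_ratmap[OF comp1(2,3) det(2), folded p'q']
    have "hpoly d R [:1, z:] [:0, 1:] = [:c:]"
    proof -
      have "hpoly d R [:1, z:] [:0, 1:] = smult c (hpoly d ([:- z, 1:] ^ d) [:1, z:] [:0, 1:])"
        unfolding c(2) by (rule hpoly_smult)
      thus ?thesis unfolding hpoly_linear_power by (simp add: one_pCons[symmetric])
    qed
    moreover have "hpoly d R [:1, z:] [:0, 1:] = p' - smult z q'"
      by (simp add: R_def p'q' hpoly_diff hpoly_smult)
    ultimately have den: "smult (- 1) p' + smult z q' = [:- c:]"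
      by (metis add.commute diff_conv_add_uminus minus_diff_eq minus_pCons neg_equal_0_iff_equal minus_poly_def smult_minus_left smult_1_left uminus_add_conv_diff minus_zero)
    have "inv (mob z 1 1 0) \<circ> f \<circ> mob z 1 1 0 = ratmap (smult 0 p' + smult (- 1) q') [:- c:]"
      using comp2(1) den unfolding inv_mob[OF det(1)] pq(1) o_assoc[symmetric] comp1(1) p'q' by simp
    moreover have "mob z 1 1 0 \<in> PGL2" unfolding PGL2_eq using det(1) by blast
    moreover have "- c \<noteq> 0" "max (degree (smult 0 p' + smult (- 1) q')) (degree [:- c:]) = d"
      using c(1) comp2(3) den by simp_all
    note ratmap_const_denominator[OF this]
    ultimately show ?thesis
      by (intro exI[of _ "smult (1 / - c) (smult 0 p' + smult (- 1) q')"] exI[of _ "mob z 1 1 0"] conjI)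
        simp_all
  qed
qed

lemma polynomial_map_pmap:
  fixes F :: "'a::{alg_closed_field, field_char_0} poly"
  assumes F: "degree F = d" "d > 0"
  shows "polynomial_map d (pmap F)"
proof -
  have maxd: "max (degree F) (degree (1 :: 'a poly)) = d" using F by simp
  define p' q' :: "'a poly" where p'q': "p' = hpoly d F [:1, 0:] [:0, 1:]" "q' = hpoly d 1 [:1, 0:] [:0, 1:]"
  have comp: "pmap F \<circ> flip = ratmap p' q'" "coprime p' q'"
    using ratmap_comp_mob[OF coprime_1_right maxd flip_mob_args(2)] unfolding p'q' flip_mob_args(1) by auto
  have inf: "pmap F Infty = Infty" using F pmap_Infty by blast
  have "ratmap p' q' (Fin 0) = Infty" using inf by (simp flip: comp(1) del: ratmap.simps)
  hence "ram_index (pmap F) Infty = order 0 q'"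
    using ram_index_fin_ratmap[OF comp(2), of 0] by (simp add: ram_index_def comp(1) del: ratmap.simps)
  also have "q' = [:- 0, 1:] ^ d" unfolding p'q' hpoly_one by simp
  also have "order 0 \<dots> = d" by (rule order_power_n_n)
  finally show ?thesis
    unfolding polynomial_map_def using pmap_Hom_deg[OF F(1)] inf by blast
qed

lemma poly_moduli_eq:
  assumes k: "k \<ge> 2"
  shows "poly_moduli k = pclass k ` {F :: 'a::{alg_closed_field, field_char_0} poly. monic_centered k F}"
proof (intro equalityI subsetI)
  fix c :: "('a P1 \<Rightarrow> 'a P1) set" assume "c \<in> poly_moduli k"
  then obtain f g where c: "c = conj_rel k `` {g}" "g \<in> Hom_deg k" "f \<in> c" "polynomial_map k f"
    unfolding poly_moduli_def moduli_def by (auto elim!: quotientE)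
  obtain F s where F: "degree F = k" "s \<in> PGL2" "inv s \<circ> f \<circ> s = pmap F"
    using polynomial_map_conj_pmap[OF c(4)] k by auto
  have "(g, f) \<in> conj_rel k" using c by blast
  moreover have "(f, pmap F) \<in> conj_rel k"
    unfolding conj_rel_def using F(2) F(3)[symmetric] c(4) pmap_Hom_deg[OF F(1)]
    unfolding polynomial_map_def by blast
  ultimately have "(g, pmap F) \<in> conj_rel k"
    using equiv_conj_rel unfolding equiv_def by (meson transD)
  hence "c = pclass k F" unfolding c(1) pclass_def by (rule equiv_class_eq[OF equiv_conj_rel])
  thus "c \<in> pclass k ` {F. monic_centered k F}"
    using exists_monic_centered[OF F(1) k] by blast
next
  fix c :: "('a P1 \<Rightarrow> 'a P1) set" assume "c \<in> pclass k ` {F. monic_centered k F}"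
  then obtain F where F: "degree F = k" "c = pclass k F" by (auto simp: monic_centered_def)
  have "polynomial_map k (pmap F)" using polynomial_map_pmap[OF F(1)] k by auto
  thus "c \<in> poly_moduli k"
    using F pclass_nonempty[OF F(1)] pmap_Hom_deg[OF F(1)]
    unfolding poly_moduli_def moduli_def pclass_def by (auto intro: quotientI)
qed

section \<open>Reduction to normal forms\<close>

lemma psum_spec:
  "psum (Suc m) (spec F) = (\<Sum>z\<in>#proots (F - [:0, 1:]). poly (pderiv F ^ Suc m) z)"
  by (simp add: psum_def spec_def image_mset.compositionality o_def)

lemma monic_diff_X:
  fixes F :: "'a::field poly"
  assumes "degree F = N" "N \<ge> 2" "lead_coeff F = 1"
  shows "degree (F - [:0, 1:]) = N" "lead_coeff (F - [:0, 1:]) = 1"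
proof -
  have "degree (F + - [:0, 1:]) = degree F" using assms by (intro degree_add_eq_left) simp
  thus *: "degree (F - [:0, 1:]) = N" by (simp only: diff_conv_add_uminus assms(1))
  have "coeff [:0, 1 :: 'a:] N = 0" using assms(2) by (intro coeff_eq_0) simp
  thus "lead_coeff (F - [:0, 1:]) = 1" using assms by (simp only: * coeff_diff) simp
qed

lemma monic_pcompose:
  fixes F :: "'a::field poly"
  assumes "degree F = k" "k \<ge> 2" "lead_coeff F = 1"
  shows "degree (F \<circ>\<^sub>p F) = k\<^sup>2" "k\<^sup>2 \<ge> 2" "lead_coeff (F \<circ>\<^sub>p F) = 1"
proof -
  show "degree (F \<circ>\<^sub>p F) = k\<^sup>2" using assms by (simp add: degree_pcompose power2_eq_square)
  have "k * 1 \<le> k * k" using assms by (intro mult_le_mono) auto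
  hence "2 \<le> k * k" using assms(2) by linarith
  thus "k\<^sup>2 \<ge> 2" by (simp add: power2_eq_square)
  have "lead_coeff (F \<circ>\<^sub>p F) = lead_coeff F * lead_coeff F ^ degree F"
    using assms by (intro lead_coeff_comp) auto
  thus "lead_coeff (F \<circ>\<^sub>p F) = 1" by (simp only: assms(3)) simp
qed

lemma elem_sym_spec_closed:
  fixes F :: "'s \<Rightarrow> 'a::{alg_closed_field, field_char_0} poly"
  assumes "fun_alg A" and F: "fun_alg.poly_fam A F" "\<And>s. degree (F s) = N" "N \<ge> 2"
    "\<And>s. lead_coeff (F s) = 1"
  shows "(\<lambda>s. elem_sym i (spec (F s))) \<in> A"
proof -
  interpret fun_alg A by fact
  show ?thesis
  proof (rule elem_sym_closed)
    fix m
    have deg: "degree (pderiv (F s) ^ Suc m) \<le> Suc m * N" for s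
      using F(2)[of s] coeff_power_bound(1)[of "pderiv (F s)" N "Suc m"]
      by (simp add: degree_pderiv del: power_Suc)
    show "(\<lambda>s. psum (Suc m) (spec (F s))) \<in> A"
      unfolding psum_spec
      by (rule sum_roots_closed[OF assms(1) _ monic_diff_X(1)[OF F(2,3,4)]
            monic_diff_X(2)[OF F(2,3,4)] _ deg])
        (intro fam_intros poly_fam_pderiv F)+
  qed (simp del: of_nat_Suc)
qed

lemma length_sigma_poly: "length (sigma_poly k F) = (k + 1) + (k\<^sup>2 + 1)"
  by (simp add: sigma_poly_def del: upt_Suc)

lemma sigma_poly_nth:
  "i < k + 1 \<Longrightarrow> sigma_poly k F ! i = elem_sym (i + 1) (spec F)"
  "i < k\<^sup>2 + 1 \<Longrightarrow> sigma_poly k F ! (k + 1 + i) = elem_sym (i + 1) (spec (F \<circ>\<^sub>p F))"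
  by (simp_all add: sigma_poly_def nth_append del: upt_Suc)

text \<open>Since \<open>D\<close> depends on the image point only, its nonvanishing constrains all
  points of a fibre at once.\<close>

theorem generic_injectivity_criterion:
  fixes D :: "'a::{alg_closed_field, field_char_0} list \<Rightarrow> 'a"
  assumes k: "k \<ge> 2" and D: "D \<in> regular_funs ((k + 1) + (k\<^sup>2 + 1))"
    and F0: "monic_centered k F0" "D (sigma_poly k F0) \<noteq> 0"
    and inj: "\<And>F F'. monic_centered k F \<Longrightarrow> monic_centered k F' \<Longrightarrow> D (sigma_poly k F) \<noteq> 0 \<Longrightarrow>
      sigma_poly k F = sigma_poly k F' \<Longrightarrow> pclass k F = pclass k F'"
  shows "\<exists>U :: 'a list set. U \<noteq> {} \<and>
    open_dense_in ((k + 1) + (k\<^sup>2 + 1)) (tau2 k ` poly_moduli k) U \<and>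
    (\<forall>Q\<in>U. \<exists>!c. c \<in> poly_moduli k \<and> tau2 k c = Q)"
proof -
  define S where "S = {F :: 'a poly. monic_centered k F}"
  define N where "N = (k + 1) + (k\<^sup>2 + 1)"
  have tau: "tau2 k (pclass k F) = sigma_poly k F" if "monic_centered k F" for F :: "'a poly"
    using that k by (intro tau2_pclass) (auto simp: monic_centered_def)
  have img: "tau2 k ` poly_moduli k = sigma_poly k ` S"
    unfolding poly_moduli_eq[OF k] image_image S_def using tau by (intro image_cong) auto
  have od: "open_dense_in N (sigma_poly k ` S) {x \<in> sigma_poly k ` S. D x \<noteq> 0}"
  proof (rule open_dense_in_image[of "sigma_poly k" S N D F0])
    show "sigma_poly k ` S \<subseteq> affine_space N"
      by (auto simp: affine_space_def length_sigma_poly N_def)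
    show "D \<in> regular_funs N" using D by (simp add: N_def)
    show "D (sigma_poly k F0) \<noteq> 0" by fact
  next
    fix F assume "F \<in> S"
    hence F: "monic_centered k F" by (simp add: S_def)
    \<comment> \<open>The segment consists of monic centered polynomials, as both normalizations are
      affine conditions.\<close>
    define \<gamma> where "\<gamma> = (\<lambda>t. F + smult t (F0 - F))"
    have mc: "monic_centered k (\<gamma> t)" for t
    proof -
      have "degree (\<gamma> t) \<le> k" unfolding \<gamma>_def using F F0(1)
        by (intro degree_add_le order.trans[OF degree_smult_le] degree_diff_le)
          (auto simp: monic_centered_def)
      moreover have "coeff (\<gamma> t) k = 1" "coeff (\<gamma> t) (k - 1) = 0"
        using F F0(1) by (auto simp: \<gamma>_def monic_centered_def)
      moreover from this have "k \<le> degree (\<gamma> t)" by (intro le_degree) simp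
      ultimately show ?thesis by (simp add: monic_centered_def)
    qed
    have "(\<lambda>t. t) \<in> (poly_funs :: ('a \<Rightarrow> 'a) set)"
      unfolding poly_funs_def by (auto intro!: exI[of _ "[:0, 1:]"])
    hence fam: "poly_funs.poly_fam \<gamma>" unfolding \<gamma>_def
      by (intro poly_funs.fam_intros)
    have mc': "degree (\<gamma> t) = k" "lead_coeff (\<gamma> t) = 1" for t
      using mc[of t] by (auto simp: monic_centered_def)
    note c = monic_pcompose[OF mc'(1) k mc'(2)]
    have fam2: "poly_funs.poly_fam (\<lambda>t. \<gamma> t \<circ>\<^sub>p \<gamma> t)"
      using mc'(1) by (intro poly_funs.poly_fam_pcompose[OF fam fam]) auto
    have "(\<lambda>t. sigma_poly k (\<gamma> t) ! i) \<in> poly_funs" if i: "i < N" for i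
    proof (cases "i < k + 1")
      case True
      thus ?thesis unfolding sigma_poly_nth(1)[OF True]
        by (intro elem_sym_spec_closed[OF poly_funs.fun_alg_axioms fam mc'(1) k mc'(2)])
    next
      case False
      define j where "j = i - (k + 1)"
      have j: "i = k + 1 + j" "j < k\<^sup>2 + 1" using False i by (auto simp: j_def N_def)
      show ?thesis unfolding j(1) sigma_poly_nth(2)[OF j(2)]
        by (intro elem_sym_spec_closed[OF poly_funs.fun_alg_axioms fam2 c(1,2,3)])
    qed
    thus "\<exists>\<gamma>. range \<gamma> \<subseteq> S \<and> \<gamma> 0 = F \<and> \<gamma> 1 = F0 \<and>
        (\<forall>i<N. (\<lambda>t. sigma_poly k (\<gamma> t) ! i) \<in> poly_funs)"
      using mc by (intro exI[of _ \<gamma>]) (auto simp: S_def \<gamma>_def)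
  qed
  have ne: "sigma_poly k F0 \<in> {x \<in> sigma_poly k ` S. D x \<noteq> 0}"
    using F0 by (auto simp: S_def)
  have uq: "\<exists>!c. c \<in> poly_moduli k \<and> tau2 k c = Q" if Q: "Q \<in> {x \<in> sigma_poly k ` S. D x \<noteq> 0}" for Q
  proof -
    obtain F where F: "monic_centered k F" "Q = sigma_poly k F" "D Q \<noteq> 0"
      using Q by (auto simp: S_def)
    show ?thesis
    proof (rule ex1I[of _ "pclass k F"])
      show "pclass k F \<in> poly_moduli k \<and> tau2 k (pclass k F) = Q"
        using F tau by (auto simp: poly_moduli_eq[OF k])
      fix c :: "('a P1 \<Rightarrow> 'a P1) set" assume c: "c \<in> poly_moduli k \<and> tau2 k c = Q"
      then obtain F' where F': "monic_centered k F'" "c = pclass k F'"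
        by (auto simp: poly_moduli_eq[OF k])
      hence "sigma_poly k F = sigma_poly k F'" using c F tau by auto
      thus "c = pclass k F" using inj[OF F(1) F'(1)] F F' by simp
    qed
  qed
  show ?thesis unfolding img N_def[symmetric]
    by (rule exI[of _ "{x \<in> sigma_poly k ` S. D x \<noteq> 0}"], intro conjI ballI)
      (use ne od uq in auto)
qed

section \<open>Power sums of multipliers as residues\<close>

lemma newton_cong:
  "(\<And>i. 0 < i \<Longrightarrow> i \<le> Suc m \<Longrightarrow> e i = e' i) \<Longrightarrow> newton e m = newton e' m"
proof (induction m rule: less_induct)
  case (less m)
  have "(\<Sum>j<m. (-1) ^ j * newton e j * e (m - j)) = (\<Sum>j<m. (-1) ^ j * newton e' j * e' (m - j))"
  proof (intro sum.cong refl)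
    fix j assume "j \<in> {..<m}"
    thus "(-1) ^ j * newton e j * e (m - j) = (-1) ^ j * newton e' j * e' (m - j)"
      using less.IH[of j] less.prems by auto
  qed
  moreover have "e (Suc m) = e' (Suc m)" using less.prems by simp
  ultimately show ?case unfolding newton.simps[of e m] newton.simps[of e' m] by (simp only:)
qed

text \<open>
  The entry with index \<open>i - 1\<close> of a point of the image is \<open>\<sigma>\<^sub>1\<^sub>,\<^sub>i\<close>, the one with index \<open>k + i\<close> is \<open>\<sigma>\<^sub>2\<^sub>,\<^sub>i\<close>.
\<close>

definition fix_psum :: "nat \<Rightarrow> 'a::field list \<Rightarrow> 'a" where
  "fix_psum m Q = newton (\<lambda>i. Q ! (i - 1)) (m - 1)"

definition per_psum :: "nat \<Rightarrow> nat \<Rightarrow> 'a::field list \<Rightarrow> 'a" where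
  "per_psum k m Q = newton (\<lambda>i. Q ! (k + i)) (m - 1)"

lemma fix_psum_sigma_poly:
  assumes "0 < m" "m \<le> k + 1"
  shows "fix_psum m (sigma_poly k F) = psum m (spec F)"
proof -
  obtain m' where m: "m = Suc m'" using assms(1) by (cases m) auto
  show ?thesis unfolding m fix_psum_def psum_Suc_eq_newton diff_Suc_1
  proof (rule newton_cong)
    fix i assume "0 < i" "i \<le> Suc m'"
    thus "sigma_poly k F ! (i - 1) = elem_sym i (spec F)"
      using sigma_poly_nth(1)[of "i - 1" k F] assms(2) m by simp
  qed
qed

lemma per_psum_sigma_poly:
  assumes "0 < m" "m \<le> k\<^sup>2 + 1"
  shows "per_psum k m (sigma_poly k F) = psum m (spec (F \<circ>\<^sub>p F))"
proof -
  obtain m' where m: "m = Suc m'" using assms(1) by (cases m) auto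
  show ?thesis unfolding m per_psum_def psum_Suc_eq_newton diff_Suc_1
  proof (rule newton_cong)
    fix i assume "0 < i" "i \<le> Suc m'"
    thus "sigma_poly k F ! (k + i) = elem_sym i (spec (F \<circ>\<^sub>p F))"
      using sigma_poly_nth(2)[of "i - 1" k F] assms(2) m by simp
  qed
qed

lemma regular_fix_psum:
  assumes "0 < m" "m \<le> k + 1"
  shows "fix_psum m \<in> regular_funs ((k + 1) + (k\<^sup>2 + 1))"
  unfolding fix_psum_def using assms by (intro regular.newton_closed regular_coord) auto

lemma regular_per_psum:
  assumes "0 < m" "m \<le> k\<^sup>2 + 1"
  shows "per_psum k m \<in> regular_funs ((k + 1) + (k\<^sup>2 + 1))"
  unfolding per_psum_def using assms by (intro regular.newton_closed regular_coord) auto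

text \<open>For monic \<open>G\<close> this is the sum of the residues of \<open>h / G\<close> at
  its finite poles, a linear functional on polynomials modulo \<open>G\<close>.\<close>

definition resid :: "'a::field poly \<Rightarrow> 'a poly \<Rightarrow> 'a" where
  "resid G h = coeff (h mod G) (degree G - 1)"

lemma resid_add: "resid G (h + h') = resid G h + resid G h'"
  by (simp add: resid_def poly_mod_add_left)

lemma resid_diff: "resid G (h - h') = resid G h - resid G h'"
  by (simp add: resid_def poly_mod_diff_left)

lemma resid_eq_coeff: "degree h < degree G \<Longrightarrow> resid G h = coeff h (degree G - 1)"
  by (simp add: resid_def mod_poly_less)

lemma resid_cong: "G dvd h - h' \<Longrightarrow> resid G h = resid G h'"
  by (simp add: resid_def flip: mod_eq_dvd_iff)

lemma resid_add_mult: "resid G (h + q * G) = resid G h"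
  by (rule resid_cong) simp

lemma resid_eq_coeffI:
  assumes "h = q * G + r" "degree r < degree G"
  shows "resid G h = coeff r (degree G - 1)"
  using resid_add_mult[of G r q] resid_eq_coeff[OF assms(2)] assms(1) by (simp add: add.commute)

lemma sum_roots_resid:
  fixes F :: "'a::alg_closed_field poly"
  assumes "degree F = N" "N \<ge> 2" "lead_coeff F = 1"
  shows "(\<Sum>z\<in>#proots (F - [:0, 1:]). poly h z) = resid (F - [:0, 1:]) (h * (pderiv F - 1))"
proof -
  have "pderiv (F - [:0, 1:]) = pderiv F - 1" by (simp add: pderiv_diff pderiv_pCons one_pCons)
  thus ?thesis using sum_roots_eq_coeff[OF monic_diff_X(2)[OF assms], of h] by (simp add: resid_def)
qed

text \<open>The residue of \<open>h P'\<close> is the sum of \<open>h\<close> over the roots of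
  \<open>P\<close>. With \<open>h = P' ^ m\<close> and \<open>P' = F' - 1\<close> this is the sum of
  \<open>(\<lambda> - 1) ^ m\<close> over the finite fixed points, \<open>N\<close> in number; the
  multiplier \<open>0\<close> at infinity does not contribute to positive power sums.\<close>

lemma resid_pderiv_power:
  fixes F :: "'a::alg_closed_field poly"
  assumes "degree F = N" "N \<ge> 2" "lead_coeff F = 1"
  defines "P \<equiv> F - [:0, 1:]"
  defines "p \<equiv> \<lambda>m. psum m (spec F)"
  shows "resid P (pderiv P ^ 2) = p 1 - of_nat N"
    and "resid P (pderiv P ^ 3) = p 2 - 2 * p 1 + of_nat N"
    and "resid P (pderiv P ^ 4) = p 3 - 3 * p 2 + 3 * p 1 - of_nat N"
    and "resid P (pderiv P ^ 6) = p 5 - 5 * p 4 + 10 * p 3 - 10 * p 2 + 5 * p 1 - of_nat N"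
proof -
  define M where "M = proots P"
  have dP: "pderiv P = pderiv F - 1" by (simp add: P_def pderiv_diff pderiv_pCons one_pCons)
  have size: "size M = N"
    using monic_eq_prod_roots(2)[OF monic_diff_X(2)[OF assms(1-3)]] monic_diff_X(1)[OF assms(1-3)]
    by (simp add: M_def P_def)
  have r: "resid P (pderiv P ^ Suc m) = (\<Sum>z\<in>#M. (poly (pderiv F) z - 1) ^ m)" for m
    using sum_roots_resid[OF assms(1-3), of "pderiv P ^ m"]
    by (simp add: M_def P_def[symmetric] dP mult.commute)
  have p: "p (Suc m) = (\<Sum>z\<in>#M. poly (pderiv F) z ^ Suc m)" for m
    by (simp only: p_def psum_spec M_def P_def poly_power)
  have ps: "p 1 = (\<Sum>z\<in>#M. poly (pderiv F) z)" "p 2 = (\<Sum>z\<in>#M. poly (pderiv F) z ^ 2)"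
    "p 3 = (\<Sum>z\<in>#M. poly (pderiv F) z ^ 3)" "p 4 = (\<Sum>z\<in>#M. poly (pderiv F) z ^ 4)"
    "p 5 = (\<Sum>z\<in>#M. poly (pderiv F) z ^ 5)"
    using p[of 0] p[of 1] p[of 2] p[of 3] p[of 4] by (simp_all add: eval_nat_numeral del: power_Suc) 
  have e: "(\<Sum>z\<in>#M. f z - 1) = (\<Sum>z\<in>#M. f z) - of_nat (size M)"
    "(\<Sum>z\<in>#M. (f z - 1) ^ 2) = (\<Sum>z\<in>#M. f z ^ 2) - 2 * (\<Sum>z\<in>#M. f z) + of_nat (size M)"
    "(\<Sum>z\<in>#M. (f z - 1) ^ 3) = (\<Sum>z\<in>#M. f z ^ 3) - 3 * (\<Sum>z\<in>#M. f z ^ 2) + 3 * (\<Sum>z\<in>#M. f z) - of_nat (size M)"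
    "(\<Sum>z\<in>#M. (f z - 1) ^ 5) = (\<Sum>z\<in>#M. f z ^ 5) - 5 * (\<Sum>z\<in>#M. f z ^ 4) + 10 * (\<Sum>z\<in>#M. f z ^ 3)
      - 10 * (\<Sum>z\<in>#M. f z ^ 2) + 5 * (\<Sum>z\<in>#M. f z) - of_nat (size M)" for f :: "'a \<Rightarrow> 'a"
    by (induction M) (simp_all add: algebra_simps eval_nat_numeral)
  show "resid P (pderiv P ^ 2) = p 1 - of_nat N"
    "resid P (pderiv P ^ 3) = p 2 - 2 * p 1 + of_nat N"
    "resid P (pderiv P ^ 4) = p 3 - 3 * p 2 + 3 * p 1 - of_nat N"
    "resid P (pderiv P ^ 6) = p 5 - 5 * p 4 + 10 * p 3 - 10 * p 2 + 5 * p 1 - of_nat N"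
    using r[of 1] r[of 2] r[of 3] r[of 5] e[of "poly (pderiv F)"] unfolding ps size
    by (simp_all add: eval_nat_numeral del: power_Suc)
qed

section \<open>Second iterates\<close>

lemma pcompose_power: "(p ^ n) \<circ>\<^sub>p q = (p \<circ>\<^sub>p q) ^ n"
  by (induction n) (simp_all add: pcompose_mult pcompose_1)

text \<open>
  Reduction of \<open>\<phi>(z) \<psi>(F(z))\<close> modulo \<open>F(F(z)) - z\<close> works like the reduction of \<open>\<phi>(z) \<psi>(w)\<close>
  modulo \<open>F(z) - w\<close> and \<open>F(w) - z\<close>, where \<open>w = F(z)\<close>.
\<close>

locale monic_poly =
  fixes F :: "'a::field poly" and k :: nat
  assumes degF: "degree F = k" and leadF: "lead_coeff F = 1" and k4: "k \<ge> 4"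
begin

definition G :: "'a poly" where "G = F \<circ>\<^sub>p F - [:0, 1:]"

lemma degG: "degree G = k\<^sup>2" and k2: "k\<^sup>2 = (k - 1) + (k - 1) * k + 1"
proof -
  have k: "k \<ge> 2" using k4 by simp
  note c = monic_pcompose[OF degF k leadF]
  show "degree G = k\<^sup>2" unfolding G_def by (rule monic_diff_X(1)[OF c])
  obtain n where "k = Suc n" using k4 by (cases k) auto
  thus "k\<^sup>2 = (k - 1) + (k - 1) * k + 1" by (simp add: power2_eq_square)
qed

text \<open>The products \<open>z ^ i * F ^ j\<close> with \<open>i, j < k\<close> have the distinct
  degrees \<open>i + j k < k\<^sup>2\<close>, so no reduction takes place and only
  \<open>i = j = k - 1\<close> reaches the top coefficient.\<close>

lemma resid_reduced:
  assumes "degree \<phi> < k" "degree \<psi> < k"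
  shows "resid G (\<phi> * (\<psi> \<circ>\<^sub>p F)) = coeff \<phi> (k - 1) * coeff \<psi> (k - 1)"
proof -
  have d: "degree \<phi> \<le> k - 1" "degree \<psi> \<le> k - 1" using assms by auto
  have dF: "degree (\<psi> \<circ>\<^sub>p F) \<le> (k - 1) * k"
    using degree_pcompose_le[of \<psi> F] d(2) degF by (metis le_trans mult_le_mono1)
  have "\<psi> \<circ>\<^sub>p F = (\<Sum>i\<le>k - 1. smult (coeff \<psi> i) (F ^ i))"
  proof -
    have "\<psi> \<circ>\<^sub>p F = (\<Sum>i\<le>degree \<psi>. smult (coeff \<psi> i) (F ^ i))"
      by (simp add: pcompose_altdef poly_altdef degree_map_poly coeff_map_poly)
    also have "\<dots> = (\<Sum>i\<le>k - 1. smult (coeff \<psi> i) (F ^ i))"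
      using d(2) by (intro sum.mono_neutral_left) (auto simp: coeff_eq_0)
    finally show ?thesis .
  qed
  hence "coeff (\<psi> \<circ>\<^sub>p F) ((k - 1) * k) = (\<Sum>i\<le>k - 1. coeff \<psi> i * coeff (F ^ i) ((k - 1) * k))"
    by (simp add: coeff_sum)
  also have "\<dots> = (\<Sum>i\<le>k - 1. if i = k - 1 then coeff \<psi> i else 0)"
  proof (intro sum.cong refl)
    fix i assume "i \<in> {..k - 1}"
    show "coeff \<psi> i * coeff (F ^ i) ((k - 1) * k) = (if i = k - 1 then coeff \<psi> i else 0)"
    proof (cases "i = k - 1")
      case True
      thus ?thesis using coeff_power_bound(2)[of F k i] degF leadF by simp
    next
      case False
      hence "i * k < (k - 1) * k" using \<open>i \<in> {..k - 1}\<close> k4 by simp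
      moreover have "degree (F ^ i) \<le> i * k" using degF by (intro coeff_power_bound(1)) simp
      ultimately have "coeff (F ^ i) ((k - 1) * k) = 0" by (intro coeff_eq_0) linarith
      thus ?thesis using False by simp
    qed
  qed
  finally have lead: "coeff (\<psi> \<circ>\<^sub>p F) ((k - 1) * k) = coeff \<psi> (k - 1)" by simp
  have "degree (\<phi> * (\<psi> \<circ>\<^sub>p F)) \<le> (k - 1) + (k - 1) * k"
    using degree_mult_le[of \<phi> "\<psi> \<circ>\<^sub>p F"] d dF by linarith
  hence "resid G (\<phi> * (\<psi> \<circ>\<^sub>p F)) = coeff (\<phi> * (\<psi> \<circ>\<^sub>p F)) (k\<^sup>2 - 1)"
    using degG k2 by (subst resid_eq_coeff) auto
  thus ?thesis using coeff_mult_bound[OF d(1) dF] lead k2 by simp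
qed

lemma G_dvd: "G dvd \<psi> \<circ>\<^sub>p (F \<circ>\<^sub>p F) - \<psi>"
proof (induction \<psi>)
  case (pCons c \<psi>)
  have "pCons c \<psi> \<circ>\<^sub>p (F \<circ>\<^sub>p F) - pCons c \<psi> =
      (F \<circ>\<^sub>p F) * (\<psi> \<circ>\<^sub>p (F \<circ>\<^sub>p F) - \<psi>) + \<psi> * G"
    by (simp add: pcompose_pCons G_def algebra_simps)
  thus ?case using pCons.IH by simp
qed simp

text \<open>Modulo \<open>G\<close> one has \<open>F(F(z)) = z\<close>, so a factor
  \<open>\<theta>(F(w))\<close> with \<open>w = F(z)\<close> becomes
  \<open>\<theta>(z)\<close>.\<close>

lemma resid_shift:
  "resid G (\<phi> * ((\<psi> * \<theta> \<circ>\<^sub>p F) \<circ>\<^sub>p F)) = resid G (\<phi> * \<theta> * (\<psi> \<circ>\<^sub>p F))"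
proof (rule resid_cong)
  have "\<phi> * ((\<psi> * \<theta> \<circ>\<^sub>p F) \<circ>\<^sub>p F) - \<phi> * \<theta> * (\<psi> \<circ>\<^sub>p F) =
      \<phi> * (\<psi> \<circ>\<^sub>p F) * (\<theta> \<circ>\<^sub>p (F \<circ>\<^sub>p F) - \<theta>)"
    by (simp add: pcompose_mult pcompose_assoc algebra_simps)
  thus "G dvd \<phi> * ((\<psi> * \<theta> \<circ>\<^sub>p F) \<circ>\<^sub>p F) - \<phi> * \<theta> * (\<psi> \<circ>\<^sub>p F)" using G_dvd by simp
qed

lemma mod_decomp:
  assumes "degree \<phi> \<le> k + j"
  obtains l where "\<phi> = \<phi> mod F + l * F" "degree l \<le> j" "degree (\<phi> mod F) < k"
proof -
  have F0: "F \<noteq> 0" using leadF by auto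
  have "degree (\<phi> mod F) < k" using degree_mod_less[OF F0, of \<phi>] degF k4 by (cases "\<phi> mod F = 0") auto
  moreover have "degree (\<phi> div F) \<le> j"
  proof (cases "\<phi> div F = 0")
    case False
    have "\<phi> div F * F = \<phi> - \<phi> mod F" by (simp add: minus_mod_eq_div_mult)
    hence "degree (\<phi> div F * F) \<le> k + j"
      using assms calculation by (metis degree_diff_le le_add1 le_trans less_imp_le)
    thus ?thesis using False F0 degF by (simp add: degree_mult_eq)
  qed simp
  ultimately show ?thesis using that[of "\<phi> div F"] by simp
qed

text \<open>Division of \<open>\<psi>\<close> by \<open>F\<close> leaves a constant quotient, and
  \<open>F(w) = z\<close> moves it to the left as one factor \<open>z\<close>. The bound
  \<open>k - 2\<close> leaves room for that factor below degree \<open>k\<close>.\<close>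

lemma resid_low_left:
  assumes "degree \<phi> \<le> k - 2" "degree \<psi> \<le> k"
  shows "resid G (\<phi> * (\<psi> \<circ>\<^sub>p F)) = 0"
proof -
  obtain l where l: "\<psi> = \<psi> mod F + l * F" "degree l \<le> 0" "degree (\<psi> mod F) < k"
    using mod_decomp[of \<psi> 0] assms(2) by auto
  then obtain c where c: "l = [:c:]" by (auto elim: degree_eq_zeroE)
  have X: "F = ([:0, 1:] \<circ>\<^sub>p F)" by (simp add: pcompose_pCons)
  have "\<phi> * (\<psi> \<circ>\<^sub>p F) = \<phi> * ((\<psi> mod F) \<circ>\<^sub>p F) + \<phi> * (([:c:] * [:0, 1:] \<circ>\<^sub>p F) \<circ>\<^sub>p F)"
    using l(1) X unfolding c by (metis distrib_left pcompose_add)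
  hence "resid G (\<phi> * (\<psi> \<circ>\<^sub>p F)) = resid G (\<phi> * ((\<psi> mod F) \<circ>\<^sub>p F)) +
      resid G (\<phi> * [:0, 1:] * ([:c:] \<circ>\<^sub>p F))"
    by (simp only: resid_add resid_shift)
  moreover have "coeff \<phi> (k - 1) = 0" using assms(1) k4 by (intro coeff_eq_0) auto
  moreover have "degree (\<phi> * [:0, 1:]) \<le> k - 1"
    using degree_mult_le[of \<phi> "[:0, 1:]"] assms(1) k4 by simp
  moreover have "coeff [:c:] (k - 1) = 0" using k4 by (intro coeff_eq_0) auto
  moreover have "degree \<phi> < k" using assms(1) k4 by linarith
  moreover have "degree (\<phi> * [:0, 1:]) < k" "degree [:c:] < k" if "degree (\<phi> * [:0, 1:]) \<le> k - 1"
    using that k4 by auto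
  ultimately show ?thesis by (simp only: resid_reduced l(3)) simp
qed

lemma resid_low_right:
  assumes "degree \<phi> \<le> k" "degree \<psi> \<le> k - 2"
  shows "resid G (\<phi> * (\<psi> \<circ>\<^sub>p F)) = 0"
proof -
  obtain l where l: "\<phi> = \<phi> mod F + l * F" "degree l \<le> 0" "degree (\<phi> mod F) < k"
    using mod_decomp[of \<phi> 0] assms(1) by auto
  then obtain c where c: "l = [:c:]" by (auto elim: degree_eq_zeroE)
  have X: "F * (\<psi> \<circ>\<^sub>p F) = ([:0, 1:] * \<psi>) \<circ>\<^sub>p F" by (simp add: pcompose_mult pcompose_pCons)
  have "\<phi> * (\<psi> \<circ>\<^sub>p F) = (\<phi> mod F) * (\<psi> \<circ>\<^sub>p F) + [:c:] * (([:0, 1:] * \<psi>) \<circ>\<^sub>p F)"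
    using l(1) unfolding c X[symmetric] by (metis distrib_right mult.assoc)
  hence "resid G (\<phi> * (\<psi> \<circ>\<^sub>p F)) = resid G ((\<phi> mod F) * (\<psi> \<circ>\<^sub>p F)) +
      resid G ([:c:] * (([:0, 1:] * \<psi>) \<circ>\<^sub>p F))" by (simp only: resid_add)
  moreover have "coeff \<psi> (k - 1) = 0" using assms(2) k4 by (intro coeff_eq_0) auto
  moreover have "degree ([:0, 1:] * \<psi>) \<le> k - 1"
    using degree_mult_le[of "[:0, 1:]" \<psi>] assms(2) k4 by simp
  moreover have "coeff [:c:] (k - 1) = 0" using k4 by (intro coeff_eq_0) auto
  ultimately show ?thesis using assms l(3) k4
    by (simp only: resid_reduced[OF l(3)]) (subst resid_reduced; auto)
qed

text \<open>Both factors are reduced modulo \<open>F\<close>, with quotients of degree at most one.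
  The relations \<open>F(z) = w\<close> and \<open>F(w) = z\<close> turn the three terms that
  involve a quotient into products with a factor of degree at most \<open>k - 2\<close>, which have
  residue zero; this uses \<open>k \<ge> 4\<close>.\<close>

lemma resid_product:
  assumes "degree \<phi> \<le> k + 1" "degree \<psi> \<le> k + 1"
  shows "resid G (\<phi> * (\<psi> \<circ>\<^sub>p F)) = resid F \<phi> * resid F \<psi>"
proof -
  obtain l where l: "\<phi> = \<phi> mod F + l * F" "degree l \<le> 1" "degree (\<phi> mod F) < k"
    using mod_decomp[OF assms(1)] .
  obtain m where m: "\<psi> = \<psi> mod F + m * F" "degree m \<le> 1" "degree (\<psi> mod F) < k"
    using mod_decomp[OF assms(2)] .
  define f g where fg: "f = \<phi> mod F" "g = \<psi> mod F"
  define x :: "'a poly" where "x = [:0, 1:]"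
  have X: "F = x \<circ>\<^sub>p F" by (simp add: x_def pcompose_pCons)
  have "\<phi> * (\<psi> \<circ>\<^sub>p F) = (f + l * (x \<circ>\<^sub>p F)) * ((g + m * (x \<circ>\<^sub>p F)) \<circ>\<^sub>p F)"
    using l(1) m(1) X fg by metis
  also have "\<dots> = f * (g \<circ>\<^sub>p F) + f * ((m * x \<circ>\<^sub>p F) \<circ>\<^sub>p F) + l * ((x * g) \<circ>\<^sub>p F) +
      l * (((x * m) * x \<circ>\<^sub>p F) \<circ>\<^sub>p F)"
    by (simp add: pcompose_add pcompose_mult algebra_simps)
  finally have "resid G (\<phi> * (\<psi> \<circ>\<^sub>p F)) = resid G (f * (g \<circ>\<^sub>p F)) + resid G (f * x * (m \<circ>\<^sub>p F)) +
      resid G (l * ((x * g) \<circ>\<^sub>p F)) + resid G (l * x * ((x * m) \<circ>\<^sub>p F))"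
    by (simp only: resid_add resid_shift)
  moreover have "resid G (f * x * (m \<circ>\<^sub>p F)) = 0"
    using degree_mult_le[of f x] l(3) m(2) k4 by (intro resid_low_right) (auto simp: x_def fg)
  moreover have "resid G (l * ((x * g) \<circ>\<^sub>p F)) = 0"
    using degree_mult_le[of x g] l(2) m(3) k4 by (intro resid_low_left) (auto simp: x_def fg)
  moreover have "resid G (l * x * ((x * m) \<circ>\<^sub>p F)) = 0"
    using degree_mult_le[of l x] degree_mult_le[of x m] l(2) m(2) k4
    by (intro resid_low_left) (auto simp: x_def)
  moreover have "resid G (f * (g \<circ>\<^sub>p F)) = resid F \<phi> * resid F \<psi>"
    using resid_reduced[OF l(3) m(3)] by (simp add: fg resid_def degF)
  ultimately show ?thesis by simp
qed

text \<open>The case \<open>m = 3\<close> of the trace formula \<open>\<Sum>\<^sub>i\<^sub>j B\<^sub>i\<^sub>j B\<^sub>j\<^sub>i\<close> with \<open>B\<^sub>i\<^sub>j = resid F (A\<^sub>i z\<^sup>j)\<close>.\<close>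

lemma resid_adic_square:
  assumes H: "H = A0 + A1 * F + A2 * F ^ 2"
    and A: "degree A0 < k" "degree A1 < k" "degree A2 < k"
  defines "B \<equiv> \<lambda>A j. resid F (A * [:0, 1:] ^ j)"
  shows "resid G (H * (H \<circ>\<^sub>p F)) = (B A0 0)\<^sup>2 + (B A1 1)\<^sup>2 + (B A2 2)\<^sup>2 +
    2 * (B A0 1 * B A1 0 + B A0 2 * B A2 0 + B A1 2 * B A2 1)"
proof -
  define x :: "'a poly" where "x = [:0, 1:]"
  have X: "x \<circ>\<^sub>p F = F" by (simp add: x_def pcompose_pCons)
  have prod: "resid G (a * F ^ i * ((b * F ^ j) \<circ>\<^sub>p F)) = B a j * B b i"
    if "degree a < k" "degree b < k" "i \<le> 2" "j \<le> 2" for a b i j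
  proof -
    have dx: "degree (x ^ n) = n" for n by (simp add: x_def degree_power_eq)
    \<comment> \<open>With \<open>w = F(z)\<close> and \<open>F(w) = z\<close>, the product
      \<open>a(z) F(z) ^ i b(w) F(w) ^ j\<close> becomes \<open>a(z) z ^ j b(w) w ^ i\<close>. For
      \<open>i, j \<le> 2\<close> both degrees stay within the bound \<open>k + 1\<close> of the
      product rule.\<close>
    have "a * F ^ i * ((b * F ^ j) \<circ>\<^sub>p F) = a * (((b * x ^ i) * (x ^ j) \<circ>\<^sub>p F) \<circ>\<^sub>p F)"
      by (simp add: pcompose_mult pcompose_power X algebra_simps)
    hence "resid G (a * F ^ i * ((b * F ^ j) \<circ>\<^sub>p F)) = resid G (a * x ^ j * ((b * x ^ i) \<circ>\<^sub>p F))"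
      by (simp only: resid_shift)
    also have "\<dots> = resid F (a * x ^ j) * resid F (b * x ^ i)"
      using degree_mult_le[of a "x ^ j"] degree_mult_le[of b "x ^ i"] that dx
      by (intro resid_product) auto
    finally show ?thesis by (simp add: B_def x_def)
  qed
  have "H * (H \<circ>\<^sub>p F) = (A0 * F ^ 0 + A1 * F ^ 1 + A2 * F ^ 2) *
      ((A0 * F ^ 0) \<circ>\<^sub>p F + (A1 * F ^ 1) \<circ>\<^sub>p F + (A2 * F ^ 2) \<circ>\<^sub>p F)"
    unfolding H by (simp add: pcompose_add)
  also have "resid G \<dots> = (B A0 0)\<^sup>2 + (B A1 1)\<^sup>2 + (B A2 2)\<^sup>2 +
    2 * (B A0 1 * B A1 0 + B A0 2 * B A2 0 + B A1 2 * B A2 1)"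
    unfolding ring_distribs resid_add using A by (simp only: prod order_refl zero_le one_le_numeral zero_le_numeral)
      (simp add: power2_eq_square)
  finally show ?thesis .
qed

text \<open>Each multiplication by \<open>z\<close> is followed by subtraction of a multiple of
  \<open>F\<close>. As \<open>F\<close> is centered, the first subtraction does not affect the
  coefficient sought; the second shift meets the coefficient of \<open>F\<close> at
  \<open>k - 2\<close>.\<close>

lemma resid_shift1:
  assumes "degree A < k" "coeff F (k - 1) = 0"
  shows "resid F (A * [:0, 1:] ^ 0) = coeff A (k - 1)"
    "resid F (A * [:0, 1:] ^ 1) = coeff A (k - 2)"
    "resid F (A * [:0, 1:] ^ 2) = coeff A (k - 3) - coeff F (k - 2) * coeff A (k - 1)"
proof -
  have X: "A * [:0, 1:] = pCons 0 A" for A :: "'a poly" by (simp add: mult.commute)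
  have red: "resid F (pCons 0 B) = coeff (pCons 0 B - smult (coeff B (k - 1)) F) (k - 1)"
      "degree (pCons 0 B - smult (coeff B (k - 1)) F) < k" if B: "degree B < k" for B
  proof -
    have "degree (pCons 0 B - smult (coeff B (k - 1)) F) \<le> k - 1"
    proof (rule degree_le, intro allI impI)
      fix i assume "k - 1 < i"
      hence "i = k \<or> i > k" by auto
      thus "coeff (pCons 0 B - smult (coeff B (k - 1)) F) i = 0"
        using B degF leadF k4 by (auto simp: coeff_pCons coeff_eq_0 split: nat.split)
    qed
    thus d: "degree (pCons 0 B - smult (coeff B (k - 1)) F) < k" using k4 by linarith
    have "pCons 0 B = [:coeff B (k - 1):] * F + (pCons 0 B - smult (coeff B (k - 1)) F)" by simp
    from resid_eq_coeffI[OF this] d degF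
    show "resid F (pCons 0 B) = coeff (pCons 0 B - smult (coeff B (k - 1)) F) (k - 1)" by simp
  qed
  obtain n where "k = 3 + n" using le_Suc_ex[of 3 k] k4 by auto
  hence n: "k = Suc (Suc (Suc n))" by simp
  show "resid F (A * [:0, 1:] ^ 0) = coeff A (k - 1)"
    using resid_eq_coeff[of A F] assms(1) degF by simp
  show "resid F (A * [:0, 1:] ^ 1) = coeff A (k - 2)"
    using red(1)[OF assms(1)] assms(2) n by (simp add: X)
  define C where "C = pCons 0 A - smult (coeff A (k - 1)) F"
  have "A * [:0, 1:] ^ 2 = pCons 0 C + [:0, coeff A (k - 1):] * F"
    by (simp add: power2_eq_square X C_def mult.assoc[symmetric])
  hence "resid F (A * [:0, 1:] ^ 2) = resid F (pCons 0 C)" by (simp only: resid_add_mult)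
  also have "\<dots> = coeff C (k - 2)"
    using red(1)[of C] red(2)[OF assms(1)] assms(2) n unfolding C_def by simp
  finally show "resid F (A * [:0, 1:] ^ 2) = coeff A (k - 3) - coeff F (k - 2) * coeff A (k - 1)"
    using n by (simp add: C_def)
qed

end

text \<open>Multiplying \<open>1 + \<mu> + \<mu>\<^sup>2\<close> by \<open>G' = \<mu> - 1\<close>
  telescopes to \<open>\<mu> ^ 3 - 1\<close>, and
  \<open>\<mu> ^ 3 = H * (H \<circ>\<^sub>p F)\<close> for \<open>H = F' ^ 3\<close>, whose degree
  \<open>3 k - 3\<close> explains the three digits in base \<open>F\<close>. The summand
  \<open>k\<^sup>2\<close> is the power sum of exponent zero over the finite points.\<close>

lemma resid_second_iterate:
  fixes F :: "'a::{alg_closed_field, field_char_0} poly"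
  assumes F: "monic_centered k F" "k \<ge> 4"
    and H: "pderiv F ^ 3 = A0 + A1 * F + A2 * F ^ 2"
    and A: "degree A0 < k" "degree A1 < k" "degree A2 < k"
  defines "B \<equiv> \<lambda>A j. [coeff A (k - 1), coeff A (k - 2), coeff A (k - 3) - coeff F (k - 2) * coeff A (k - 1)] ! j"
  shows "of_nat (k\<^sup>2) + psum 1 (spec (F \<circ>\<^sub>p F)) + psum 2 (spec (F \<circ>\<^sub>p F)) =
    (B A0 0)\<^sup>2 + (B A1 1)\<^sup>2 + (B A2 2)\<^sup>2 +
    2 * (B A0 1 * B A1 0 + B A0 2 * B A2 0 + B A1 2 * B A2 1)"
proof -
  interpret monic_poly F k using F by unfold_locales (auto simp: monic_centered_def)
  have k: "k \<ge> 2" using F(2) by simp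
  note c = monic_pcompose[OF degF k leadF]
  define \<mu> where "\<mu> = pderiv (F \<circ>\<^sub>p F)"
  define M where "M = proots G"
  have size: "size M = k\<^sup>2"
    using monic_eq_prod_roots(2)[OF monic_diff_X(2)[OF c]] degG by (simp add: M_def G_def)
  have p: "psum (Suc m) (spec (F \<circ>\<^sub>p F)) = (\<Sum>z\<in>#M. poly (\<mu> ^ Suc m) z)" for m
    by (simp add: psum_spec M_def G_def \<mu>_def del: power_Suc)
  have "of_nat (k\<^sup>2) + psum 1 (spec (F \<circ>\<^sub>p F)) + psum 2 (spec (F \<circ>\<^sub>p F)) =
      (\<Sum>z\<in>#M. poly (1 + \<mu> + \<mu>\<^sup>2) z)"
    using p[of 0] p[of 1] size by (simp add: sum_mset.distrib numeral_2_eq_2)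
  also have "\<dots> = resid G ((1 + \<mu> + \<mu>\<^sup>2) * (\<mu> - 1))"
    unfolding M_def G_def using sum_roots_resid[OF c, of "1 + \<mu> + \<mu>\<^sup>2"] by (simp only: \<mu>_def)
  also have "(1 + \<mu> + \<mu>\<^sup>2) * (\<mu> - 1) = \<mu> ^ 3 - 1"
    by (simp add: algebra_simps power2_eq_square power3_eq_cube)
  also have "resid G (\<mu> ^ 3 - 1) = resid G (\<mu> ^ 3)"
  proof -
    have "0 < k\<^sup>2 - 1" using c(2) by linarith
    hence "resid G 1 = 0" using degG k by (subst resid_eq_coeff) auto
    thus ?thesis by (simp add: resid_diff)
  qed
  also have "\<mu> ^ 3 = pderiv F ^ 3 * ((pderiv F ^ 3) \<circ>\<^sub>p F)"
    by (simp add: \<mu>_def pderiv_pcompose pcompose_power power_mult_distrib mult.commute)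
  also have "resid G \<dots> = (B A0 0)\<^sup>2 + (B A1 1)\<^sup>2 + (B A2 2)\<^sup>2 +
      2 * (B A0 1 * B A1 0 + B A0 2 * B A2 0 + B A1 2 * B A2 1)"
  proof -
    have cF: "coeff F (k - 1) = 0" using F(1) by (simp add: monic_centered_def)
    show ?thesis
      unfolding resid_adic_square[OF H A] resid_shift1[OF A(1) cF] resid_shift1[OF A(2) cF]
        resid_shift1[OF A(3) cF] B_def by simp
  qed
  finally show ?thesis .
qed

section \<open>Degrees two, three and four\<close>

lemma poly_eq_Poly_coeffs: "degree p \<le> n \<Longrightarrow> p = Poly (map (coeff p) [0..<Suc n])"
  by (rule poly_eqI) (auto simp: coeff_Poly_eq nth_default_def coeff_eq_0 simp del: upt_Suc)

lemma monic_centered_2: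
  assumes "monic_centered 2 F"
  obtains c where "F = [:c, 0, 1:]"
  using poly_eq_Poly_coeffs[of F 2] assms that[of "coeff F 0"]
  by (auto simp: monic_centered_def upt_rec numeral_2_eq_2)

lemma monic_centered_3:
  assumes "monic_centered 3 F"
  obtains a b where "F = [:b, a, 0, 1:]"
  using poly_eq_Poly_coeffs[of F 3] assms that[of "coeff F 0" "coeff F 1"]
  by (auto simp: monic_centered_def upt_rec eval_nat_numeral)

lemma monic_centered_4:
  assumes "monic_centered 4 F"
  obtains a b c where "F = [:c, b, a, 0, 1:]"
  using poly_eq_Poly_coeffs[of F 4] assms that[of "coeff F 0" "coeff F 1" "coeff F 2"]
  by (auto simp: monic_centered_def upt_rec eval_nat_numeral)

lemma monic_centered_5:
  assumes "monic_centered 5 F"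
  obtains a b c d where "F = [:d, c, b, a, 0, 1:]"
  using poly_eq_Poly_coeffs[of F 5] assms that[of "coeff F 0" "coeff F 1" "coeff F 2" "coeff F 3"]
  by (auto simp: monic_centered_def upt_rec eval_nat_numeral)

text \<open>The first power sum is twice the sum of the roots of \<open>z\<^sup>2 - z + c\<close>,
  hence constant; the second is the first one that sees \<open>c\<close>.\<close>

lemma psum_quadratic:
  fixes c :: "'a::{alg_closed_field, field_char_0}"
  shows "psum 2 (spec [:c, 0, 1:]) = 4 - 8 * c"
proof -
  define F where "F = [:c, 0, 1:]"
  have F: "degree F = 2" "2 \<le> (2::nat)" "lead_coeff F = 1" by (simp_all add: F_def)
  have dF: "pderiv F = [:0, 2:]" and P: "F - [:0, 1:] = [:c, -1, 1:]"
    by (simp_all add: F_def pderiv_pCons)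
  have "psum 2 (spec F) = (\<Sum>z\<in>#proots (F - [:0, 1:]). poly (pderiv F ^ 2) z)"
    using psum_spec[of 1 F] by (simp only: numeral_2_eq_2 One_nat_def)
  also have "\<dots> = resid (F - [:0, 1:]) (pderiv F ^ 2 * (pderiv F - 1))"
    by (rule sum_roots_resid[OF F])
  also have "\<dots> = coeff [:- 4 * c, 4 - 8 * c:] (degree (F - [:0, 1:]) - 1)"
    by (rule resid_eq_coeffI[of _ "[:4, 8:]"])
      (simp_all add: P dF power2_eq_square one_pCons)
  also have "\<dots> = 4 - 8 * c" by (simp add: P)
  finally show ?thesis by (simp add: F_def)
qed

lemma resid_cong_power:
  fixes G :: "'a::field poly"
  assumes "h = q * G + r"
  shows "resid G (u * h) = resid G (u * r)" "resid G (h ^ n) = resid G (r ^ n)"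
proof -
  have d: "G dvd h - r" using assms by simp
  hence "G dvd u * h - u * r" by (simp flip: right_diff_distrib)
  thus "resid G (u * h) = resid G (u * r)" by (rule resid_cong)
  have "h mod G = r mod G" using d by (simp add: mod_eq_dvd_iff)
  hence "h ^ n mod G = r ^ n mod G" by (metis power_mod)
  thus "resid G (h ^ n) = resid G (r ^ n)" by (simp add: resid_def)
qed

text \<open>If the coefficient of \<open>z ^ (k - i)\<close> has weight \<open>i\<close>, the
  residue of \<open>P' ^ m\<close> is isobaric of weight \<open>(m - 1) * (k - 1)\<close>. For
  \<open>k = 3\<close> weight \<open>4\<close> offers only \<open>a\<^sup>2\<close>, so
  \<open>b\<^sup>2\<close> first appears with \<open>P' ^ 4\<close>.\<close>

lemma residues_cubic:
  fixes a b :: "'a::field_char_0"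
  defines "P \<equiv> [:b, a, 0, 1:]"
  shows "resid P (pderiv P ^ 2) = - 3 * a" "resid P (pderiv P ^ 4) = 81 * b\<^sup>2 - 15 * a ^ 3"
proof -
  have dP: "pderiv P = [:a, 0, 3:]" by (simp add: P_def pderiv_pCons)
  have r2: "pderiv P ^ 2 = [:0, 9:] * P + [:a\<^sup>2, - 9 * b, - 3 * a:]"
    unfolding dP by (simp add: P_def power2_eq_square)
  have "resid P (pderiv P ^ 2) = coeff [:a\<^sup>2, - 9 * b, - 3 * a:] (degree P - 1)"
    by (rule resid_eq_coeffI[OF r2]) (simp add: P_def)
  thus "resid P (pderiv P ^ 2) = - 3 * a" by (simp add: P_def numeral_2_eq_2)
  have "resid P (pderiv P ^ 4) = resid P ((pderiv P ^ 2) ^ 2)" by (simp flip: power_mult)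
  also have "\<dots> = resid P ([:a\<^sup>2, - 9 * b, - 3 * a:] ^ 2)" by (rule resid_cong_power[OF r2])
  also have "\<dots> = coeff [:a ^ 4 - 54 * a * b * b, - 18 * a\<^sup>2 * b - 54 * a\<^sup>2 * b - 9 * a\<^sup>2 * b,
      81 * b\<^sup>2 - 15 * a ^ 3:] (degree P - 1)"
    by (rule resid_eq_coeffI[of _ "[:54 * a * b, 9 * a\<^sup>2:]"])
      (simp_all add: P_def power2_eq_square algebra_simps eval_nat_numeral)
  also have "\<dots> = 81 * b\<^sup>2 - 15 * a ^ 3" by (simp add: P_def numeral_2_eq_2)
  finally show "resid P (pderiv P ^ 4) = 81 * b\<^sup>2 - 15 * a ^ 3" .
qed

lemma residues_quartic:
  fixes a b c :: "'a::field_char_0"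
  defines "P \<equiv> [:c, b, a, 0, 1:]"
  shows "resid P (pderiv P ^ 2) = - 8 * b"
    "resid P (pderiv P ^ 3) = - 8 * a ^ 3 + 32 * a * c + 28 * b\<^sup>2"
proof -
  have dP: "pderiv P = [:b, 2 * a, 0, 4:]" by (simp add: P_def pderiv_pCons)
  have r2: "pderiv P ^ 2 = [:0, 0, 16:] * P + [:b\<^sup>2, 4 * a * b, 4 * a\<^sup>2 - 16 * c, - 8 * b:]"
    unfolding dP by (simp add: P_def power2_eq_square)
  have "resid P (pderiv P ^ 2) = coeff [:b\<^sup>2, 4 * a * b, 4 * a\<^sup>2 - 16 * c, - 8 * b:] (degree P - 1)"
    by (rule resid_eq_coeffI[OF r2]) (simp add: P_def)
  thus "resid P (pderiv P ^ 2) = - 8 * b" by (simp add: P_def numeral_3_eq_3)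
  have "resid P (pderiv P ^ 3) = resid P (pderiv P * (pderiv P ^ 2))"
    by (simp add: power2_eq_square power3_eq_cube mult.assoc)
  also have "\<dots> = resid P (pderiv P * [:b\<^sup>2, 4 * a * b, 4 * a\<^sup>2 - 16 * c, - 8 * b:])"
    by (rule resid_cong_power[OF r2])
  also have "\<dots> = coeff [:b ^ 3 - 32 * a * b * c, - 26 * a * b\<^sup>2 - 16 * a\<^sup>2 * c + 64 * c\<^sup>2,
      - 36 * a\<^sup>2 * b + 80 * b * c, - 8 * a ^ 3 + 32 * a * c + 28 * b\<^sup>2:] (degree P - 1)"
    by (rule resid_eq_coeffI[of _ "[:32 * a * b, 16 * a\<^sup>2 - 64 * c, - 32 * b:]"])
      (simp_all add: dP, simp_all add: P_def algebra_simps eval_nat_numeral)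
  also have "\<dots> = - 8 * a ^ 3 + 32 * a * c + 28 * b\<^sup>2" by (simp add: P_def numeral_3_eq_3)
  finally show "resid P (pderiv P ^ 3) = - 8 * a ^ 3 + 32 * a * c + 28 * b\<^sup>2" .
qed

lemma second_iterate_quartic:
  fixes a b c :: "'a::{alg_closed_field, field_char_0}"
  defines "F \<equiv> [:c, b, a, 0, 1:]"
  shows "16 + psum 1 (spec (F \<circ>\<^sub>p F)) + psum 2 (spec (F \<circ>\<^sub>p F)) =
    (- 8 * a ^ 3 + 32 * a * c + 28 * b\<^sup>2)\<^sup>2 + 6400 * b\<^sup>2 + 4096 + b * (2304 * a ^ 3 - 5120 * a * c)"
proof -
  \<comment> \<open>The digits of \<open>F' ^ 3\<close> in base \<open>F\<close>, found by dividing
    by \<open>F\<close> twice. The last one is \<open>64 * z\<close> because the leading term of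
    \<open>F' ^ 3\<close> is \<open>64 * z ^ 9\<close>.\<close>
  define A0 where "A0 = [:- 32 * a * b * c + b ^ 3, - 16 * a\<^sup>2 * c - 26 * a * b\<^sup>2 + 64 * c\<^sup>2,
    - 36 * a\<^sup>2 * b + 80 * b * c, - 8 * a ^ 3 + 32 * a * c + 28 * b\<^sup>2:]"
  define A1 where "A1 = [:32 * a * b, 16 * a\<^sup>2 - 128 * c, - 80 * b, - 32 * a:]"
  define A2 where "A2 = [:0, 64 :: 'a:]"
  have mc: "monic_centered 4 F" by (simp add: monic_centered_def F_def numeral_3_eq_3)
  have dF: "pderiv F = [:b, 2 * a, 0, 4:]" by (simp add: F_def pderiv_pCons)
  have adic: "pderiv F ^ 3 = A0 + A1 * F + A2 * F ^ 2"
    unfolding dF by (simp add: F_def A0_def A1_def A2_def algebra_simps eval_nat_numeral)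
  have "degree A0 < 4" "degree A1 < 4" "degree A2 < 4" by (simp_all add: A0_def A1_def A2_def)
  from resid_second_iterate[OF mc order_refl adic this] show ?thesis
    by (simp add: A0_def A1_def A2_def F_def eval_nat_numeral algebra_simps)
qed

lemma spec_relations:
  fixes F :: "'a::{alg_closed_field, field_char_0} poly"
  assumes F: "monic_centered k F" and k: "k \<ge> 2"
  defines "p \<equiv> \<lambda>m. fix_psum m (sigma_poly k F)" and "P \<equiv> F - [:0, 1:]"
  shows "resid P (pderiv P ^ 2) = p 1 - of_nat k"
    and "resid P (pderiv P ^ 3) = p 2 - 2 * p 1 + of_nat k"
    and "resid P (pderiv P ^ 4) = p 3 - 3 * p 2 + 3 * p 1 - of_nat k"
    and "k \<ge> 4 \<Longrightarrow> resid P (pderiv P ^ 6) = p 5 - 5 * p 4 + 10 * p 3 - 10 * p 2 + 5 * p 1 - of_nat k"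
proof -
  have "degree F = k" "lead_coeff F = 1" using F by (auto simp: monic_centered_def)
  note r = resid_pderiv_power[OF this(1) k this(2), folded P_def]
  show "resid P (pderiv P ^ 2) = p 1 - of_nat k" "resid P (pderiv P ^ 3) = p 2 - 2 * p 1 + of_nat k"
    "resid P (pderiv P ^ 4) = p 3 - 3 * p 2 + 3 * p 1 - of_nat k"
    "k \<ge> 4 \<Longrightarrow> resid P (pderiv P ^ 6) = p 5 - 5 * p 4 + 10 * p 3 - 10 * p 2 + 5 * p 1 - of_nat k"
    using r k by (simp_all add: p_def fix_psum_sigma_poly)
qed

lemma generic_injectivity_degree_2:
  "\<exists>U :: 'a::{alg_closed_field, field_char_0} list set. U \<noteq> {} \<and>
    open_dense_in ((2 + 1) + (2\<^sup>2 + 1)) (tau2 2 ` poly_moduli 2) U \<and>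
    (\<forall>Q\<in>U. \<exists>!c. c \<in> poly_moduli 2 \<and> tau2 2 c = Q)"
proof (rule generic_injectivity_criterion[where D = "\<lambda>_. 1"])
  show "monic_centered 2 [:0, 0, 1 :: 'a:]" by (simp add: monic_centered_def)
  fix F F' :: "'a poly"
  assume F: "monic_centered 2 F" "monic_centered 2 F'" and eq: "sigma_poly 2 F = sigma_poly 2 F'"
  obtain c c' where c: "F = [:c, 0, 1:]" "F' = [:c', 0, 1:]" using F by (metis monic_centered_2)
  have "4 - 8 * c = 4 - 8 * c'"
    unfolding psum_quadratic[symmetric] c[symmetric]
    using eq fix_psum_sigma_poly[of 2 2 F] fix_psum_sigma_poly[of 2 2 F'] by simp
  thus "pclass 2 F = pclass 2 F'" using c by simp
qed (auto intro: regular.const)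

text \<open>The first spectrum gives \<open>a\<close> and \<open>b\<^sup>2\<close>, and the sign of
  \<open>b\<close> is changed by conjugation with \<open>z \<mapsto> - z\<close>. The map is thus
  injective everywhere, and \<open>D\<close> can be constant.\<close>

lemma generic_injectivity_degree_3:
  "\<exists>U :: 'a::{alg_closed_field, field_char_0} list set. U \<noteq> {} \<and>
    open_dense_in ((3 + 1) + (3\<^sup>2 + 1)) (tau2 3 ` poly_moduli 3) U \<and>
    (\<forall>Q\<in>U. \<exists>!c. c \<in> poly_moduli 3 \<and> tau2 3 c = Q)"
proof (rule generic_injectivity_criterion[where D = "\<lambda>_. 1"])
  show "monic_centered 3 [:0, 0, 0, 1 :: 'a:]" by (simp add: monic_centered_def numeral_2_eq_2)
  fix F F' :: "'a poly"
  assume F: "monic_centered 3 F" "monic_centered 3 F'" and eq: "sigma_poly 3 F = sigma_poly 3 F'"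
  obtain a b a' b' where ab: "F = [:b, a, 0, 1:]" "F' = [:b', a', 0, 1:]" using F by (metis monic_centered_3)
  have P: "F - [:0, 1:] = [:b, a - 1, 0, 1:]" "F' - [:0, 1:] = [:b', a' - 1, 0, 1:]"
    by (simp_all add: ab)
  note s = spec_relations[OF F(1), unfolded P residues_cubic] spec_relations[OF F(2), unfolded P residues_cubic]
  have "- 3 * (a - 1) = - 3 * (a' - 1)" by (simp only: s(1) s(5) eq)
  hence a: "a = a'" by simp
  have "81 * b\<^sup>2 - 15 * (a - 1) ^ 3 = 81 * b'\<^sup>2 - 15 * (a' - 1) ^ 3" using s(3,7) eq by simp
  hence "b\<^sup>2 = b'\<^sup>2" using a by simp
  hence "b' = b \<or> b' = - b" using power2_eq_iff by metis
  thus "pclass 3 F = pclass 3 F'"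
  proof
    assume b: "b' = - b"
    show ?thesis
    proof (rule pclass_scale[where w = "- 1"])
      fix i :: nat assume "i \<le> 3"
      hence "i = 0 \<or> i = 1 \<or> i = 2 \<or> i = 3" by arith
      thus "- 1 * coeff F' i = (- 1) ^ i * coeff F i"
        unfolding ab by (elim disjE) (simp_all add: a b eval_nat_numeral)
    qed (simp_all add: ab)
  qed (simp add: ab a)
qed (auto intro: regular.const)

lemma generic_injectivity_degree_4:
  "\<exists>U :: 'a::{alg_closed_field, field_char_0} list set. U \<noteq> {} \<and>
    open_dense_in ((4 + 1) + (4\<^sup>2 + 1)) (tau2 4 ` poly_moduli 4) U \<and>
    (\<forall>Q\<in>U. \<exists>!c. c \<in> poly_moduli 4 \<and> tau2 4 c = Q)"
proof -
  \<comment> \<open>\<open>\<beta>\<close> recovers \<open>b\<close>. The residues of the first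
    spectrum belong to \<open>F(z) - z\<close>, with linear coefficient \<open>b - 1\<close>, the
    one of the second iterate to \<open>F\<close> itself: hence
    \<open>28 * (\<beta> Q - 1)\<^sup>2\<close> in \<open>s\<close> but
    \<open>28 * (\<beta> Q)\<^sup>2\<close> in \<open>t\<close>.\<close>
  define \<beta> where "\<beta> = (\<lambda>Q :: 'a list. 1 - (fix_psum 1 Q - 4) / 8)"
  define s where "s = (\<lambda>Q :: 'a list. fix_psum 2 Q - 2 * fix_psum 1 Q + 4 - 28 * (\<beta> Q - 1)\<^sup>2)"
  define t where "t = (\<lambda>Q :: 'a list. 16 + per_psum 4 1 Q + per_psum 4 2 Q - (s Q + 28 * (\<beta> Q)\<^sup>2)\<^sup>2
    - 6400 * (\<beta> Q)\<^sup>2 - 4096)"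
  \<comment> \<open>The factor \<open>160\<close> cancels the terms in \<open>a b c\<close>, as
    \<open>160 * 32 = 5120\<close>. Where \<open>D\<close> is nonzero, \<open>a\<close> and
    \<open>b\<close> are nonzero and \<open>a ^ 3\<close> and \<open>a c\<close> are
    determined.\<close>
  define D where "D = (\<lambda>Q. t Q + 160 * \<beta> Q * s Q)"
  have val: "\<beta> (sigma_poly 4 F) = b" "s (sigma_poly 4 F) = - 8 * a ^ 3 + 32 * a * c"
      "t (sigma_poly 4 F) = b * (2304 * a ^ 3 - 5120 * a * c)"
      "D (sigma_poly 4 F) = 1024 * b * a ^ 3"
    if F: "F = [:c, b, a, 0, 1:]" for F :: "'a poly" and a b c
  proof -
    have mc: "monic_centered 4 F" by (simp add: monic_centered_def F numeral_3_eq_3)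
    have P: "F - [:0, 1:] = [:c, b - 1, a, 0, 1:]" by (simp add: F)
    note r = spec_relations[OF mc, unfolded P residues_quartic]
    show \<beta>: "\<beta> (sigma_poly 4 F) = b" using r(1) by (simp add: \<beta>_def field_simps)
    show s: "s (sigma_poly 4 F) = - 8 * a ^ 3 + 32 * a * c"
      unfolding s_def \<beta> using r(2) by (simp add: algebra_simps)
    show t: "t (sigma_poly 4 F) = b * (2304 * a ^ 3 - 5120 * a * c)"
    proof -
      have "per_psum 4 1 (sigma_poly 4 F) = psum 1 (spec (F \<circ>\<^sub>p F))"
        "per_psum 4 2 (sigma_poly 4 F) = psum 2 (spec (F \<circ>\<^sub>p F))"
        by (rule per_psum_sigma_poly; simp)+
      thus ?thesis
        by (simp only: t_def \<beta> s second_iterate_quartic[of c b a, folded F]) simp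
    qed
    show "D (sigma_poly 4 F) = 1024 * b * a ^ 3"
      by (simp add: D_def \<beta> s t algebra_simps)
  qed
  show ?thesis
  proof (rule generic_injectivity_criterion[where D = D])
    have "\<beta> \<in> regular_funs ((4 + 1) + (4\<^sup>2 + 1))"
      unfolding \<beta>_def by (intro regular.intros regular_fix_psum) auto
    moreover from this have "s \<in> regular_funs ((4 + 1) + (4\<^sup>2 + 1))"
      unfolding s_def by (intro regular.intros regular_fix_psum) auto
    ultimately show "D \<in> regular_funs ((4 + 1) + (4\<^sup>2 + 1))"
      unfolding D_def t_def by (intro regular.intros regular_per_psum) auto
    show "monic_centered 4 [:0, 1, 1, 0, 1 :: 'a:]" by (simp add: monic_centered_def numeral_3_eq_3)
    show "D (sigma_poly 4 [:0, 1, 1, 0, 1:]) \<noteq> 0" using val(4)[OF refl] by simp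
    fix F F' :: "'a poly"
    assume F: "monic_centered 4 F" "monic_centered 4 F'"
      and D: "D (sigma_poly 4 F) \<noteq> 0" and eq: "sigma_poly 4 F = sigma_poly 4 F'"
    obtain a b c a' b' c' where abc: "F = [:c, b, a, 0, 1:]" "F' = [:c', b', a', 0, 1:]"
      using F by (metis monic_centered_4)
    note v = val[OF abc(1)] and v' = val[OF abc(2), folded eq]
    have b: "b' = b" using v(1) v'(1) by simp
    have nz: "a \<noteq> 0" "b \<noteq> 0" using D v(4) by auto
    have a3: "a' ^ 3 = a ^ 3" using v(4) v'(4) b nz by simp
    hence ac: "a' * c' = a * c" using v(2) v'(2) by simp
    define w where "w = a' / a"
    have w: "w ^ 3 = 1" "a' = w * a" using a3 nz by (simp_all add: w_def power_divide)
    hence w0: "w \<noteq> 0" by auto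
    have wc: "w * c' = c" using ac nz by (simp add: w(2) ac_simps)
    show "pclass 4 F = pclass 4 F'"
    proof (rule pclass_scale[where w = w])
      fix i :: nat assume "i \<le> 4"
      hence "i = 0 \<or> i = 1 \<or> i = 2 \<or> i = 3 \<or> i = 4" by arith
      moreover have "w ^ 4 = w" using w(1) by (simp add: eval_nat_numeral)
      ultimately show "w * coeff F' i = w ^ i * coeff F i"
        unfolding abc by (elim disjE) (simp_all add: b wc w(2), simp_all add: eval_nat_numeral)
    qed (simp_all add: abc w0)
  qed simp
qed

section \<open>Degree five\<close>

text \<open>
  The residues of \<open>P'\<^sup>3\<close>, \<open>P'\<^sup>4\<close>, \<open>P'\<^sup>6\<close> modulo \<open>P = z\<^sup>5 + a z\<^sup>3 + b z\<^sup>2 + c z + d\<close>, named by their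
  weights, and the residue of \<open>((F \<circ> F)')\<^sup>3\<close> for the second iterate of the polynomial \<open>F\<close> with
  coefficients \<open>a\<close>, \<open>b\<close>, \<open>c\<close>, \<open>d\<close>.
\<close>

abbreviation (input) quintic_k8 where
  "quintic_k8 a b c d \<equiv> 8 * a ^ 4 - 48 * a ^ 2 * c - 54 * a * b ^ 2 + 100 * b * d + 65 * c
    ^ 2"

abbreviation (input) quintic_k12 where
  "quintic_k12 a b c d \<equiv> 16 * a ^ 6 - 144 * a ^ 4 * c - 312 * a ^ 3 * b ^ 2 + 720 * a ^ 2 *
    b * d + 384 * a ^ 2 * c ^ 2 + 864 * a * b ^ 2 * c - 375 * a * d ^ 2 + 81 * b ^ 4 - 1350 * b
    * c * d - 255 * c ^ 3"

abbreviation (input) quintic_k20 where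
  "quintic_k20 a b c d \<equiv> 64 * a ^ 10 - 960 * a ^ 8 * c - 4080 * a ^ 7 * b ^ 2 + 10400 * a ^
    6 * b * d + 5440 * a ^ 6 * c ^ 2 + 35040 * a ^ 5 * b ^ 2 * c - 6960 * a ^ 5 * d ^ 2 + 15660
    * a ^ 4 * b ^ 4 - 80160 * a ^ 4 * b * c * d - 14080 * a ^ 4 * c ^ 3 - 58320 * a ^ 3 * b ^ 3
    * d - 92160 * a ^ 3 * b ^ 2 * c ^ 2 + 48000 * a ^ 3 * c * d ^ 2 - 50220 * a ^ 2 * b ^ 4 * c
    + 81000 * a ^ 2 * b ^ 2 * d ^ 2 + 172800 * a ^ 2 * b * c ^ 2 * d + 15360 * a ^ 2 * c ^ 4 -
    3645 * a * b ^ 6 + 129600 * a * b ^ 3 * c * d + 69120 * a * b ^ 2 * c ^ 3 - 50000 * a * b *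
    d ^ 3 - 80625 * a * c ^ 2 * d ^ 2 + 7290 * b ^ 5 * d + 19440 * b ^ 4 * c ^ 2 - 101250 * b ^
    2 * c * d ^ 2 - 74250 * b * c ^ 3 * d - 4095 * c ^ 5 + 15625 * d ^ 4"

abbreviation (input) quintic_q where
  "quintic_q a b c d \<equiv> (quintic_k8 a b c d)\<^sup>2 + (60 * a ^ 2 - 175 * c)\<^sup>2 +
    15625 - 200 * b * (44 * a ^ 3 * b - 60 * a ^ 2 * d - 144 * a * b * c - 27 * b ^ 3 + 175 * c
    * d)"

lemma resid_quintic_square:
  fixes a b c d :: "'a::field_char_0"
  shows "resid [:d, c, b, a, 0, 1:] ([:r0, r1, r2, r3, r4:] ^ 2) =
    2 * r0 * r4 + 2 * r1 * r3 + r2 ^ 2 - a * (2 * r2 * r4 + r3 ^ 2) - 2 * b * r3 * r4 + (a ^ 2 - c) * r4 ^ 2"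
    (is "resid ?P _ = _")
proof -
  \<comment> \<open>The coefficients of the square in degrees \<open>5\<close> to \<open>8\<close>;
    \<open>q0\<close> and \<open>q1\<close> are the two lower coefficients of the quotient by the
    quintic.\<close>
  define h5 h6 h7 h8 where "h5 = 2 * r1 * r4 + 2 * r2 * r3" and "h6 = 2 * r2 * r4 + r3 ^ 2"
    and "h7 = 2 * r3 * r4" and "h8 = r4 ^ 2"
  note h = h5_def h6_def h7_def h8_def
  define q0 q1 where "q0 = h5 - a * h7 - b * h8" and "q1 = h6 - a * h8"
  have "[:r0, r1, r2, r3, r4:] ^ 2 = [:q0, q1, h7, h8:] * ?P +
    [:r0 ^ 2 - q0 * d, 2 * r0 * r1 - q0 * c - q1 * d, 2 * r0 * r2 + r1 ^ 2 - q0 * b - q1 * c - h7 * d,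
      2 * r0 * r3 + 2 * r1 * r2 - q0 * a - q1 * b - h7 * c - h8 * d,
      2 * r0 * r4 + 2 * r1 * r3 + r2 ^ 2 - q1 * a - h7 * b - h8 * c:]"
    by (simp add: power2_eq_square q0_def q1_def) (simp add: h algebra_simps power2_eq_square)
  from resid_eq_coeffI[OF this] show ?thesis
    by (simp add: eval_nat_numeral) (simp add: q1_def h algebra_simps power2_eq_square)
qed

text \<open>\<open>u\<close> and \<open>v\<close> are the remainders of \<open>P' ^ 2\<close> and
  \<open>P' ^ 3\<close>, so the residues of \<open>P' ^ 4\<close> and \<open>P' ^ 6\<close> are
  those of squares of polynomials of degree at most four.\<close>

lemma residues_quintic:
  fixes a b c d :: "'a::field_char_0"
  defines "P \<equiv> [:d, c, b, a, 0, 1:]"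
  shows "resid P (pderiv P ^ 2) = 4 * a ^ 2 - 15 * c"
    "resid P (pderiv P ^ 3) = quintic_k8 a b c d"
    "resid P (pderiv P ^ 4) = quintic_k12 a b c d"
    "resid P (pderiv P ^ 6) = quintic_k20 a b c d"
proof -
  define u where "u = [:5 * b * d + c ^ 2, - 5 * a * d + 9 * b * c, a * c + 9 * b ^ 2, 12 * a * b
    - 25 * d, 4 * a ^ 2 - 15 * c:]"
  define v where "v = [:36 * a ^ 2 * b * d - 25 * a * d ^ 2 - 85 * b * c * d + c ^ 3, 8 * a ^ 3 *
    d + 36 * a ^ 2 * b * c - 65 * a * c * d - 35 * b ^ 2 * d - 79 * b * c ^ 2, 8 * a ^ 3 * c +
    36 * a ^ 2 * b ^ 2 - 80 * a * b * d - 31 * a * c ^ 2 - 108 * b ^ 2 * c + 125 * d ^ 2, 44 * a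
    ^ 3 * b - 60 * a ^ 2 * d - 144 * a * b * c - 27 * b ^ 3 + 175 * c * d, quintic_k8 a b c d:]"
  have dP: "pderiv P = [:c, 2 * b, 3 * a, 0, 5:]" by (simp add: P_def pderiv_pCons)
  have u: "pderiv P ^ 2 = [:- 5 * b, 5 * a, 0, 25:] * P + u"
    unfolding dP by (simp add: P_def u_def power2_eq_square)
  have v: "pderiv P * u = [:- 36 * a ^ 2 * b + 25 * a * d + 90 * b * c, - 8 * a ^ 3 + 35 * a * c +
    45 * b ^ 2, 60 * a * b - 125 * d, 20 * a ^ 2 - 75 * c:] * P + v"
    unfolding dP by (simp add: P_def u_def v_def, simp add: algebra_simps eval_nat_numeral)
  have deg: "degree u < degree P" "degree v < degree P" by (simp_all add: u_def v_def P_def)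
  show "resid P (pderiv P ^ 2) = 4 * a ^ 2 - 15 * c"
    using resid_eq_coeffI[OF u deg(1)] by (simp add: P_def u_def eval_nat_numeral)
  have "resid P (pderiv P * pderiv P ^ 2) = resid P (pderiv P * u)" by (rule resid_cong_power[OF u])
  also have "\<dots> = coeff v (degree P - 1)" by (rule resid_eq_coeffI[OF v deg(2)])
  finally show "resid P (pderiv P ^ 3) = quintic_k8 a b c d"
    by (simp add: P_def v_def eval_nat_numeral)
  have "resid P ((pderiv P ^ 2) ^ 2) = resid P (u ^ 2)" by (rule resid_cong_power[OF u])
  thus "resid P (pderiv P ^ 4) = quintic_k12 a b c d"
    unfolding power_mult[symmetric] unfolding P_def u_def resid_quintic_square
    by (simp add: algebra_simps eval_nat_numeral)
  have "pderiv P ^ 3 = pderiv P * pderiv P ^ 2" by (simp add: eval_nat_numeral)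
  also have "\<dots> = (pderiv P * [:- 5 * b, 5 * a, 0, 25:] + [:- 36 * a ^ 2 * b + 25 * a * d + 90 * b * c, - 8 * a ^ 3 + 35 * a * c + 45 * b ^ 2, 60 * a * b
      - 125 * d, 20 * a ^ 2 - 75 * c:]) * P + v"
    unfolding u distrib_left v by (simp only: ring_distribs ac_simps)
  finally have v3: "pderiv P ^ 3 = (pderiv P * [:- 5 * b, 5 * a, 0, 25:] + [:- 36 * a ^ 2 * b + 25 * a * d + 90 * b * c, - 8 * a ^ 3 + 35 * a * c + 45 * b ^ 2, 60 * a * b
      - 125 * d, 20 * a ^ 2 - 75 * c:]) * P + v" .
  have "resid P ((pderiv P ^ 3) ^ 2) = resid P (v ^ 2)" by (rule resid_cong_power[OF v3])
  thus "resid P (pderiv P ^ 6) = quintic_k20 a b c d"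
    unfolding power_mult[symmetric] unfolding P_def v_def resid_quintic_square
    by (simp add: algebra_simps eval_nat_numeral)
qed

lemma second_iterate_quintic:
  fixes a b c d :: "'a::{alg_closed_field, field_char_0}"
  defines "F \<equiv> [:d, c, b, a, 0, 1:]"
  shows "25 + psum 1 (spec (F \<circ>\<^sub>p F)) + psum 2 (spec (F \<circ>\<^sub>p F)) =
    quintic_q a b c d"
proof -
  \<comment> \<open>The digits of \<open>F' ^ 3\<close> in base \<open>F\<close>; \<open>A0\<close>
    is the remainder of the cube given by the same formula as for the residues above.\<close>
  define A0 where "A0 = [:36 * a ^ 2 * b * d - 25 * a * d ^ 2 - 85 * b * c * d + c ^ 3, 8 * a ^ 3
    * d + 36 * a ^ 2 * b * c - 65 * a * c * d - 35 * b ^ 2 * d - 79 * b * c ^ 2, 8 * a ^ 3 * c +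
    36 * a ^ 2 * b ^ 2 - 80 * a * b * d - 31 * a * c ^ 2 - 108 * b ^ 2 * c + 125 * d ^ 2, 44 * a
    ^ 3 * b - 60 * a ^ 2 * d - 144 * a * b * c - 27 * b ^ 3 + 175 * c * d, quintic_k8 a b c d:]"
  define A1 where "A1 = [:- 36 * a ^ 2 * b + 50 * a * d + 85 * b * c, - 8 * a ^ 3 + 65 * a * c +
    35 * b ^ 2, 80 * a * b - 250 * d, 60 * a ^ 2 - 175 * c, - 100 * b:]"
  define A2 where "A2 = [:- 25 * a, 0, 125:]"
  have mc: "monic_centered 5 F" by (simp add: monic_centered_def F_def eval_nat_numeral)
  have dF: "pderiv F = [:c, 2 * b, 3 * a, 0, 5:]" by (simp add: F_def pderiv_pCons)
  have adic: "pderiv F ^ 3 = A0 + A1 * F + A2 * F ^ 2"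
    unfolding dF by (simp add: F_def A0_def A1_def A2_def algebra_simps eval_nat_numeral)
  have "degree A0 < 5" "degree A1 < 5" "degree A2 < 5" by (simp_all add: A0_def A1_def A2_def)
  from resid_second_iterate[OF mc _ adic this] show ?thesis
    by (simp add: A0_def A1_def A2_def F_def eval_nat_numeral algebra_simps)
qed

text \<open>
  Write \<open>z\<^sup>5 + a z\<^sup>3 + b z\<^sup>2 + (c + 1) z + d\<close> for the polynomial.  The invariants of the scaling
  action are expressed by \<open>T = 4 c - a\<^sup>2\<close>, \<open>x = 3 a b\<^sup>2 + 20 T\<^sup>2\<close> and the known quantities \<open>e\<close>,
  \<open>k8\<close>, \<open>k12\<close>, \<open>k20\<close> (residues of powers of \<open>P'\<close>) and \<open>q\<close> (from the second iterate): \<open>b d\<close>, \<open>a d\<^sup>2\<close>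
  and \<open>b\<^sup>4\<close> are linear in \<open>x\<close> with coefficients in \<open>T\<close>, and the two relations
  \<open>a\<^sup>2 b\<^sup>4 = (a b\<^sup>2)\<^sup>2\<close>, \<open>a b\<^sup>2 \<cdot> a d\<^sup>2 = a\<^sup>2 (b d)\<^sup>2\<close> become \<open>1800 x\<^sup>2 = r0 + r1 x\<close>, \<open>g0 + g1 x = 0\<close>.
\<close>

definition quintic_Y0 :: "'a::field_char_0 \<Rightarrow> 'a \<Rightarrow> 'a poly" where
  "quintic_Y0 e k8 = [:- (e ^ 2) + k8, 8 * e, - 320:]"

definition quintic_W0 :: "'a::field_char_0 \<Rightarrow> 'a \<Rightarrow> 'a \<Rightarrow> 'a poly" where
  "quintic_W0 e k8 q = [:390 * e ^ 3 - 25257 * e ^ 2 - 18 * e * k8 + 92430 * e - 3 * k8 ^ 2 + 660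
    * k8 + 3 * q - 151425, - 1920 * e ^ 2 - 144000 * e + 288000, - 12800 * e, 48000:]"

definition quintic_W1 :: "'a::field_char_0 \<Rightarrow> 'a poly" where
  "quintic_W1 e = [:- 620 * e - 9900, - 4800:]"

definition quintic_Z0 :: "'a::field_char_0 \<Rightarrow> 'a \<Rightarrow> 'a \<Rightarrow> 'a \<Rightarrow> 'a poly" where
  "quintic_Z0 e k8 k12 q = [:- 2470 * e ^ 3 - 25257 * e ^ 2 + 3042 * e * k8 + 92430 * e - 3 * k8 ^
    2 + 660 * k8 - 200 * k12 + 3 * q - 151425, 14160 * e ^ 2 - 144000 * e + 10800 * k8 + 288000,
    - 374400 * e, - 1728000:]"

definition quintic_Z1 :: "'a::field_char_0 \<Rightarrow> 'a poly" where
  "quintic_Z1 e = [:28860 * e - 9900, 108000:]"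

definition quintic_r0 :: "'a::field_char_0 \<Rightarrow> 'a \<Rightarrow> 'a \<Rightarrow> 'a poly" where
  "quintic_r0 e k8 q = [:1560 * e ^ 4 - 101028 * e ^ 3 - 72 * e ^ 2 * k8 + 369720 * e ^ 2 - 12 * e
    * k8 ^ 2 + 2640 * e * k8 + 12 * e * q - 605700 * e, - 1830 * e ^ 3 - 954855 * e ^ 2 - 270 *
    e * k8 + 2538450 * e - 45 * k8 ^ 2 + 9900 * k8 + 45 * q - 2271375, - 80000 * e ^ 2 - 2160000
    * e + 4320000:]"

definition quintic_r1 :: "'a::field_char_0 \<Rightarrow> 'a poly" where
  "quintic_r1 e = [:- 2480 * e ^ 2 - 39600 * e, - 28500 * e - 148500:]"

definition quintic_g0 :: "'a::field_char_0 \<Rightarrow> 'a \<Rightarrow> 'a \<Rightarrow> 'a \<Rightarrow> 'a poly" where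
  "quintic_g0 e k8 k12 q = [:- 4200 * e ^ 5 + 99096 * e ^ 4 + 2304 * e ^ 3 * k8 + 5928408 * e ^ 3
    + 24 * e ^ 2 * k8 ^ 2 - 528 * e ^ 2 * k8 - 24 * e ^ 2 * q - 23190120 * e ^ 2 - 288 * e * k8
    ^ 2 - 174240 * e * k8 - 792 * e * q + 39976200 * e, 2850 * e ^ 4 + 2939742 * e ^ 3 - 7992 *
    e ^ 2 * k8 + 54616050 * e ^ 2 + 198 * e * k8 ^ 2 - 25740 * e * k8 - 198 * e * q - 157543650
    * e - 1080 * k8 ^ 2 - 653400 * k8 - 2970 * q + 149910750, 73750 * e ^ 3 + 24255375 * e ^ 2 -
    101250 * e * k8 + 88890750 * e + 1125 * k8 ^ 2 - 247500 * k8 + 48000 * k12 - 1125 * q -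
    228335625, 54000000 * e - 108000000:]"

definition quintic_g1 :: "'a::field_char_0 \<Rightarrow> 'a \<Rightarrow> 'a \<Rightarrow> 'a \<Rightarrow> 'a poly" where
  "quintic_g1 e k8 k12 q = [:14200 * e ^ 3 - 60204 * e ^ 2 - 2376 * e * k8 + 3722760 * e - 36 * k8
    ^ 2 + 7920 * k8 - 2400 * k12 + 36 * q - 1817100, 84000 * e ^ 2 + 806400 * e - 16200 * k8 +
    13257000, 112500 * e + 3712500:]"

text \<open>Elimination of \<open>x\<close> from the two relations, and from \<open>a\<^sup>2\<close> times the equation for \<open>k20\<close>.\<close>

definition quintic_G :: "'a::field_char_0 \<Rightarrow> 'a \<Rightarrow> 'a \<Rightarrow> 'a \<Rightarrow> 'a poly" where
  "quintic_G e k8 k12 q =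
    (let g0 = quintic_g0 e k8 k12 q; g1 = quintic_g1 e k8 k12 q
     in smult 1800 (g0 * g0) + quintic_r1 e * (g0 * g1) - quintic_r0 e k8 q * (g1 * g1))"

definition quintic_F :: "'a::field_char_0 \<Rightarrow> 'a \<Rightarrow> 'a \<Rightarrow> 'a \<Rightarrow> 'a \<Rightarrow> 'a poly" where
  "quintic_F e k8 k12 k20 q =
    (let A = [:4 * e, 15:]; C = [:e, 4:]; g0 = quintic_g0 e k8 k12 q; g = quintic_g1 e k8 k12 q;
      X = [:0, 0, - 20:] * g - g0; Y = quintic_Y0 e k8 * g - smult 18 g0;
      W = quintic_W0 e k8 q * g - quintic_W1 e * g0; Z = quintic_Z0 e k8 k12 q * g - quintic_Z1 e * g0
     in smult 23040000 (A ^ 6 * g ^ 2) - smult 345600000 (A ^ 5 * C * g ^ 2) - smult 489600000 (A ^ 4 *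
     X * g) + smult 37440000 (A ^ 4 * Y * g) + smult 1958400000 (A ^ 4 * C ^ 2 * g ^ 2) + smult
     4204800000 (A ^ 3 * C * X * g) - smult 33408 (A ^ 3 * Z * g) + smult 348000 (A ^ 3 * W * g)
     - smult 288576000 (A ^ 3 * C * Y * g) - smult 5068800000 (A ^ 3 * C ^ 3 * g ^ 2) - smult
     69984000 (A ^ 2 * X * Y) - smult 11059200000 (A ^ 2 * C ^ 2 * X * g) + smult 230400 (A ^ 2
     * C * Z * g) - smult 1116000 (A ^ 2 * C * W * g) + smult 2916000 (A ^ 2 * Y * Y) + smult
     622080000 (A ^ 2 * C ^ 2 * Y * g) + smult 5529600000 (A ^ 2 * C ^ 4 * g ^ 2) - smult 27000
     (A * X * W) + smult 155520000 (A * C * X * Y) + smult 8294400000 (A * C ^ 3 * X * g) -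
     smult 2400 (A * Y * Z) - smult 387000 (A * C ^ 2 * Z * g) + smult 1620 (A * W * Y) + smult
     432000 (A * C ^ 2 * W * g) - smult 3645000 (A * C * Y * Y) - smult 267300000 (A * C ^ 3 * Y
     * g) - smult 1474200000 (A * C ^ 5 * g ^ 2) + smult 1 (Z * Z) - smult (360000 * k20) (A * g
     ^ 2))"

text \<open>\<open>T\<close> is chosen such that \<open>a\<^sup>2\<close> and \<open>c\<close> are
  both linear in it. The shift by \<open>20 * T\<^sup>2\<close> in \<open>x\<close> makes the terms
  of degrees four and three in \<open>T\<close> cancel in \<open>quintic_r0\<close>. In
  \<open>q\<close> the linear coefficient is \<open>c + 1\<close>, since \<open>q\<close> belongs to
  \<open>F\<close> and not to \<open>F(z) - z\<close>.\<close>

lemma quintic_relations: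
  fixes a b c d :: "'a::field_char_0"
  assumes e: "e = 4 * a ^ 2 - 15 * c"
    and k8: "k8 = quintic_k8 a b c d"
    and k12: "k12 = quintic_k12 a b c d"
    and q: "q = quintic_q a b (c + 1) d"
  defines "T \<equiv> 4 * c - a\<^sup>2"
  defines "x \<equiv> 3 * a * b\<^sup>2 + 20 * T\<^sup>2"
  shows "a\<^sup>2 = 15 * T + 4 * e" "c = 4 * T + e"
    and "100 * (b * d) = poly (quintic_Y0 e k8) T + 18 * x"
    and "16200 * b ^ 4 = poly (quintic_W0 e k8 q) T + poly (quintic_W1 e) T * x"
    and "75000 * (a * d\<^sup>2) = poly (quintic_Z0 e k8 k12 q) T + poly (quintic_Z1 e) T * x"
    and "1800 * x\<^sup>2 = poly (quintic_r0 e k8 q) T + poly (quintic_r1 e) T * x"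
    and "poly (quintic_g0 e k8 k12 q) T + poly (quintic_g1 e k8 k12 q) T * x = 0"
proof -
  show A: "a\<^sup>2 = 15 * T + 4 * e" and "c = 4 * T + e" by (simp_all add: e T_def algebra_simps)
  show Y: "100 * (b * d) = poly (quintic_Y0 e k8) T + 18 * x"
    unfolding quintic_Y0_def x_def T_def e k8 by (simp, algebra)
  show W: "16200 * b ^ 4 = poly (quintic_W0 e k8 q) T + poly (quintic_W1 e) T * x"
    unfolding quintic_W0_def quintic_W1_def x_def T_def e k8 q by (simp, algebra)
  show Z: "75000 * (a * d\<^sup>2) = poly (quintic_Z0 e k8 k12 q) T + poly (quintic_Z1 e) T * x"
    unfolding quintic_Z0_def quintic_Z1_def x_def T_def e k8 k12 q by (simp, algebra)
  have r: "poly (quintic_r0 e k8 q) T = (15 * T + 4 * e) * poly (quintic_W0 e k8 q) T - 720000 * T ^ 4"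
    "poly (quintic_r1 e) T = (15 * T + 4 * e) * poly (quintic_W1 e) T + 72000 * T\<^sup>2"
    unfolding quintic_r0_def quintic_r1_def quintic_W0_def quintic_W1_def by (simp, algebra)+
  have "1800 * x\<^sup>2 = a\<^sup>2 * (16200 * b ^ 4) + 72000 * T\<^sup>2 * x - 720000 * T ^ 4"
    unfolding x_def by algebra
  thus R: "1800 * x\<^sup>2 = poly (quintic_r0 e k8 q) T + poly (quintic_r1 e) T * x"
    unfolding A W r by (simp add: algebra_simps)
  \<comment> \<open>The relation between \<open>a b\<^sup>2\<close>, \<open>a d\<^sup>2\<close> and
    \<open>b d\<close>, scaled by \<open>2 * 3 * 75000 = 45 * 100\<^sup>2\<close> to match the
    normalizations.\<close>
  have "2 * (3 * a * b\<^sup>2) * (75000 * (a * d\<^sup>2)) = 45 * a\<^sup>2 * (100 * (b * d))\<^sup>2" by algebra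
  moreover have "3 * a * b\<^sup>2 = x - 20 * T\<^sup>2" by (simp add: x_def)
  ultimately have rel: "2 * (x - 20 * T\<^sup>2) * (poly (quintic_Z0 e k8 k12 q) T + poly (quintic_Z1 e) T * x) =
      45 * (15 * T + 4 * e) * (poly (quintic_Y0 e k8) T + 18 * x)\<^sup>2"
    unfolding A Y Z by simp
  \<comment> \<open>The multiplier \<open>2 * e + 66 + 9 * T\<close> is chosen to cancel
    \<open>x\<^sup>2\<close>, whose coefficient in the first summand is \<open>- 1800\<close> times
    it. What is left is linear in \<open>x\<close>.\<close>
  have "poly (quintic_g0 e k8 k12 q) T + poly (quintic_g1 e k8 k12 q) T * x =
      6 * (2 * (x - 20 * T\<^sup>2) * (poly (quintic_Z0 e k8 k12 q) T + poly (quintic_Z1 e) T * x) -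
        45 * (15 * T + 4 * e) * (poly (quintic_Y0 e k8) T + 18 * x)\<^sup>2) +
      (2 * e + 66 + 9 * T) * (1800 * x\<^sup>2 - (poly (quintic_r0 e k8 q) T + poly (quintic_r1 e) T * x))"
    unfolding quintic_g0_def quintic_g1_def quintic_Y0_def quintic_Z0_def quintic_Z1_def quintic_r0_def
      quintic_r1_def by (simp, algebra)
  thus "poly (quintic_g0 e k8 k12 q) T + poly (quintic_g1 e k8 k12 q) T * x = 0"
    unfolding rel R by simp
qed

text \<open>The root \<open>T\<close> depends on the quintic, while the two polynomials depend on
  \<open>e\<close>, \<open>k8\<close>, \<open>k12\<close>, \<open>k20\<close> and \<open>q\<close>
  only. Two quintics with equal spectra thus provide common roots of the same pair.\<close>

lemma quintic_common_root:
  fixes a b c d :: "'a::field_char_0"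
  assumes e: "e = 4 * a ^ 2 - 15 * c"
    and k8: "k8 = quintic_k8 a b c d"
    and k12: "k12 = quintic_k12 a b c d"
    and k20: "k20 = quintic_k20 a b c d"
    and q: "q = quintic_q a b (c + 1) d"
  defines "T \<equiv> 4 * c - a\<^sup>2"
  shows "poly (quintic_G e k8 k12 q) T = 0" "poly (quintic_F e k8 k12 k20 q) T = 0"
proof -
  define x where "x = 3 * a * b\<^sup>2 + 20 * T\<^sup>2"
  note rel = quintic_relations[OF e k8 k12 q, folded T_def, folded x_def]
  define u where "u = poly (quintic_g1 e k8 k12 q) T"
  have u0: "poly (quintic_g0 e k8 k12 q) T = - u * x" using rel(7) by (simp only: u_def eq_neg_iff_add_eq_0 mult_minus_left)
  have "poly (quintic_G e k8 k12 q) T =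
      u\<^sup>2 * (1800 * x\<^sup>2 - (poly (quintic_r0 e k8 q) T + poly (quintic_r1 e) T * x))"
    by (simp add: quintic_G_def Let_def u0 flip: u_def) (simp add: algebra_simps power2_eq_square)
  thus "poly (quintic_G e k8 k12 q) T = 0" using rel(6) by simp
  \<comment> \<open>Substituting \<open>x = - g0 / g1\<close> and clearing \<open>g1\<close>, which
    has the value \<open>u\<close> at \<open>T\<close>, turns the auxiliary polynomials of
    \<open>quintic_F\<close> into \<open>u\<close> times monomials in \<open>a\<close>,
    \<open>b\<close>, \<open>d\<close>. The equation for \<open>k20\<close> is taken times
    \<open>a\<^sup>2\<close> because \<open>d ^ 4\<close> can then be reached as
    \<open>(a d\<^sup>2)\<^sup>2\<close>; the factor \<open>360000\<close> clears
    denominators.\<close>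
  have hats: "poly [:4 * e, 15:] T = a\<^sup>2" "poly [:e, 4:] T = c"
    "poly [:0, 0, - 20:] T * u - poly (quintic_g0 e k8 k12 q) T = u * (3 * a * b\<^sup>2)"
    "poly (quintic_Y0 e k8) T * u - 18 * poly (quintic_g0 e k8 k12 q) T = u * (100 * (b * d))"
    "poly (quintic_W0 e k8 q) T * u - poly (quintic_W1 e) T * poly (quintic_g0 e k8 k12 q) T =
      u * (16200 * b ^ 4)"
    "poly (quintic_Z0 e k8 k12 q) T * u - poly (quintic_Z1 e) T * poly (quintic_g0 e k8 k12 q) T =
      u * (75000 * (a * d\<^sup>2))"
    using rel(1,2) unfolding rel(3-5)
    by (simp_all add: u0) (simp_all add: x_def algebra_simps power2_eq_square)
  show "poly (quintic_F e k8 k12 k20 q) T = 0"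
    unfolding quintic_F_def Let_def poly_add poly_diff poly_mult poly_smult poly_power u_def[symmetric] hats k20
    by algebra
qed

text \<open>The values of the invariants at \<open>z\<^sup>5 + z\<^sup>3 + z\<close>.\<close>

lemma quintic_special:
  fixes e k8 k12 k20 q :: "'a::field_char_0"
  assumes "e = 4" "k8 = 8" "k12 = 16" "k20 = 64" "q = 29475"
  shows "quintic_g0 e k8 k12 q = [:80140800, 464488800, 482494000, 108000000:]"
    and "quintic_g1 e k8 k12 q = [:14027200, 17697000, 4162500:]"
    and "quintic_G e k8 k12 q = [:2714320060416000000, 10793832532992000000, 16760648065536000000,
    12644085173760000000, 4626155980800000000, 679406400000000000, 16200000000000000:]"
    and "quintic_F e k8 k12 k20 q = [:- 57637886894303330304000000, - 335187526323856785408000000, -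
    825979117655898169344000000, - 1116247761116856483840000000, - 892106650697439513600000000,
    - 421494440570964864000000000, - 109714386644997120000000000, - 12798397560960000000000000,
    - 290083680000000000000000:]"
proof -
  show g: "quintic_g0 e k8 k12 q = [:80140800, 464488800, 482494000, 108000000:]"
    "quintic_g1 e k8 k12 q = [:14027200, 17697000, 4162500:]"
    by (simp_all add: quintic_g0_def quintic_g1_def assms)
  show "quintic_G e k8 k12 q = [:2714320060416000000, 10793832532992000000, 16760648065536000000, 12644085173760000000,
      4626155980800000000, 679406400000000000, 16200000000000000:]"
    unfolding quintic_G_def Let_def g by (simp add: quintic_r0_def quintic_r1_def assms)
  have hats: "[:4 * e, 15:] = [:16, 15:]" "[:e, 4:] = [:4, 4:]"
    "[:0, 0, - 20:] * quintic_g1 e k8 k12 q - quintic_g0 e k8 k12 q = [:- 80140800, - 464488800, - 763038000, - 461940000, - 83250000:]"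
    "quintic_Y0 e k8 * quintic_g1 e k8 k12 q - smult 18 (quintic_g0 e k8 k12 q) = [:- 1554752000, - 8053504000, - 12640592000, - 7473840000, - 1332000000:]"
    "quintic_W0 e k8 q * quintic_g1 e k8 k12 q - quintic_W1 e * quintic_g0 e k8 k12 q =
      [:39415680000, 462317760000, 1561524480000, 2093558400000, 1154736000000, 199800000000:]"
    "quintic_Z0 e k8 k12 q * quintic_g1 e k8 k12 q - quintic_Z1 e * quintic_g0 e k8 k12 q =
      [:- 10649669760000, - 60092214720000, - 122302973760000, - 114145804800000, - 48478176000000, - 7192800000000:]"
    unfolding g by (simp_all add: quintic_Y0_def quintic_W0_def quintic_W1_def quintic_Z0_def
        quintic_Z1_def assms)
  show "quintic_F e k8 k12 k20 q = [:- 57637886894303330304000000, - 335187526323856785408000000, - 825979117655898169344000000, -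
      1116247761116856483840000000, - 892106650697439513600000000, -
      421494440570964864000000000, - 109714386644997120000000000, - 12798397560960000000000000,
      - 290083680000000000000000:]"
    unfolding quintic_F_def Let_def hats unfolding g unfolding assms(4)
    by (simp add: eval_nat_numeral)
qed

text \<open>Integer Bezout certificates; the scalar factors are invertible in characteristic zero.
  The root \<open>- 1\<close> is the value of \<open>T\<close> at \<open>a = 1\<close>,
  \<open>c = 0\<close>.\<close>

lemma quintic_bezout:
  fixes e k8 k12 k20 q :: "'a::field_char_0"
  assumes "e = 4" "k8 = 8" "k12 = 16" "k20 = 64" "q = 29475"
  shows "\<exists>U V. U * quintic_F e k8 k12 k20 q + V * quintic_G e k8 k12 q = [:- (- 1), 1:]"
    and "\<exists>U V. U * quintic_g0 e k8 k12 q + V * quintic_g1 e k8 k12 q = 1"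
proof -
  note s = quintic_special[OF assms]
  have "[:1065999627246245976164058620917771632353136,
    2152094715970628382021686524356634818708951, 1349002027696944067400692394886311411287440,
    265223326543958232745878061765955106738750, 6648393918493067924447579590961130703125:] *
    quintic_F e k8 k12 k20 q + [:22636227384917784089716738280332876147746727159984,
    87322171753887128474982881506279074991134050387304,
    131769141099114808318264801172394683606948015032660,
    96847804458265025385581423188362606935979420495150,
    34654587454972497101194861322450409565153385616000,
    5008841350519561973562166698551294521786596750000,
    119048800862104271482328139187586390822437500000:] * quintic_G e k8 k12 q = smult
    138431717146349659358146827854494329544710201999360000000000 [:1, 1:]"
    (is "?U * _ + ?V * _ = smult ?n _") unfolding s by simp
  hence "smult (1 / ?n) (?U * quintic_F e k8 k12 k20 q + ?V * quintic_G e k8 k12 q) = [:- (- 1), 1:]"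
    by simp
  thus "\<exists>U V. U * quintic_F e k8 k12 k20 q + V * quintic_G e k8 k12 q = [:- (- 1), 1:]"
    unfolding smult_add_right mult_smult_left[symmetric] by blast
  have "[:3402468275760, 1087884901125:] * quintic_g0 e k8 k12 q + [:- 19423828128992, -
    94377273178620, - 28226202840000:] * quintic_g1 e k8 k12 q = smult 214607663030425600 1"
    (is "?U * _ + ?V * _ = smult ?n _") unfolding s by simp
  hence "smult (1 / ?n) (?U * quintic_g0 e k8 k12 q + ?V * quintic_g1 e k8 k12 q) = 1"
    by simp
  thus "\<exists>U V. U * quintic_g0 e k8 k12 q + V * quintic_g1 e k8 k12 q = 1"
    unfolding smult_add_right mult_smult_left[symmetric] by blast
qed

section \<open>Degree bounds and recovery of the quintic from its invariants\<close>

definition bounded_degree :: "('s \<Rightarrow> 'a::field poly) \<Rightarrow> bool" where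
  "bounded_degree F \<longleftrightarrow> (\<exists>n. \<forall>s. degree (F s) \<le> n)"

lemma bounded_degreeI: "(\<And>s. degree (F s) \<le> n) \<Longrightarrow> bounded_degree F"
  by (auto simp: bounded_degree_def)

lemma bounded_degree_add: "bounded_degree F \<Longrightarrow> bounded_degree G \<Longrightarrow> bounded_degree (\<lambda>s. F s + G s)"
  unfolding bounded_degree_def by (meson degree_add_le le_trans max.cobounded1 max.cobounded2)

lemma bounded_degree_diff: "bounded_degree F \<Longrightarrow> bounded_degree G \<Longrightarrow> bounded_degree (\<lambda>s. F s - G s)"
  unfolding bounded_degree_def by (meson degree_diff_le le_trans max.cobounded1 max.cobounded2)

lemma bounded_degree_mult: "bounded_degree F \<Longrightarrow> bounded_degree G \<Longrightarrow> bounded_degree (\<lambda>s. F s * G s)"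
  unfolding bounded_degree_def by (meson add_mono degree_mult_le le_trans)

lemma bounded_degree_const: "bounded_degree (\<lambda>_. p)"
  by (auto simp: bounded_degree_def)

lemma bounded_degree_power: "bounded_degree F \<Longrightarrow> bounded_degree (\<lambda>s. F s ^ n)"
  by (induction n) (simp_all add: bounded_degree_const bounded_degree_mult)

lemma bounded_degree_smult: "bounded_degree F \<Longrightarrow> bounded_degree (\<lambda>s. smult (f s) (F s))"
  unfolding bounded_degree_def by (meson degree_smult_le le_trans)

lemma bounded_degree_pCons:
  assumes "bounded_degree F"
  shows "bounded_degree (\<lambda>s. pCons (f s) (F s))"
proof -
  obtain n where "\<And>s. degree (F s) \<le> n" using assms by (auto simp: bounded_degree_def)
  hence "degree (pCons (f s) (F s)) \<le> Suc n" for s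
    by (meson Suc_le_mono degree_pCons_le le_trans)
  thus ?thesis by (rule bounded_degreeI)
qed

lemmas bounded_degree_intros = bounded_degree_const bounded_degree_add bounded_degree_diff
  bounded_degree_mult bounded_degree_power bounded_degree_smult bounded_degree_pCons

text \<open>For \<open>quintic_F\<close> any uniform bound will do, but here the bound has to be
  sharp: the coefficient at the bound must not vanish at the special point.\<close>

lemma quintic_G_degree: "degree (quintic_G e k8 k12 q) \<le> 6"
proof -
  have m: "degree (p * r) \<le> i + j" if "degree p \<le> i" "degree r \<le> j" for p r :: "'a poly" and i j
    using degree_mult_le[of p r] that by linarith
  have d: "degree (quintic_g0 e k8 k12 q) \<le> 3" "degree (quintic_g1 e k8 k12 q) \<le> 2"
    "degree (quintic_r0 e k8 q) \<le> 2" "degree (quintic_r1 e) \<le> 1"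
    unfolding quintic_g0_def quintic_g1_def quintic_r0_def quintic_r1_def
    by (simp_all only: degree_pCons_eq_if degree_0) simp_all
  note t = m[OF d(1,1)] m[OF d(4) m[OF d(1,2)]] m[OF d(3) m[OF d(2,2)]]
  show ?thesis unfolding quintic_G_def Let_def
    by (intro degree_diff_le degree_add_le order.trans[OF degree_smult_le])
      (use t in simp_all)
qed

text \<open>Scaling by a fourth root of unity \<open>w\<close> multiplies \<open>a\<close>,
  \<open>b\<close>, \<open>d\<close> by \<open>w\<^sup>2\<close>, \<open>w\<close>,
  \<open>1 / w\<close>. The factor \<open>w\<close> is read off from \<open>b\<close>, from
  \<open>d\<close> if \<open>b = 0\<close>, and from \<open>a\<close> if both vanish. The value of
  \<open>d ^ 4\<close> is required only for \<open>a = 0\<close>, as otherwise it follows from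
  \<open>a\<^sup>2\<close> and \<open>a d\<^sup>2\<close>.\<close>

lemma quintic_scaling:
  fixes a b c d a' b' d' :: "'a::{alg_closed_field, field_char_0}"
  assumes a2: "a'\<^sup>2 = a\<^sup>2" and ab: "a' * b'\<^sup>2 = a * b\<^sup>2" and bd: "b' * d' = b * d"
    and b4: "b' ^ 4 = b ^ 4" and ad: "a' * d'\<^sup>2 = a * d\<^sup>2" and d4: "a = 0 \<Longrightarrow> d' ^ 4 = d ^ 4"
  obtains w where "w ^ 4 = 1" "b' = w * b" "a' = w\<^sup>2 * a" "w * d' = d"
proof (cases "b = 0")
  case False
  define w where "w = b' / b"
  have w: "w ^ 4 = 1" "b' = w * b" using False b4 by (simp_all add: w_def power_divide)
  have "(w\<^sup>2 * a') * b\<^sup>2 = a * b\<^sup>2" using ab by (simp add: w(2) power_mult_distrib ac_simps)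
  hence "w\<^sup>2 * a' = a" using False by simp
  moreover have "w\<^sup>2 * (w\<^sup>2 * a') = w ^ 4 * a'" by (simp add: eval_nat_numeral)
  ultimately have "a' = w\<^sup>2 * a" using w(1) by simp
  moreover have "b * (w * d') = b * d" using bd by (simp add: w(2) ac_simps)
  hence "w * d' = d" using False by simp
  ultimately show ?thesis using that w by blast
next
  case b: True
  hence b': "b' = 0" using b4 by simp
  show ?thesis
  proof (cases "d = 0")
    case False
    show ?thesis
    proof (cases "a = 0")
      case True
      hence "a' = 0" "d' ^ 4 = d ^ 4" using a2 d4 by simp_all
      moreover from this have "d' \<noteq> 0" using False by auto
      ultimately show ?thesis using that[of "d / d'"] False True b b'
        by (simp add: power_divide)
    next
      case a: False
      hence d': "d' \<noteq> 0" using ad False by auto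
      define w where "w = d / d'"
      have wd: "w * d' = d" using d' by (simp add: w_def)
      have "a' * d'\<^sup>2 = (w\<^sup>2 * a) * d'\<^sup>2"
        using ad unfolding wd[symmetric] by (simp add: power_mult_distrib ac_simps)
      hence wa: "a' = w\<^sup>2 * a" using d' by simp
      have "w ^ 4 * a\<^sup>2 = a\<^sup>2" using a2 unfolding wa by (simp add: power_mult_distrib flip: power_mult)
      hence "w ^ 4 = 1" using a by simp
      thus ?thesis using that[of w] wd wa b b' by simp
    qed
  next
    case d: True
    show ?thesis
    proof (cases "a = 0")
      case True
      hence "a' = 0" "d' = 0" using a2 d4 d by simp_all
      thus ?thesis using that[of 1] True b b' d by simp
    next
      case a: False
      hence "a' \<noteq> 0" using a2 by auto
      hence d': "d' = 0" using ad d by simp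
      have "a' = a \<or> a' = - a" using a2 by (simp add: power2_eq_iff)
      thus ?thesis
      proof
        assume "a' = a"
        thus ?thesis using that[of 1] b b' d d' by simp
      next
        assume neg: "a' = - a"
        \<comment> \<open>Only \<open>a\<close> is nonzero here, and its sign is changed by
          \<open>w\<^sup>2 = - 1\<close>.\<close>
        obtain i :: 'a where i: "i\<^sup>2 = - 1" using nth_root_exists[of 2 "- 1"] by auto
        have "i ^ 4 = (i\<^sup>2)\<^sup>2" by (simp flip: power_mult)
        thus ?thesis using that[of i] i neg b b' d d' by simp
      qed
    qed
  qed
qed

lemma generic_injectivity_degree_5:
  "\<exists>U :: 'a::{alg_closed_field, field_char_0} list set. U \<noteq> {} \<and>
    open_dense_in ((5 + 1) + (5\<^sup>2 + 1)) (tau2 5 ` poly_moduli 5) U \<and>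
    (\<forall>Q\<in>U. \<exists>!c. c \<in> poly_moduli 5 \<and> tau2 5 c = Q)"
proof -
  define N :: nat where "N = (5 + 1) + (5\<^sup>2 + 1)"
  define p where "p = (\<lambda>m (Q :: 'a list). fix_psum m Q)"
  define e where "e = (\<lambda>Q. p 1 Q - 5)"
  define k8 where "k8 = (\<lambda>Q. p 2 Q - 2 * p 1 Q + 5)"
  define k12 where "k12 = (\<lambda>Q. p 3 Q - 3 * p 2 Q + 3 * p 1 Q - 5)"
  define k20 where "k20 = (\<lambda>Q. p 5 Q - 5 * p 4 Q + 10 * p 3 Q - 10 * p 2 Q + 5 * p 1 Q - 5)"
  define q where "q = (\<lambda>Q :: 'a list. 25 + per_psum 5 1 Q + per_psum 5 2 Q)"
  note defs = e_def k8_def k12_def k20_def q_def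
  have regular: "e \<in> regular_funs N" "k8 \<in> regular_funs N" "k12 \<in> regular_funs N"
    "k20 \<in> regular_funs N" "q \<in> regular_funs N"
    unfolding defs p_def N_def
    by (intro regular.intros regular_fix_psum regular_per_psum; simp)+
  define G where "G = (\<lambda>Q. quintic_G (e Q) (k8 Q) (k12 Q) (q Q))"
  define F where "F = (\<lambda>Q. quintic_F (e Q) (k8 Q) (k12 Q) (k20 Q) (q Q))"
  define g0 where "g0 = (\<lambda>Q. quintic_g0 (e Q) (k8 Q) (k12 Q) (q Q))"
  define g1 where "g1 = (\<lambda>Q. quintic_g1 (e Q) (k8 Q) (k12 Q) (q Q))"
  have "regular.poly_fam N g0" "regular.poly_fam N g1"
    unfolding g0_def g1_def quintic_g0_def quintic_g1_def
    by (intro regular.fam_intros regular.intros regular)+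
  moreover have "regular.poly_fam N G"
    unfolding G_def quintic_G_def Let_def quintic_g0_def quintic_g1_def quintic_r0_def quintic_r1_def
    by (intro regular.fam_intros regular.intros regular)
  moreover have "regular.poly_fam N F"
    unfolding F_def quintic_F_def Let_def quintic_g0_def quintic_g1_def quintic_Y0_def quintic_W0_def
      quintic_W1_def quintic_Z0_def quintic_Z1_def
    by (intro regular.fam_intros regular.intros regular)
  ultimately have fam: "regular.poly_fam N F" "regular.poly_fam N G"
    "regular.poly_fam N g0" "regular.poly_fam N g1" by blast+
  have "bounded_degree F"
    unfolding F_def quintic_F_def Let_def quintic_g0_def quintic_g1_def quintic_Y0_def quintic_W0_def
      quintic_W1_def quintic_Z0_def quintic_Z1_def
    by (intro bounded_degree_intros)
  then obtain m where degF: "\<And>Q. degree (F Q) \<le> m" by (auto simp: bounded_degree_def)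
  have degG: "degree (G Q) \<le> 6" for Q unfolding G_def by (rule quintic_G_degree)
  have degg: "degree (g0 Q) \<le> 3" "degree (g1 Q) \<le> 2" for Q
    unfolding g0_def g1_def quintic_g0_def quintic_g1_def by simp_all
  have val: "e (sigma_poly 5 H) = 4 * a ^ 2 - 15 * c"
    "k8 (sigma_poly 5 H) = quintic_k8 a b c d"
    "k12 (sigma_poly 5 H) = quintic_k12 a b c d"
    "k20 (sigma_poly 5 H) = quintic_k20 a b c d"
    "q (sigma_poly 5 H) = quintic_q a b (c + 1) d"
    if H: "H = [:d, c + 1, b, a, 0, 1:]" for H :: "'a poly" and a b c d
  proof -
    have mc: "monic_centered 5 H" by (simp add: monic_centered_def H eval_nat_numeral)
    have P: "H - [:0, 1:] = [:d, c, b, a, 0, 1:]" by (simp add: H)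
    have five: "of_nat 5 = (5 :: 'a)" by simp
    note r = spec_relations[OF mc, unfolded P residues_quintic five]
    have "2 \<le> (5::nat)" "4 \<le> (5::nat)" by simp_all
    note r = r(1-3)[OF this(1)] r(4)[OF this(1,2)]
    show "e (sigma_poly 5 H) = 4 * a ^ 2 - 15 * c"
      "k8 (sigma_poly 5 H) = quintic_k8 a b c d"
      "k12 (sigma_poly 5 H) = quintic_k12 a b c d"
      "k20 (sigma_poly 5 H) = quintic_k20 a b c d"
      unfolding r e_def k8_def k12_def k20_def p_def by (rule refl)+
    have "per_psum 5 1 (sigma_poly 5 H) = psum 1 (spec (H \<circ>\<^sub>p H))"
      "per_psum 5 2 (sigma_poly 5 H) = psum 2 (spec (H \<circ>\<^sub>p H))"
      by (rule per_psum_sigma_poly; simp)+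
    thus "q (sigma_poly 5 H) = quintic_q a b (c + 1) d"
      by (simp only: q_def second_iterate_quintic[of d "c + 1" b a, folded H])
  qed
  \<comment> \<open>With \<open>b = d = 0\<close> the invariants are small integers. The entry
    \<open>0 + 1\<close> matches the pattern \<open>c + 1\<close>.\<close>
  define H0 :: "'a poly" where "H0 = [:0, 0 + 1, 0, 1, 0, 1:]"
  define Q0 where "Q0 = sigma_poly 5 H0"
  have Q0: "e Q0 = 4" "k8 Q0 = 8" "k12 Q0 = 16" "k20 Q0 = 64" "q Q0 = 29475"
    unfolding Q0_def val[OF H0_def] by simp_all
  have lead: "coeff (G Q0) 6 \<noteq> 0" "coeff (g1 Q0) 2 \<noteq> 0"
    unfolding G_def g1_def quintic_special[OF Q0] by (simp_all add: eval_nat_numeral)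
  obtain U V U' V' where bezout: "U * F Q0 + V * G Q0 = [:- (- 1), 1:]" "U' * g0 Q0 + V' * g1 Q0 = 1"
    using quintic_bezout[OF Q0] unfolding F_def G_def g0_def g1_def by blast
  have "m + 6 > 0" by simp
  from regular.generic_unique_root[OF fam(1,2) degF degG lead(1) bezout(1) this]
  obtain D1 where D1: "D1 \<in> regular_funs N" "D1 Q0 \<noteq> 0"
    "\<forall>Q t t'. D1 Q \<noteq> 0 \<longrightarrow> poly (F Q) t = 0 \<longrightarrow> poly (G Q) t = 0 \<longrightarrow>
      poly (F Q) t' = 0 \<longrightarrow> poly (G Q) t' = 0 \<longrightarrow> t = t'"
    by (elim bexE conjE) (rule that)
  from regular.generic_coprime[OF fam(3,4) degg lead(2) bezout(2)]
  obtain D2 where D2: "D2 \<in> regular_funs N" "D2 Q0 \<noteq> 0"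
    "\<forall>Q t. D2 Q \<noteq> 0 \<longrightarrow> poly (g0 Q) t = 0 \<longrightarrow> poly (g1 Q) t \<noteq> 0"
    by (elim bexE conjE) (rule that)
  show ?thesis
  \<comment> \<open>\<open>D1\<close> makes the common root \<open>T\<close> unique;
    \<open>D2\<close> excludes a common zero of \<open>g0\<close> and \<open>g1\<close>, so that the
    linear relation determines \<open>x\<close> from \<open>T\<close>.\<close>
  proof (rule generic_injectivity_criterion[where D = "\<lambda>Q. D1 Q * D2 Q"])
    show "(\<lambda>Q. D1 Q * D2 Q) \<in> regular_funs ((5 + 1) + (5\<^sup>2 + 1))"
      using regular.mult[OF D1(1) D2(1)] unfolding N_def .
    show "monic_centered 5 H0" by (simp add: monic_centered_def H0_def eval_nat_numeral)
    show "D1 (sigma_poly 5 H0) * D2 (sigma_poly 5 H0) \<noteq> 0" using D1(2) D2(2) by (simp add: Q0_def)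
    fix H H' :: "'a poly"
    assume H: "monic_centered 5 H" "monic_centered 5 H'"
      and D: "D1 (sigma_poly 5 H) * D2 (sigma_poly 5 H) \<noteq> 0" and eq: "sigma_poly 5 H = sigma_poly 5 H'"
    obtain a b c1 d a' b' c1' d' where "H = [:d, c1, b, a, 0, 1:]" "H' = [:d', c1', b', a', 0, 1:]"
      using H by (metis monic_centered_5)
    moreover define c c' where "c = c1 - 1" and "c' = c1' - 1"
    ultimately have abc: "H = [:d, c + 1, b, a, 0, 1:]" "H' = [:d', c' + 1, b', a', 0, 1:]" by simp_all
    define Q where "Q = sigma_poly 5 H"
    note v = val[OF abc(1), folded Q_def] and v' = val[OF abc(2), folded eq, folded Q_def]
    have nz: "D1 Q \<noteq> 0" "D2 Q \<noteq> 0" using D by (auto simp: Q_def)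
    define T where "T = 4 * c - a\<^sup>2"
    define x where "x = 3 * a * b\<^sup>2 + 20 * T\<^sup>2"
    define T' where "T' = 4 * c' - a'\<^sup>2"
    define x' where "x' = 3 * a' * b'\<^sup>2 + 20 * T'\<^sup>2"
    note rel = quintic_relations[OF v(1,2,3,5), folded T_def, folded x_def]
    note rel' = quintic_relations[OF v'(1,2,3,5), folded T'_def, folded x'_def]
    note root = quintic_common_root[OF v, folded T_def] quintic_common_root[OF v', folded T'_def]
    have T: "T' = T"
      using D1(3)[rule_format, OF nz(1), of T' T] root unfolding F_def G_def by simp
    \<comment> \<open>If \<open>g1\<close> vanished at \<open>T\<close>, then so would
      \<open>g0\<close> by the linear relation.\<close>
    have "poly (g1 Q) T \<noteq> 0"
    proof
      assume z: "poly (g1 Q) T = 0"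
      hence "poly (g0 Q) T = 0" using rel(7) unfolding g0_def g1_def by simp
      thus False using D2(3) nz(2) z by blast
    qed
    moreover have "poly (g0 Q) T + poly (g1 Q) T * x = poly (g0 Q) T + poly (g1 Q) T * x'"
      using rel(7) rel'(7) unfolding T g0_def g1_def by simp
    ultimately have x: "x' = x" by simp
    have c: "c' = c" using rel(2) rel'(2) T by simp
    have a2: "a'\<^sup>2 = a\<^sup>2" using rel(1) rel'(1) T by simp
    have ab: "a' * b'\<^sup>2 = a * b\<^sup>2" using x T by (simp add: x_def x'_def mult.assoc)
    have "100 * (b' * d') = 100 * (b * d)" unfolding rel(3) rel'(3) T x ..
    hence bd: "b' * d' = b * d" by simp
    have "16200 * b' ^ 4 = 16200 * b ^ 4" unfolding rel(4) rel'(4) T x ..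
    hence b4: "b' ^ 4 = b ^ 4" by simp
    have "75000 * (a' * d'\<^sup>2) = 75000 * (a * d\<^sup>2)" unfolding rel(5) rel'(5) T x ..
    hence ad: "a' * d'\<^sup>2 = a * d\<^sup>2" by simp
    \<comment> \<open>For \<open>a = 0\<close> every term of \<open>k20\<close> other than the one
      in \<open>d ^ 4\<close> is a function of \<open>b d\<close>, \<open>b ^ 4\<close> and
      \<open>c\<close>, which are already known to agree.\<close>
    have d4: "d' ^ 4 = d ^ 4" if a0: "a = 0"
    proof -
      have a0': "a' = 0" using a2 a0 by simp
      have expand: "k20 Q = 7290 * (b ^ 4 * (b * d)) + 19440 * b ^ 4 * c ^ 2 - 101250 * (b * d)\<^sup>2 * c - 74250 * (b * d) * c ^ 3 - 4095 * c ^ 5 + 15625 * d ^ 4"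
        unfolding v(4) a0 by (simp add: eval_nat_numeral)
      have "k20 Q = 7290 * (b' ^ 4 * (b' * d')) + 19440 * b' ^ 4 * c' ^ 2 - 101250 * (b' * d')\<^sup>2 * c' - 74250 * (b' * d') * c' ^ 3 - 4095 * c' ^ 5 + 15625 * d' ^ 4"
        unfolding v'(4) a0' by (simp add: eval_nat_numeral)
      thus ?thesis unfolding expand bd b4 c by simp
    qed
    obtain w where w: "w ^ 4 = 1" "b' = w * b" "a' = w\<^sup>2 * a" "w * d' = d"
      using quintic_scaling[OF a2 ab bd b4 ad d4] .
    show "pclass 5 H = pclass 5 H'"
    proof (rule pclass_scale[where w = w])
      show "w \<noteq> 0" using w(1) by auto
      fix i :: nat assume "i \<le> 5"
      hence "i = 0 \<or> i = 1 \<or> i = 2 \<or> i = 3 \<or> i = 4 \<or> i = 5" by arith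
      moreover have "w ^ 5 = w" using w(1) by (simp add: eval_nat_numeral)
      ultimately show "w * coeff H' i = w ^ i * coeff H i"
        unfolding abc by (elim disjE) (simp_all add: c w(2,3,4), simp_all add: eval_nat_numeral)
    qed (simp_all add: abc)
  qed simp
qed

theorem theorem4:
  fixes k :: nat
  assumes "k \<in> {2, 3, 4, 5}"
  shows "\<exists>U :: 'a::{alg_closed_field, field_char_0} list set.
           U \<noteq> {} \<and>
           open_dense_in ((k + 1) + (k ^ 2 + 1)) (tau2 k ` poly_moduli k) U \<and>
           (\<forall>Q\<in>U. \<exists>!c. c \<in> poly_moduli k \<and> tau2 k c = Q)"
  using assms generic_injectivity_degree_2 generic_injectivity_degree_3 generic_injectivity_degree_4 generic_injectivity_degree_5
  by (elim insertE emptyE; simp only:)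

end
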